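(* Let $L=(L,d,[\cdot,\cdot])$ be a differential graded Lie algebra with $d$ of degree $+1$, and let $\eta:L\to L$ be a map of degree $-1$ with $d\eta d=d$, $\eta^2=0$ and $\eta d\eta=\eta$. Put $[d,\eta]=d\eta+\eta d$, $H:=\ker[d,\eta]$ and $g:=\eta\circ[\cdot,\cdot]$, and equip $H$ with the $L_\infty$-structure $\mu_*$ given by $\mu_1=0$ and $$\mu_n=\Bigl(\frac{-1}{2}\Bigr)^{n-1}\sum_{\phi\in\mathrm{Ot}(n)}e(\phi)\,\phi\bigl((1-[d,\eta])[\cdot,\cdot],g,\dots,g\bigr)\circ\alpha_n\qquad(n\ge2).$$ Then the following anti-symmetric maps $f_n:H^{\otimes n}\to L$ of degree $1-n$ define an $L_\infty$-equivalence (i.e. an $L_\infty$-quasi-isomorphism) $(H,\mu_* )\to(L,d,[\cdot,\cdot])$: $$f_1:=\text{inclusion},\qquad f_2:=-g,\qquad f_n:=-\Bigl(\frac{-1}{2}\Bigr)^{n-1}\sum_{\phi\in\mathrm{Ot}(n)}e(\phi)\,\phi(g,\dots,g)\circ\alpha_n\quad(n\ge2).$$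
   Context: Conventions. $k$ is a commutative ring containing $\mathbb{Q}$; modules are $\mathbb{Z}$-graded $k$-modules, maps are $k$-linear, and the Koszul sign rule $(f\otimes g)(a\otimes b)=(-1)^{|g||a|}f(a)\otimes g(b)$ is used. For $\sigma\in\Sigma_n$ and homogeneous $a_1,\dots,a_n$, $\chi(\sigma)$ is defined by $a_{\sigma(1)}\wedge\cdots\wedge a_{\sigma(n)}=\chi(\sigma)\,a_1\wedge\cdots\wedge a_n$ in the graded exterior algebra ($a\wedge b=-(-1)^{|a||b|}b\wedge a$), and $\alpha_n(a_1\otimes\cdots\otimes a_n)=\sum_{\sigma\in\Sigma_n}\chi(\sigma)\,a_{\sigma(1)}\otimes\cdots\otimes a_{\sigma(n)}$. $\mathrm{Sh}(k,n)$ is the set of $\sigma\in\Sigma_n$ with $\sigma(1)<\dots<\sigma(k)$ and $\sigma(k+1)<\dots<\sigma(n)$. $L_\infty$-algebras and morphisms. An $L_\infty$-algebra (with $\mu_0=0$) is a graded module with graded anti-symmetric maps $\mu_n$ of degree $2-n$, $n\ge1$, such that for all $n\ge 1$ $$\sum_{k+l=n+1}\sum_{\sigma\in\mathrm{Sh}(k,n)}(-1)^{k(l-1)}\chi(\sigma)\mu_l(\mu_k(a_{\sigma(1)},\dots,a_{\sigma(k)}),a_{\sigma(k+1)},\dots,a_{\sigma(n)})=0.$$ A differential graded Lie algebra is an $L_\infty$-algebra with $\mu_1=d$, $\mu_2=[\cdot,\cdot]$, $\mu_n=0$ for $n\ge3$. An $L_\infty$-morphism from $(H,\mu_* )$ to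 a differential graded Lie algebra $(L,d,[\cdot,\cdot])$ is a sequence of graded anti-symmetric maps $f_n:H^{\otimes n}\to L$ of degree $1-n$, $n\ge1$, such that for all $n\ge 1$ and homogeneous $a_1,\dots,a_n\in H$ $$d f_n(a_1,\dots,a_n)-\sum_{i+j=n}\sum_\sigma\chi(\sigma)(-1)^{i+(j-1)(|a_{\sigma(1)}|+\cdots+|a_{\sigma(i)}|)}[f_i(a_{\sigma(1)},\dots,a_{\sigma(i)}),f_j(a_{\sigma(i+1)},\dots,a_{\sigma(n)})]$$ $$=\sum_{k+l=n+1}\sum_{\sigma\in\mathrm{Sh}(k,n)}(-1)^{k(l-1)}\chi(\sigma)f_l(\mu_k(a_{\sigma(1)},\dots,a_{\sigma(k)}),a_{\sigma(k+1)},\dots,a_{\sigma(n)}),$$ where all indices $i,j,k,l$ are $\ge1$ and the second sum on the left runs over all $\sigma\in\mathrm{Sh}(i,n)$ with $\sigma(1)<\sigma(i+1)$. It is an $L_\infty$-quasi-isomorphism if $f_1$ is a quasi-isomorphism of differential graded modules $(H,\mu_1)\to(L,d)$. Trees. $\mathrm{Ot}(n)$ is the set of (equivalence classes of) oriented trees with $n$ leaves, i.e. planar rooted binary trees with $n$ leaves and $n-1$ ramifications (internal vertices), each ramification having exactly one left and one right child; leaves are numbered $1,\dots,n$ from left to right, and the tree $\tau$ with one leaf has no ramification. For a leaf $i$ of $\phi$, $w_\phi(i)$ is the number of left steps on the path from the root to leaf $i$ (equivalently, the number of ramifications preceding leaf $i$ in the depth-first left-to-right order in which a vertex precedes its descendants,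 minus $i-1$). For $n\ge2$, $e(\phi):=(-1)^{w_\phi(1)+\cdots+w_\phi(n)}$, and $e(\tau):=1$. Given a family $B=(b_K)$ of bilinear maps $L\otimes L\to L$ indexed by the ramifications of $\phi$, $\phi(B):L^{\otimes n}\to L$ is defined recursively: $\tau(\emptyset)=\mathrm{Id}$, and if $\phi$ has root $K_0$ with left subtree $\phi_1$ and right subtree $\phi_2$, then $\phi(B)=b_{K_0}\circ(\phi_1(B_1)\otimes\phi_2(B_2))$, with $B_1,B_2$ the restricted families. $\phi(b_0,g,\dots,g)$ means that the root carries $b_0$ and every other ramification carries $g$; $\phi(g,\dots,g)$ means that every ramification carries $g$. The operator $[d,\eta]$ is a projection, so $1-[d,\eta]$ is a projection of $L$ onto $H$.
   Formalization: The sign e(φ) is corrected to (-1)^n·(-1)^{w_φ(1)+…+w_φ(n)} for n≥2 (e(τ)=1 unchanged): with the printed e(φ) the morphism equation fails at n=3, where μ_3 gets the wrong sign. For even n the formulas are unchanged. *)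

theory Defs
  imports Complex_Main "HOL-Library.Tree" "HOL-Combinatorics.Permutations"
begin

section \<open>Koszul signs and shuffles\<close>

text \<open>Signs are integers; they act on a \<open>k\<close>-module through \<open>of_int\<close>. Tuples
  \<open>(a_1, ..., a_n)\<close> are lists, so indices start at 0, and
  \<open>permute_list \<sigma> xs\<close> is the list \<open>(a_\<sigma>(1), ..., a_\<sigma>(n))\<close>. The list \<open>ds\<close> contains
  the degrees of the entries.\<close>

definition ksign :: "int \<Rightarrow> int" where
  "ksign m = (if even m then 1 else - 1)"

text \<open>The sign \<open>\<chi>(\<sigma>)\<close> with
  \<open>a_\<sigma>(1) \<and> ... \<and> a_\<sigma>(n) = \<chi>(\<sigma>) a_1 \<and> ... \<and> a_n\<close>: each inversion contributes
  one factor \<open>-(-1)^(|a||b|)\<close>. See \<open>chi_wedge\<close> below.\<close>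

definition chi :: "int list \<Rightarrow> (nat \<Rightarrow> nat) \<Rightarrow> int" where
  "chi ds \<sigma> = (\<Prod>(i, j)\<in>{(i, j). i < j \<and> j < length ds \<and> \<sigma> j < \<sigma> i}.
                 - ksign (ds ! \<sigma> i * ds ! \<sigma> j))"

lemma wedge_insort:
  fixes w :: "nat \<Rightarrow> 'r::ring_1"
  assumes "\<And>y. y \<in> set ys \<Longrightarrow> w x * w y = of_int (c x y) * (w y * w x)"
    and "sorted ys" "x \<notin> set ys"
  shows "w x * prod_list (map w ys) =
         of_int (\<Prod>y\<leftarrow>filter (\<lambda>y. y < x) ys. c x y) * prod_list (map w (insort x ys))"
  using assms
proof (induction ys)
  case (Cons y ys)
  show ?case
  proof (cases "x \<le> y")
    case True
    with Cons.prems have "filter (\<lambda>y. y < x) (y # ys) = []"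
      by (auto simp: filter_empty_conv)
    with True show ?thesis by simp
  next
    case False
    have IH: "w x * prod_list (map w ys) =
       of_int (\<Prod>y\<leftarrow>filter (\<lambda>y. y < x) ys. c x y) * prod_list (map w (insort x ys))"
      using Cons by auto
    have "w x * prod_list (map w (y # ys)) = (w x * w y) * prod_list (map w ys)"
      by (simp add: mult.assoc)
    also have "\<dots> = of_int (c x y) * (w y * w x) * prod_list (map w ys)"
      using Cons.prems by simp
    also have "\<dots> = of_int (c x y) * (w y * (w x * prod_list (map w ys)))"
      by (simp add: mult.assoc)
    also have "\<dots> = of_int (c x y) * (w y * of_int (\<Prod>y\<leftarrow>filter (\<lambda>y. y < x) ys. c x y))
        * prod_list (map w (insort x ys))"
      by (simp only: IH mult.assoc)
    also have "\<dots> = of_int (c x y) * (of_int (\<Prod>y\<leftarrow>filter (\<lambda>y. y < x) ys. c x y) * w y)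
        * prod_list (map w (insort x ys))"
      by (simp only: mult_of_int_commute)
    also have "\<dots> = of_int (\<Prod>y\<leftarrow>filter (\<lambda>y. y < x) (y # ys). c x y)
        * prod_list (map w (insort x (y # ys)))"
      using False by (simp add: mult.assoc)
    finally show ?thesis .
  qed
qed simp

lemma wedge_sort:
  fixes w :: "nat \<Rightarrow> 'r::ring_1"
  assumes "\<And>x y. x \<in> set js \<Longrightarrow> y \<in> set js \<Longrightarrow> x \<noteq> y \<Longrightarrow>
             w x * w y = of_int (c x y) * (w y * w x)"
    and "distinct js"
  shows "prod_list (map w js) =
    of_int (\<Prod>(i, j)\<in>{(i, j). i < j \<and> j < length js \<and> js ! j < js ! i}. c (js ! i) (js ! j))
      * prod_list (map w (sort js))"
  using assms
proof (induction js)
  case (Cons x xs)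
  define P where "P = {(i, j). i < j \<and> j < length xs \<and> xs ! j < xs ! i}"
  define Q where "Q = {j. j < length xs \<and> xs ! j < x}"
  let ?f = "\<lambda>js (i, j). (c (js ! i) (js ! j) :: int)"
  have fin: "finite P" "finite Q"
    by (rule finite_subset[of _ "{..<length xs} \<times> {..<length xs}"]) (auto simp: P_def Q_def)
  have eq: "{(i, j). i < j \<and> j < length (x # xs) \<and> (x # xs) ! j < (x # xs) ! i} =
      map_prod Suc Suc ` P \<union> (\<lambda>j. (0, Suc j)) ` Q" (is "?S = _")
  proof (intro set_eqI, safe)
    fix i j assume *: "i < j" "j < length (x # xs)" "(x # xs) ! j < (x # xs) ! i"
      "(i, j) \<notin> (\<lambda>j. (0, Suc j)) ` Q"
    then obtain j' where j: "j = Suc j'" by (cases j) auto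
    show "(i, j) \<in> map_prod Suc Suc ` P"
    proof (cases i)
      case 0 with * j show ?thesis by (auto simp: Q_def)
    next
      case (Suc i') with * j show ?thesis by (auto simp: P_def)
    qed
  qed (auto simp: P_def Q_def)
  have "(\<Prod>p\<in>?S. ?f (x # xs) p) =
      (\<Prod>p\<in>map_prod Suc Suc ` P. ?f (x # xs) p) * (\<Prod>p\<in>(\<lambda>j. (0, Suc j)) ` Q. ?f (x # xs) p)"
    unfolding eq using fin by (intro prod.union_disjoint) auto
  also have "(\<Prod>p\<in>map_prod Suc Suc ` P. ?f (x # xs) p) = (\<Prod>p\<in>P. ?f xs p)"
    by (subst prod.reindex) (auto simp: inj_on_def intro!: prod.cong)
  also have "(\<Prod>p\<in>(\<lambda>j. (0, Suc j)) ` Q. ?f (x # xs) p) = (\<Prod>j\<in>Q. c x (xs ! j))"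
    by (subst prod.reindex) (auto simp: inj_on_def)
  also have "(\<Prod>j\<in>Q. c x (xs ! j)) = (\<Prod>y\<in>{y \<in> set xs. y < x}. c x y)"
  proof -
    have "inj_on ((!) xs) Q"
      using Cons.prems(2) by (auto simp: Q_def inj_on_def nth_eq_iff_index_eq)
    moreover have "(!) xs ` Q = {y \<in> set xs. y < x}"
      by (fastforce simp: Q_def in_set_conv_nth)
    ultimately show ?thesis
      by (metis (mono_tags, lifting) comp_apply prod.cong prod.reindex)
  qed
  also have "\<dots> = (\<Prod>y\<leftarrow>filter (\<lambda>y. y < x) (sort xs). c x y)"
    using Cons.prems(2) by (subst prod.distinct_set_conv_list[symmetric]) auto
  finally have split: "(\<Prod>p\<in>?S. ?f (x # xs) p) =
      (\<Prod>p\<in>P. ?f xs p) * (\<Prod>y\<leftarrow>filter (\<lambda>y. y < x) (sort xs). c x y)" .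
  have IH: "prod_list (map w xs) = of_int (\<Prod>p\<in>P. ?f xs p) * prod_list (map w (sort xs))"
    unfolding P_def
  proof (rule Cons.IH)
    show "w a * w b = of_int (c a b) * (w b * w a)"
      if "a \<in> set xs" "b \<in> set xs" "a \<noteq> b" for a b
      by (rule Cons.prems(1)) (use that in simp_all)
  qed (use Cons.prems(2) in simp)
  have ins: "w x * prod_list (map w (sort xs)) =
     of_int (\<Prod>y\<leftarrow>filter (\<lambda>y. y < x) (sort xs). c x y) * prod_list (map w (insort x (sort xs)))"
  proof (rule wedge_insort)
    show "w x * w y = of_int (c x y) * (w y * w x)" if "y \<in> set (sort xs)" for y
      by (rule Cons.prems(1)) (use that Cons.prems(2) in auto)
  qed (use Cons.prems(2) in simp_all)
  define A where "A = (\<Prod>p\<in>P. ?f xs p)"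
  define B where "B = (\<Prod>y\<leftarrow>filter (\<lambda>y. y < x) (sort xs). c x y)"
  have "prod_list (map w (x # xs)) = w x * of_int A * prod_list (map w (sort xs))"
    using IH[folded A_def] by (simp only: list.map prod_list.Cons mult.assoc)
  also have "w x * of_int A = of_int A * w x"
    by (rule mult_of_int_commute[symmetric])
  also have "of_int A * w x * prod_list (map w (sort xs)) =
      of_int (A * B) * prod_list (map w (insort x (sort xs)))"
    using ins[folded B_def] by (simp only: of_int_mult mult.assoc)
  finally show ?case
    unfolding split A_def B_def sort_key_simps .
qed simp

lemma chi_wedge:
  fixes w :: "nat \<Rightarrow> 'r::ring_1"
  assumes "\<And>i j. i < length ds \<Longrightarrow> j < length ds \<Longrightarrow> i \<noteq> j \<Longrightarrow>
             w i * w j = - of_int (ksign (ds ! i * ds ! j)) * (w j * w i)"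
    and \<sigma>: "\<sigma> permutes {..<length ds}"
  shows "prod_list (map (\<lambda>i. w (\<sigma> i)) [0..<length ds]) =
         of_int (chi ds \<sigma>) * prod_list (map w [0..<length ds])"
proof -
  let ?js = "map \<sigma> [0..<length ds]"
  have set: "set ?js = {..<length ds}"
    using permutes_image[OF \<sigma>] by (simp add: lessThan_atLeast0)
  have dist: "distinct ?js"
    using permutes_inj[OF \<sigma>] by (simp add: distinct_map inj_on_def)
  have "sort ?js = [0..<length ds]"
    by (rule sorted_distinct_set_unique) (use set dist in auto)
  moreover have "(\<Prod>(i, j)\<in>{(i, j). i < j \<and> j < length ?js \<and> ?js ! j < ?js ! i}.
      - ksign (ds ! (?js ! i) * ds ! (?js ! j))) = chi ds \<sigma>"
    unfolding chi_def by (rule prod.cong) auto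
  moreover have "prod_list (map w ?js) =
    of_int (\<Prod>(i, j)\<in>{(i, j). i < j \<and> j < length ?js \<and> ?js ! j < ?js ! i}.
       - ksign (ds ! (?js ! i) * ds ! (?js ! j))) * prod_list (map w (sort ?js))"
  proof (rule wedge_sort)
    show "w i * w j = of_int (- ksign (ds ! i * ds ! j)) * (w j * w i)"
      if "i \<in> set ?js" "j \<in> set ?js" "i \<noteq> j" for i j
      using assms(1)[of i j] that set by auto
  qed (fact dist)
  ultimately show ?thesis by (simp add: comp_def)
qed

definition Sh :: "nat \<Rightarrow> nat \<Rightarrow> (nat \<Rightarrow> nat) set" where
  "Sh k n = {\<sigma>. \<sigma> permutes {..<n} \<and> strict_mono_on {..<k} \<sigma> \<and> strict_mono_on {k..<n} \<sigma>}"


section \<open>Graded modules and graded maps\<close>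

text \<open>A \<open>\<int>\<close>-graded module is a submodule \<open>M\<close> of the ambient module that is the
  internal direct sum of the submodules \<open>G p\<close> (\<open>p\<close> an integer).\<close>

definition is_decomp :: "(int \<Rightarrow> 'v::ab_group_add set) \<Rightarrow> 'v \<Rightarrow> (int \<Rightarrow> 'v) \<Rightarrow> bool" where
  "is_decomp G x c \<longleftrightarrow>
     finite {p. c p \<noteq> 0} \<and> (\<forall>p. c p \<in> G p) \<and> x = (\<Sum>p\<in>{p. c p \<noteq> 0}. c p)"

locale graded_module = module scale
  for scale :: "'k::comm_ring_1 \<Rightarrow> 'v::ab_group_add \<Rightarrow> 'v" +
  fixes M :: "'v set" and G :: "int \<Rightarrow> 'v set"
  assumes subspace_carrier: "subspace M"
    and subspace_grade: "\<And>p. subspace (G p)"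
    and grade_subset: "\<And>p. G p \<subseteq> M"
    and direct_sum: "\<And>x. x \<in> M \<Longrightarrow> \<exists>!c. is_decomp G x c"

definition hcomp :: "(int \<Rightarrow> 'v::ab_group_add set) \<Rightarrow> 'v \<Rightarrow> int \<Rightarrow> 'v" where
  "hcomp G x = (THE c. is_decomp G x c)"

definition homog :: "(int \<Rightarrow> 'v set) \<Rightarrow> int list \<Rightarrow> 'v list \<Rightarrow> bool" where
  "homog G ds xs \<longleftrightarrow> list_all2 (\<lambda>p x. x \<in> G p) ds xs"

text \<open>Linear maps \<open>M^(\<otimes> n) \<rightarrow> N\<close> are multilinear maps on lists of length \<open>n\<close>.\<close>

definition multilinear ::
  "('k \<Rightarrow> 'v \<Rightarrow> 'v) \<Rightarrow> 'v::plus set \<Rightarrow> ('k \<Rightarrow> 'w \<Rightarrow> 'w) \<Rightarrow> 'w::plus set \<Rightarrow> nat \<Rightarrow> ('v list \<Rightarrow> 'w) \<Rightarrow> bool"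
  where
  "multilinear sM M sN N n F \<longleftrightarrow>
     (\<forall>xs. length xs = n \<and> set xs \<subseteq> M \<longrightarrow> F xs \<in> N \<and>
        (\<forall>i<n. \<forall>x\<in>M. \<forall>y\<in>M. \<forall>r.
           F (xs[i := x + y]) = F (xs[i := x]) + F (xs[i := y]) \<and>
           F (xs[i := sM r x]) = sN r (F (xs[i := x]))))"

definition graded_multilinear ::
  "('k \<Rightarrow> 'v \<Rightarrow> 'v) \<Rightarrow> 'v::plus set \<Rightarrow> (int \<Rightarrow> 'v set) \<Rightarrow>
   ('k \<Rightarrow> 'w \<Rightarrow> 'w) \<Rightarrow> 'w::plus set \<Rightarrow> (int \<Rightarrow> 'w set) \<Rightarrow> nat \<Rightarrow> int \<Rightarrow> ('v list \<Rightarrow> 'w) \<Rightarrow> bool"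
  where
  "graded_multilinear sM M GM sN N GN n q F \<longleftrightarrow>
     multilinear sM M sN N n F \<and>
     (\<forall>ds xs. length xs = n \<and> homog GM ds xs \<longrightarrow> F xs \<in> GN (sum_list ds + q))"

definition graded_antisymmetric ::
  "(int \<Rightarrow> 'v set) \<Rightarrow> ('k::comm_ring_1 \<Rightarrow> 'w \<Rightarrow> 'w) \<Rightarrow> nat \<Rightarrow> ('v list \<Rightarrow> 'w) \<Rightarrow> bool" where
  "graded_antisymmetric GM sN n F \<longleftrightarrow>
     (\<forall>ds xs \<sigma>. length xs = n \<and> homog GM ds xs \<and> \<sigma> permutes {..<n} \<longrightarrow>
        F (permute_list \<sigma> xs) = sN (of_int (chi ds \<sigma>)) (F xs))"


section \<open>\<open>L\<^sub>\<infinity>\<close>-algebras and morphisms\<close>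

text \<open>The sum over \<open>k + l = n + 1\<close> and \<open>\<sigma> \<in> Sh(k,n)\<close> of the terms
  \<open>(-1)^(k(l-1)) \<chi>(\<sigma>) F_l(\<mu>_k(a_\<sigma>(1), ..., a_\<sigma>(k)), a_\<sigma>(k+1), ..., a_\<sigma>(n))\<close>.\<close>

definition insertion_sum ::
  "('k::comm_ring_1 \<Rightarrow> 'w::ab_group_add \<Rightarrow> 'w) \<Rightarrow> (nat \<Rightarrow> 'v list \<Rightarrow> 'w) \<Rightarrow> (nat \<Rightarrow> 'v list \<Rightarrow> 'v) \<Rightarrow>
   int list \<Rightarrow> 'v list \<Rightarrow> 'w" where
  "insertion_sum sN F \<mu> ds xs =
     (\<Sum>(k, l)\<in>{(k, l). 1 \<le> k \<and> 1 \<le> l \<and> k + l = length xs + 1}. \<Sum>\<sigma>\<in>Sh k (length xs).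
        sN (of_int ((- 1) ^ (k * (l - 1)) * chi ds \<sigma>))
           (F l (\<mu> k (take k (permute_list \<sigma> xs)) # drop k (permute_list \<sigma> xs))))"

definition Linf_algebra ::
  "('k::comm_ring_1 \<Rightarrow> 'v::ab_group_add \<Rightarrow> 'v) \<Rightarrow> 'v set \<Rightarrow> (int \<Rightarrow> 'v set) \<Rightarrow> (nat \<Rightarrow> 'v list \<Rightarrow> 'v) \<Rightarrow> bool"
  where
  "Linf_algebra scale M G \<mu> \<longleftrightarrow>
     graded_module scale M G \<and>
     (\<forall>n\<ge>1. graded_multilinear scale M G scale M G n (2 - int n) (\<mu> n) \<and>
            graded_antisymmetric G scale n (\<mu> n)) \<and>
     (\<forall>n\<ge>1. \<forall>ds xs. length xs = n \<and> homog G ds xs \<longrightarrow> insertion_sum scale \<mu> \<mu> ds xs = 0)"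

definition dgla_maps ::
  "('v \<Rightarrow> 'v) \<Rightarrow> ('v \<Rightarrow> 'v \<Rightarrow> 'v) \<Rightarrow> nat \<Rightarrow> 'v list \<Rightarrow> 'v::zero" where
  "dgla_maps d br n xs =
     (if n = 1 then d (xs ! 0) else if n = 2 then br (xs ! 0) (xs ! 1) else 0)"

definition dg_lie_algebra ::
  "('k::comm_ring_1 \<Rightarrow> 'v::ab_group_add \<Rightarrow> 'v) \<Rightarrow> 'v set \<Rightarrow> (int \<Rightarrow> 'v set) \<Rightarrow>
   ('v \<Rightarrow> 'v) \<Rightarrow> ('v \<Rightarrow> 'v \<Rightarrow> 'v) \<Rightarrow> bool" where
  "dg_lie_algebra scale L G d br \<longleftrightarrow> Linf_algebra scale L G (dgla_maps d br)"

text \<open>The bracket terms of the morphism equation. With 0-based indices the condition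
  \<open>\<sigma>(1) < \<sigma>(i+1)\<close> reads \<open>\<sigma> 0 < \<sigma> i\<close>.\<close>

definition bracket_sum ::
  "('k::comm_ring_1 \<Rightarrow> 'w::ab_group_add \<Rightarrow> 'w) \<Rightarrow> ('w \<Rightarrow> 'w \<Rightarrow> 'w) \<Rightarrow> (nat \<Rightarrow> 'v list \<Rightarrow> 'w) \<Rightarrow>
   int list \<Rightarrow> 'v list \<Rightarrow> 'w" where
  "bracket_sum sN br f ds xs =
     (\<Sum>(i, j)\<in>{(i, j). 1 \<le> i \<and> 1 \<le> j \<and> i + j = length xs}.
      \<Sum>\<sigma>\<in>{\<sigma> \<in> Sh i (length xs). \<sigma> 0 < \<sigma> i}.
        sN (of_int (chi ds \<sigma> *
              ksign (int i + (int j - 1) * sum_list (take i (permute_list \<sigma> ds)))))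
           (br (f i (take i (permute_list \<sigma> xs))) (f j (drop i (permute_list \<sigma> xs)))))"

definition Linf_morphism ::
  "('k::comm_ring_1 \<Rightarrow> 'v::ab_group_add \<Rightarrow> 'v) \<Rightarrow> 'v set \<Rightarrow> (int \<Rightarrow> 'v set) \<Rightarrow> (nat \<Rightarrow> 'v list \<Rightarrow> 'v) \<Rightarrow>
   ('k \<Rightarrow> 'w::ab_group_add \<Rightarrow> 'w) \<Rightarrow> 'w set \<Rightarrow> (int \<Rightarrow> 'w set) \<Rightarrow> ('w \<Rightarrow> 'w) \<Rightarrow> ('w \<Rightarrow> 'w \<Rightarrow> 'w) \<Rightarrow>
   (nat \<Rightarrow> 'v list \<Rightarrow> 'w) \<Rightarrow> bool" where
  "Linf_morphism sH H GH \<mu> sL L GL d br f \<longleftrightarrow>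
     Linf_algebra sH H GH \<mu> \<and> dg_lie_algebra sL L GL d br \<and>
     (\<forall>n\<ge>1. graded_multilinear sH H GH sL L GL n (1 - int n) (f n) \<and>
            graded_antisymmetric GH sL n (f n)) \<and>
     (\<forall>n\<ge>1. \<forall>ds xs. length xs = n \<and> homog GH ds xs \<longrightarrow>
        d (f n xs) - bracket_sum sL br f ds xs = insertion_sum sL f \<mu> ds xs)"

definition coh_rel :: "(int \<Rightarrow> 'v set) \<Rightarrow> ('v::ab_group_add \<Rightarrow> 'v) \<Rightarrow> int \<Rightarrow> ('v \<times> 'v) set" where
  "coh_rel G d p =
     {(x, y). x \<in> G p \<and> y \<in> G p \<and> d x = 0 \<and> d y = 0 \<and> x - y \<in> d ` G (p - 1)}"

definition cohomology :: "(int \<Rightarrow> 'v set) \<Rightarrow> ('v::ab_group_add \<Rightarrow> 'v) \<Rightarrow> int \<Rightarrow> 'v set set" where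
  "cohomology G d p = {x \<in> G p. d x = 0} // coh_rel G d p"

definition quasi_isomorphism ::
  "('k \<Rightarrow> 'v \<Rightarrow> 'v) \<Rightarrow> 'v::ab_group_add set \<Rightarrow> (int \<Rightarrow> 'v set) \<Rightarrow> ('v \<Rightarrow> 'v) \<Rightarrow>
   ('k \<Rightarrow> 'w \<Rightarrow> 'w) \<Rightarrow> 'w::ab_group_add set \<Rightarrow> (int \<Rightarrow> 'w set) \<Rightarrow> ('w \<Rightarrow> 'w) \<Rightarrow> ('v \<Rightarrow> 'w) \<Rightarrow> bool"
  where
  "quasi_isomorphism sM M GM dM sN N GN dN f \<longleftrightarrow>
     graded_multilinear sM M GM sN N GN 1 0 (\<lambda>xs. f (xs ! 0)) \<and>
     (\<forall>x\<in>M. f (dM x) = dN (f x)) \<and>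
     (\<forall>p. bij_betw (\<lambda>c. coh_rel GN dN p `` (f ` c)) (cohomology GM dM p) (cohomology GN dN p))"

definition Linf_quasi_isomorphism ::
  "('k::comm_ring_1 \<Rightarrow> 'v::ab_group_add \<Rightarrow> 'v) \<Rightarrow> 'v set \<Rightarrow> (int \<Rightarrow> 'v set) \<Rightarrow> (nat \<Rightarrow> 'v list \<Rightarrow> 'v) \<Rightarrow>
   ('k \<Rightarrow> 'w::ab_group_add \<Rightarrow> 'w) \<Rightarrow> 'w set \<Rightarrow> (int \<Rightarrow> 'w set) \<Rightarrow> ('w \<Rightarrow> 'w) \<Rightarrow> ('w \<Rightarrow> 'w \<Rightarrow> 'w) \<Rightarrow>
   (nat \<Rightarrow> 'v list \<Rightarrow> 'w) \<Rightarrow> bool" where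
  "Linf_quasi_isomorphism sH H GH \<mu> sL L GL d br f \<longleftrightarrow>
     Linf_morphism sH H GH \<mu> sL L GL d br f \<and>
     quasi_isomorphism sH H GH (\<lambda>x. \<mu> 1 [x]) sL L GL d (\<lambda>x. f 1 [x])"


section \<open>Oriented trees\<close>

text \<open>Oriented trees are unlabelled planar binary trees; \<open>size1\<close> counts leaves.\<close>

definition Ot :: "nat \<Rightarrow> unit tree set" where
  "Ot n = {\<phi>. size1 \<phi> = n}"

text \<open>The list \<open>(w_\<phi>(1), ..., w_\<phi>(n))\<close>: numbers of left steps from the root to the leaves.\<close>

primrec left_steps :: "'a tree \<Rightarrow> nat list" where
  "left_steps \<langle>\<rangle> = [0]"
| "left_steps \<langle>l, _, r\<rangle> = map Suc (left_steps l) @ left_steps r"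

text \<open>Sign convention: every leaf contributes \<open>(-1)^(w + 1)\<close>, where \<open>w\<close> is its number of left
  steps; so \<open>e(\<phi>)\<close> is \<open>(-1)^n\<close> times the sign \<open>(-1)^(w(1) + ... + w(n))\<close> (the two agree for
  even \<open>n\<close>). Without the factor \<open>(-1)^n\<close> the formulas for \<open>\<mu>_n\<close> and \<open>f_n\<close> below, with
  \<open>f_1\<close> the inclusion, violate the morphism equation at \<open>n = 3\<close>: for \<open>a \<in> H\<close> of degree 1 and
  \<open>P = 1 - [d,\<eta>]\<close>, applying \<open>P\<close> to that equation at \<open>(a, a, a)\<close> gives
  \<open>\<mu>_3(a,a,a) = -3 P[a, f_2(a,a)] = 3 P[a, \<eta>[a,a]]\<close>, whereas the tree sum without the
  factor is \<open>-3 P[a, \<eta>[a,a]]\<close>.\<close>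

definition tree_sign :: "'a tree \<Rightarrow> int" where
  "tree_sign \<phi> = (if \<phi> = \<langle>\<rangle> then 1 else (- 1) ^ (\<Sum>w\<leftarrow>left_steps \<phi>. w + 1))"

text \<open>A family of bilinear maps indexed by the ramifications of a tree is a labelling of the tree;
  each map is labelled together with its degree, which enters the Koszul sign of
  \<open>\<phi>_1(B_1) \<otimes> \<phi>_2(B_2)\<close>.\<close>

primrec tree_deg :: "(int \<times> 'b) tree \<Rightarrow> int" where
  "tree_deg \<langle>\<rangle> = 0"
| "tree_deg \<langle>l, b, r\<rangle> = tree_deg l + fst b + tree_deg r"

primrec tree_eval ::
  "('k::comm_ring_1 \<Rightarrow> 'v \<Rightarrow> 'v) \<Rightarrow> (int \<times> ('v \<Rightarrow> 'v \<Rightarrow> 'v)) tree \<Rightarrow> int list \<Rightarrow> 'v list \<Rightarrow> 'v" where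
  "tree_eval scale \<langle>\<rangle> ds xs = hd xs"
| "tree_eval scale \<langle>l, b, r\<rangle> ds xs =
     scale (of_int (ksign (tree_deg r * sum_list (take (size1 l) ds))))
       (snd b (tree_eval scale l (take (size1 l) ds) (take (size1 l) xs))
              (tree_eval scale r (drop (size1 l) ds) (drop (size1 l) xs)))"

text \<open>The labellings \<open>\<phi>(g, ..., g)\<close> and \<open>\<phi>(b, g, ..., g)\<close>.\<close>

definition label_all :: "'b \<Rightarrow> 'a tree \<Rightarrow> 'b tree" where
  "label_all g \<phi> = map_tree (\<lambda>_. g) \<phi>"

primrec label_root :: "'b \<Rightarrow> 'b \<Rightarrow> 'a tree \<Rightarrow> 'b tree" where
  "label_root b g \<langle>\<rangle> = \<langle>\<rangle>"
| "label_root b g \<langle>l, _, r\<rangle> = \<langle>label_all g l, b, label_all g r\<rangle>"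

text \<open>Multilinear extension of a map given on homogeneous arguments (with their degrees) to
  arbitrary arguments, by decomposing each argument into its homogeneous components.\<close>

definition homog_extension ::
  "(int \<Rightarrow> 'v::ab_group_add set) \<Rightarrow> (int list \<Rightarrow> 'v list \<Rightarrow> 'v) \<Rightarrow> 'v list \<Rightarrow> 'v" where
  "homog_extension G F xs =
     (\<Sum>ds\<in>listset (map (\<lambda>x. {p. hcomp G x p \<noteq> 0}) xs). F ds (map2 (hcomp G) xs ds))"

text \<open>The composite \<open>\<phi>(B) \<circ> \<alpha>_n\<close> for a labelled tree.\<close>

definition tree_alt ::
  "('k::comm_ring_1 \<Rightarrow> 'v::ab_group_add \<Rightarrow> 'v) \<Rightarrow> (int \<Rightarrow> 'v set) \<Rightarrow>
   (int \<times> ('v \<Rightarrow> 'v \<Rightarrow> 'v)) tree \<Rightarrow> 'v list \<Rightarrow> 'v" where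
  "tree_alt scale G B =
     homog_extension G (\<lambda>ds xs. \<Sum>\<sigma>\<in>{\<sigma>. \<sigma> permutes {..<length xs}}.
       scale (of_int (chi ds \<sigma>)) (tree_eval scale B (permute_list \<sigma> ds) (permute_list \<sigma> xs)))"


section \<open>The transferred structure\<close>

definition ker_comm :: "('v::ab_group_add \<Rightarrow> 'v) \<Rightarrow> ('v \<Rightarrow> 'v) \<Rightarrow> 'v set" where
  "ker_comm d \<eta> = {x. d (\<eta> x) + \<eta> (d x) = 0}"

definition proj_comm :: "('v::ab_group_add \<Rightarrow> 'v) \<Rightarrow> ('v \<Rightarrow> 'v) \<Rightarrow> 'v \<Rightarrow> 'v" where
  "proj_comm d \<eta> x = x - (d (\<eta> x) + \<eta> (d x))"

text \<open>\<open>\<rho>\<close> is the inclusion of the rationals into \<open>k\<close>. Only the values for \<open>n \<ge> 1\<close> matter.\<close>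

definition transfer_mu ::
  "(rat \<Rightarrow> 'k::comm_ring_1) \<Rightarrow> ('k \<Rightarrow> 'v::ab_group_add \<Rightarrow> 'v) \<Rightarrow> (int \<Rightarrow> 'v set) \<Rightarrow>
   ('v \<Rightarrow> 'v) \<Rightarrow> ('v \<Rightarrow> 'v \<Rightarrow> 'v) \<Rightarrow> ('v \<Rightarrow> 'v) \<Rightarrow> nat \<Rightarrow> 'v list \<Rightarrow> 'v" where
  "transfer_mu \<rho> scale G d br \<eta> n xs =
     (if n = 1 then 0
      else scale (\<rho> ((- 1 / 2) ^ (n - 1)))
             (\<Sum>\<phi>\<in>Ot n. scale (of_int (tree_sign \<phi>))
                (tree_alt scale G
                   (label_root (0, \<lambda>x y. proj_comm d \<eta> (br x y)) (- 1, \<lambda>x y. \<eta> (br x y)) \<phi>) xs)))"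

definition transfer_f ::
  "(rat \<Rightarrow> 'k::comm_ring_1) \<Rightarrow> ('k \<Rightarrow> 'v::ab_group_add \<Rightarrow> 'v) \<Rightarrow> (int \<Rightarrow> 'v set) \<Rightarrow>
   ('v \<Rightarrow> 'v \<Rightarrow> 'v) \<Rightarrow> ('v \<Rightarrow> 'v) \<Rightarrow> nat \<Rightarrow> 'v list \<Rightarrow> 'v" where
  "transfer_f \<rho> scale G br \<eta> n xs =
     (if n = 1 then xs ! 0
      else - scale (\<rho> ((- 1 / 2) ^ (n - 1)))
             (\<Sum>\<phi>\<in>Ot n. scale (of_int (tree_sign \<phi>))
                (tree_alt scale G (label_all (- 1, \<lambda>x y. \<eta> (br x y)) \<phi>) xs)))"

end

theory Submission
  imports Defs
begin

text \<open>
  Write \<open>P = 1 - [d, \<eta>]\<close> and let \<open>Q_n\<close> denote the bracket terms of the morphism equation, which reads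
  \<open>d f_n - Q_n = f_n \<circ> \<mu>\<close>, where the right side stands for the insertion sum. If \<open>f_1\<close> is the inclusion
  of \<open>H\<close> and \<open>f_n\<close> has values in the image of \<open>\<eta>\<close> for \<open>n \<ge> 2\<close>, then this equation leaves no choice:
  applying \<open>P\<close> gives \<open>\<mu>_n = - P Q_n\<close>, applying \<open>\<eta>\<close> gives \<open>f_n = \<eta> Q_n\<close>. The proof shows that the
  solution of this recursion satisfies the equations and that the tree formulas solve the
  recursion.

  For the first part everything follows from one identity, \<open>d Q_n = - Q \<circ> \<mu>\<close> (lemma \<open>d_Q\<close>), where
  \<open>Q \<circ> \<mu>\<close> is again an insertion sum. Its image under \<open>\<eta>\<close> is the morphism equation for \<open>n\<close> arguments,
  because \<open>d f_n = d \<eta> Q_n = Q_n - P Q_n - \<eta> d Q_n\<close>; its image under \<open>P\<close> is the \<open>n\<close>-th relation of the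
  \<open>L\<^sub>\<infinity>\<close>-algebra, because \<open>P d = 0\<close>. The identity itself is proved by induction on \<open>n\<close>: the
  Leibniz rule and the morphism equations for fewer arguments express \<open>d Q_n\<close> by brackets of
  \<open>Q\<close> with \<open>f\<close>, which cancel by the Jacobi identity (\<open>Q_jacobi\<close>), and by brackets of \<open>f \<circ> \<mu>\<close> with \<open>f\<close>,
  which form \<open>- Q \<circ> \<mu>\<close> (\<open>Q_after_mu_expand\<close>).

  All signs and shuffles are handled by one operation on lists of elements with degrees,
  \<open>unshuffle\<close>, which sums over the distributions of the entries into two blocks. It is
  defined by recursion on the list, and list induction shows that it is graded cocommutative
  and coassociative (\<open>unshuffle_swap\<close>, \<open>unshuffle_assoc\<close>); the computation above uses nothing else
  about permutations. Sums over shuffles are unshuffle sums by \<open>unshuffle_Sh\<close>.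

  For the second part, cut every tree at its root (\<open>root_sum_rec\<close>). After antisymmetrization, cutting
  a list in two becomes an unshuffle (\<open>alternate_deconcat\<close>), so the antisymmetrized tree sums satisfy
  a recursion over unshuffles (\<open>alternate_root_sum\<close>). It counts each pair of blocks twice, and the
  powers of \<open>- 1/2\<close> correct this (\<open>f_rec\<close>, \<open>tmu_mu\<close>).

  Finally, \<open>H\<close> contains exactly one representative of each cohomology class, so the inclusion is
  a quasi-isomorphism.
\<close>

section \<open>Graded lists and unshuffles\<close>

text \<open>The sign \<open>(-1)^m\<close> acting on an abelian group. Keeping the exponent as an integer turns the
  comparison of signs into a parity check (\<open>sg_cong\<close>).\<close>

definition sg :: "int \<Rightarrow> 'w::ab_group_add \<Rightarrow> 'w" where
  "sg m x = (if even m then x else - x)"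

lemma sg_sg [simp]: "sg m (sg n x) = sg (m + n) x"
  by (simp add: sg_def)

lemma sg_0 [simp]: "sg 0 x = x" "sg m 0 = 0"
  by (simp_all add: sg_def)

lemma sg_add: "sg m (x + y) = sg m x + sg m y"
  by (simp add: sg_def)

lemma sg_minus: "sg m (- x) = - sg m x"
  by (simp add: sg_def)

lemma minus_sg: "- sg m x = sg (m + 1) x"
  by (simp add: sg_def)

lemma sg_cong: "even m = even n \<Longrightarrow> x = y \<Longrightarrow> sg m x = sg n y"
  by (simp add: sg_def)

lemma sg_sum: "sg m (sum F S) = (\<Sum>x\<in>S. sg m (F x))"
  by (simp add: sg_def sum_negf)

lemma sg_additive:
  assumes "additive h" shows "h (sg m x) = sg m (h x)"
proof -
  interpret additive h by fact
  show ?thesis by (simp add: sg_def minus)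
qed

text \<open>In a graded list every entry carries its degree, so that cutting, splitting and permuting the
  list moves the degrees along and no separate list of degrees has to be kept in step.\<close>

type_synonym 'a glist = "(int \<times> 'a) list"

abbreviation len :: "'a glist \<Rightarrow> int" where "len zs \<equiv> int (length zs)"

definition deg :: "'a glist \<Rightarrow> int" where
  "deg zs = sum_list (map fst zs)"

lemma deg_simps [simp]: "deg [] = 0" "deg (z # zs) = fst z + deg zs" "deg (A @ B) = deg A + deg B"
  by (simp_all add: deg_def)

text \<open>The sum over all ways to distribute the entries of a list, without changing their order, into
  two lists. The first entry \<open>z\<close> goes to the left list or to the right one; in the second case it
  has to pass the whole left list \<open>A\<close>, and each step past an entry \<open>a\<close> costs the sign
  \<open>-(-1)^(|a||z|)\<close> of the graded exterior algebra. This is the sum over all \<open>(k, n)\<close>-shuffles with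
  the sign \<open>\<chi>\<close> (lemma \<open>unshuffle_Sh\<close>), in a form on which list induction works.\<close>

primrec unshuffle :: "'a glist \<Rightarrow> ('a glist \<Rightarrow> 'a glist \<Rightarrow> 'w) \<Rightarrow> 'w::ab_group_add" where
  "unshuffle [] F = F [] []"
| "unshuffle (z # zs) F = unshuffle zs (\<lambda>A B. F (z # A) B) +
     unshuffle zs (\<lambda>A B. sg (len A + deg A * fst z) (F A (z # B)))"

lemma unshuffle_cong:
  assumes "\<And>A B. \<lbrakk>length zs = length A + length B; deg zs = deg A + deg B;
     set A \<subseteq> set zs; set B \<subseteq> set zs\<rbrakk> \<Longrightarrow> F A B = F' A B"
  shows "unshuffle zs F = unshuffle zs F'"
  using assms
proof (induction zs arbitrary: F F')
  case (Cons z zs)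
  have 1: "F (z # A) B = F' (z # A) B" "F A (z # B) = F' A (z # B)" if
    "length zs = length A + length B" "deg zs = deg A + deg B"
    "set A \<subseteq> set zs" "set B \<subseteq> set zs" for A B
    by (intro Cons.prems; use that in auto)+
  show ?case unfolding unshuffle.simps
    by (intro arg_cong2[where f="(+)"] Cons.IH) (simp_all add: 1)
qed simp

lemma unshuffle_add: "unshuffle zs (\<lambda>A B. F A B + F' A B) = unshuffle zs F + unshuffle zs F'"
  by (induction zs arbitrary: F F') (simp_all add: sg_add algebra_simps)

lemma unshuffle_additive:
  assumes "additive h" shows "h (unshuffle zs F) = unshuffle zs (\<lambda>A B. h (F A B))"
proof -
  interpret additive h by fact
  show ?thesis by (induction zs arbitrary: F) (simp_all add: add sg_additive[OF assms])
qed

lemma additive_sg: "additive (sg m)" by unfold_locales (rule sg_add)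
lemma additive_uminus: "additive (uminus :: 'a \<Rightarrow> 'a::ab_group_add)" by unfold_locales simp

lemma sg_unshuffle: "sg m (unshuffle zs F) = unshuffle zs (\<lambda>A B. sg m (F A B))"
  by (rule unshuffle_additive[OF additive_sg])

lemma unshuffle_minus: "- (unshuffle zs F) = unshuffle zs (\<lambda>A B. - (F A B))"
  by (rule unshuffle_additive[OF additive_uminus])

lemma unshuffle_zero: "unshuffle zs (\<lambda>A B. 0) = 0"
  by (induction zs) simp_all

text \<open>Graded cocommutativity. The blocks \<open>A\<close> and \<open>B\<close> exchange their places at the cost of
  \<open>-(-1)^(|a||b|)\<close> for each pair of entries.\<close>

lemma unshuffle_swap:
  "unshuffle zs F = unshuffle zs (\<lambda>A B. sg (len A * len B + deg A * deg B) (F B A))"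
proof (induction zs arbitrary: F)
  case (Cons z zs)
  show ?case unfolding unshuffle.simps
    unfolding Cons[of "\<lambda>A B. F (z # A) B"] Cons[of "\<lambda>A B. sg (len A + deg A * fst z) (F A (z # B))"]
    by (subst add.commute, intro arg_cong2[where f="(+)"] unshuffle_cong)
      (simp_all, (rule sg_cong; auto)+)
qed simp

text \<open>Coassociativity: both sides distribute the entries into three blocks, and the sign of an entry
  only depends on the blocks that it passes.\<close>

lemma unshuffle_assoc:
  "unshuffle zs (\<lambda>A C. unshuffle A (\<lambda>A B. F A B C)) = unshuffle zs (\<lambda>A R. unshuffle R (\<lambda>B C. F A B C))"
proof (induction zs arbitrary: F)
  case (Cons z zs)
  have a: "unshuffle zs (\<lambda>A C. sg (len A + deg A * fst z) (unshuffle A (\<lambda>A B. F A B (z # C)))) =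
    unshuffle zs (\<lambda>A C. unshuffle A (\<lambda>A B. sg (len A + len B + (deg A + deg B) * fst z) (F A B (z # C))))"
    unfolding sg_unshuffle by (intro unshuffle_cong) (auto intro!: sg_cong)
  note a = a[unfolded sg_unshuffle]
  show ?case
    by (simp add: unshuffle_add a sg_unshuffle sg_add add.assoc Cons del: sg_sg)
      (simp add: algebra_simps)
qed simp

lemma unshuffle_rotate:
  "unshuffle zs (\<lambda>A C. unshuffle A (\<lambda>A B. F A B C)) =
   unshuffle zs (\<lambda>A C. unshuffle A (\<lambda>A B. sg ((len A + len B) * len C + (deg A + deg B) * deg C) (F C A B)))"
  unfolding unshuffle_assoc
  by (subst unshuffle_swap, simp only: sg_unshuffle, unfold unshuffle_assoc[symmetric])
    (intro unshuffle_cong; auto intro!: sg_cong)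

lemma unshuffle_0I: "(\<And>A B. \<lbrakk>length zs = length A + length B; deg zs = deg A + deg B;
     set A \<subseteq> set zs; set B \<subseteq> set zs\<rbrakk> \<Longrightarrow> F A B = 0) \<Longrightarrow> unshuffle zs F = 0"
  using unshuffle_cong[of zs F "\<lambda>A B. 0"] by (simp add: unshuffle_zero)


section \<open>Transfer along a contraction by recursion\<close>

text \<open>The bracket axioms in the form in which they enter the transfer: the Jacobi identity is cyclic,
  and the scalars are present only through the absence of 2- and 3-torsion, which allows
  sums over unshuffles to be compared after doubling or tripling them.\<close>

locale dg_lie =
  fixes G :: "int \<Rightarrow> 'v::ab_group_add set" and d :: "'v \<Rightarrow> 'v" and br :: "'v \<Rightarrow> 'v \<Rightarrow> 'v"
  assumes d_additive: "additive d"
    and br_additive_left: "additive (\<lambda>x. br x y)"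
    and br_additive_right: "additive (br x)"
    and zero_G: "0 \<in> G p"
    and add_G: "x \<in> G p \<Longrightarrow> y \<in> G p \<Longrightarrow> x + y \<in> G p"
    and minus_G: "x \<in> G p \<Longrightarrow> - x \<in> G p"
    and d_degree: "x \<in> G p \<Longrightarrow> d x \<in> G (p + 1)"
    and br_degree: "x \<in> G p \<Longrightarrow> y \<in> G q \<Longrightarrow> br x y \<in> G (p + q)"
    and d_d: "d (d x) = 0"
    and antisymmetry: "x \<in> G p \<Longrightarrow> y \<in> G q \<Longrightarrow> br x y = - sg (p * q) (br y x)"
    and leibniz: "x \<in> G p \<Longrightarrow> y \<in> G q \<Longrightarrow> d (br x y) = br (d x) y + sg p (br x (d y))"
    and jacobi: "x \<in> G p \<Longrightarrow> y \<in> G q \<Longrightarrow> z \<in> G r \<Longrightarrow>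
      br (br x y) z + sg (r * (p + q)) (br (br z x) y) + sg (p * (q + r)) (br (br y z) x) = 0"
    and double_zero: "(x::'v) + x = 0 \<Longrightarrow> x = 0"
    and triple_zero: "(x::'v) + x + x = 0 \<Longrightarrow> x = 0"
begin

sublocale d: additive d by (rule d_additive)
sublocale brl: additive "\<lambda>x. br x y" for y by (rule br_additive_left)
sublocale brr: additive "br x" for x by (rule br_additive_right)

lemma double_cancel: "x + x = y + y \<Longrightarrow> x = (y::'v)"
  using double_zero[of "x - y"] by (simp add: algebra_simps)

lemma sg_G: "x \<in> G p \<Longrightarrow> sg m x \<in> G p"
  by (simp add: sg_def minus_G)

lemma unshuffle_G: "(\<And>A B. \<lbrakk>length zs = length A + length B; deg zs = deg A + deg B;
     set A \<subseteq> set zs; set B \<subseteq> set zs\<rbrakk> \<Longrightarrow> F A B \<in> G p) \<Longrightarrow> unshuffle zs F \<in> G p"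
proof (induction zs arbitrary: F)
  case (Cons z zs)
  show ?case unfolding unshuffle.simps
    by (intro add_G Cons.IH sg_G Cons.prems) auto
qed simp

text \<open>The bracket terms of the morphism equation. Since the entries of each block keep their order, the
  condition \<open>\<sigma>(1) < \<sigma>(i + 1)\<close> says that the first entry of the list lies in the left block. With
  \<open>i = 1 + len A\<close> and \<open>j = len B\<close> the exponent is \<open>i + (j - 1)(|a_\<sigma>(1)| + ... + |a_\<sigma>(i)|)\<close>.\<close>

primrec half_bracket :: "('v glist \<Rightarrow> 'v) \<Rightarrow> 'v glist \<Rightarrow> 'v" where
  "half_bracket f [] = 0"
| "half_bracket f (z # zs) = unshuffle zs (\<lambda>A B. sg (1 + len A + (len B - 1) * (fst z + deg A))
     (br (f (z # A)) (f B)))"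

end

text \<open>The recursion \<open>f_n = \<eta> Q_n(f)\<close> that determines the transferred morphism, where \<open>Q_n\<close> are the bracket
  terms. It is stated for twice \<open>Q_n\<close>, that is without a condition on the first entry, because this
  is the symmetric form that sums over trees produce. The convention \<open>f [] = 0\<close> makes the terms
  with an empty block vanish, so no block needs to be required nonempty.\<close>

locale transfer = dg_lie +
  fixes \<eta> :: "'a::ab_group_add \<Rightarrow> 'a" and f :: "'a glist \<Rightarrow> 'a"
  assumes \<eta>_additive: "additive \<eta>"
    and d_\<eta>_d: "d (\<eta> (d x)) = d x"
    and \<eta>_d_\<eta>: "\<eta> (d (\<eta> x)) = \<eta> x"
    and \<eta>_\<eta>: "\<eta> (\<eta> x) = 0"
    and \<eta>_degree: "x \<in> G p \<Longrightarrow> \<eta> x \<in> G (p - 1)"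
    and f_Nil: "f [] = 0"
    and f_single: "f [z] = snd z"
    and f_degree': "(\<And>p x. (p, x) \<in> set zs \<Longrightarrow> x \<in> G p) \<Longrightarrow> f zs \<in> G (deg zs + 1 - len zs)"
    and f_eq: "2 \<le> length zs \<Longrightarrow> (\<And>p x. (p, x) \<in> set zs \<Longrightarrow> x \<in> G p) \<Longrightarrow>
       f zs + f zs = \<eta> (unshuffle zs (\<lambda>A B. sg (len A + (len B - 1) * deg A) (br (f A) (f B))))"
    and f_zero: "0 \<in> snd ` set zs \<Longrightarrow> f zs = 0"
begin

sublocale \<eta>: additive \<eta> by (rule \<eta>_additive)

lemma proj_additive: "additive (proj_comm d \<eta>)"
  by unfold_locales (simp add: proj_comm_def d.add \<eta>.add)
sublocale P: additive "proj_comm d \<eta>" by (rule proj_additive)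

lemma proj_d: "proj_comm d \<eta> (d x) = 0"
  by (simp add: proj_comm_def d_\<eta>_d d_d \<eta>.zero)

lemma proj_eq: "proj_comm d \<eta> x = x - d (\<eta> x) - \<eta> (d x)"
  by (simp add: proj_comm_def algebra_simps)

text \<open>As \<open>d \<eta> d = d\<close>, \<open>\<eta> d \<eta> = \<eta>\<close> and \<open>d d = \<eta> \<eta> = 0\<close>, composing \<open>[d, \<eta>]\<close> with \<open>d\<close> or \<open>\<eta>\<close> gives back \<open>d\<close> or \<open>\<eta>\<close>;
  hence the kernel of \<open>[d, \<eta>]\<close> is the intersection of the kernels of \<open>d\<close> and \<open>\<eta>\<close>.\<close>

lemma ker_d: assumes "x \<in> ker_comm d \<eta>" shows "d x = 0"
proof -
  have "d (d (\<eta> x) + \<eta> (d x)) = 0" using assms by (simp add: ker_comm_def d.zero)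
  thus ?thesis by (simp add: d.add d_d d_\<eta>_d)
qed

lemma ker_\<eta>: assumes "x \<in> ker_comm d \<eta>" shows "\<eta> x = 0"
proof -
  have "\<eta> (d (\<eta> x) + \<eta> (d x)) = 0" using assms by (simp add: ker_comm_def \<eta>.zero)
  thus ?thesis by (simp add: \<eta>.add \<eta>_\<eta> \<eta>_d_\<eta>)
qed

lemma kerI: "d x = 0 \<Longrightarrow> \<eta> x = 0 \<Longrightarrow> x \<in> ker_comm d \<eta>"
  by (simp add: ker_comm_def d.zero \<eta>.zero)

lemma proj_ker: "proj_comm d \<eta> x \<in> ker_comm d \<eta>"
  by (rule kerI) (simp_all add: proj_eq d.diff \<eta>.diff d_d d_\<eta>_d \<eta>_\<eta> \<eta>_d_\<eta>)

lemma minus_ker: "x \<in> ker_comm d \<eta> \<Longrightarrow> - x \<in> ker_comm d \<eta>"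
  by (intro kerI) (simp_all add: d.minus \<eta>.minus ker_d ker_\<eta>)

definition homog_ker :: "'a glist \<Rightarrow> bool" where
  "homog_ker zs \<longleftrightarrow> (\<forall>(p, x)\<in>set zs. x \<in> G p \<and> x \<in> ker_comm d \<eta>)"

lemma homog_ker_simps [simp]: "homog_ker []" "homog_ker (z # zs) \<longleftrightarrow> snd z \<in> G (fst z) \<and> snd z \<in> ker_comm d \<eta> \<and> homog_ker zs"
  by (auto simp: homog_ker_def case_prod_unfold)

lemma homog_ker_subset: "homog_ker zs \<Longrightarrow> set A \<subseteq> set zs \<Longrightarrow> homog_ker A"
  by (auto simp: homog_ker_def)

lemma f_degree: "homog_ker zs \<Longrightarrow> f zs \<in> G (deg zs + 1 - len zs)"
  by (rule f_degree') (auto simp: homog_ker_def)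

abbreviation Q :: "'a glist \<Rightarrow> 'a" where "Q \<equiv> half_bracket f"

text \<open>The value \<open>- P Q\<close> is forced: the projection \<open>P\<close> kills \<open>d\<close> and \<open>\<eta>\<close>, so applying it to the
  morphism equation leaves \<open>- P Q = \<mu>\<close>.\<close>

definition \<mu> :: "'a glist \<Rightarrow> 'a" where "\<mu> zs = - proj_comm d \<eta> (Q zs)"

text \<open>The result of \<open>\<mu>_n\<close>, which has degree \<open>2 - n\<close>, as an entry of a graded list.\<close>

definition mu_entry :: "'a glist \<Rightarrow> int \<times> 'a" where "mu_entry A = (deg A + 2 - len A, \<mu> A)"

lemma fst_mu_entry [simp]: "fst (mu_entry A) = deg A + 2 - len A"
  and snd_mu_entry [simp]: "snd (mu_entry A) = \<mu> A"
  by (simp_all add: mu_entry_def)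

lemma Q_single [simp]: "Q [z] = 0"
  by (simp add: f_Nil brr.zero)

lemma \<mu>_Nil [simp]: "\<mu> [] = 0" and \<mu>_single [simp]: "\<mu> [z] = 0"
  by (simp_all add: \<mu>_def P.zero del: half_bracket.simps(2))

lemma Q_degree:
  assumes "homog_ker zs"
  shows "Q zs \<in> G (deg zs + 2 - len zs)"
proof (cases zs)
  case (Cons z ys)
  have "br (f (z # A)) (f B) \<in> G (deg zs + 2 - len zs)"
    if AB: "length ys = length A + length B" "deg ys = deg A + deg B"
      "set A \<subseteq> set ys" "set B \<subseteq> set ys" for A B
  proof -
    have HA: "homog_ker (z # A)" and HB: "homog_ker B"
      using assms AB homog_ker_subset[of zs "z # A"] homog_ker_subset[of zs B] by (auto simp: Cons)
    have "br (f (z # A)) (f B) \<in> G ((deg (z # A) + 1 - len (z # A)) + (deg B + 1 - len B))"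
      by (intro br_degree f_degree HA HB)
    also have "(deg (z # A) + 1 - len (z # A)) + (deg B + 1 - len B) = deg zs + 2 - len zs"
      using AB by (simp add: Cons)
    finally show ?thesis .
  qed
  then show ?thesis unfolding Cons half_bracket.simps by (intro unshuffle_G sg_G) simp
qed (simp add: zero_G)

lemma proj_degree: assumes "x \<in> G p" shows "proj_comm d \<eta> x \<in> G p"
proof -
  have "d (\<eta> x) \<in> G p" "\<eta> (d x) \<in> G p"
    using d_degree[OF \<eta>_degree[OF assms]] \<eta>_degree[OF d_degree[OF assms]] by simp_all
  from add_G[OF assms minus_G[OF add_G[OF this]]] show ?thesis by (simp only: proj_comm_def diff_conv_add_uminus)
qed

lemma homog_ker_mu_entry: "homog_ker A \<Longrightarrow> homog_ker B \<Longrightarrow> homog_ker (mu_entry A # B)"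
  by (simp add: \<mu>_def minus_G proj_degree Q_degree minus_ker proj_ker)

text \<open>The summand of the blocks \<open>(A, B)\<close> equals that of \<open>(B, A)\<close>: the sign for the exchange of the
  blocks, the antisymmetry of the bracket and the two sign factors cancel. Of two such summands,
  exactly one has the first entry in its left block.\<close>

lemma Q_double:
  assumes "homog_ker zs"
  shows "Q zs + Q zs = unshuffle zs (\<lambda>A B. sg (len A + (len B - 1) * deg A) (br (f A) (f B)))"
proof (cases zs)
  case (Cons z ys)
  have "unshuffle ys (\<lambda>A B. sg (len A + deg A * fst z + (len A + len B * deg A)) (br (f A) (f (z # B)))) = Q zs"
    unfolding Cons half_bracket.simps
  proof (subst unshuffle_swap, intro unshuffle_cong, goal_cases)
    case (1 A B)
    have H: "homog_ker (z # A)" "homog_ker B"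
      using assms 1 homog_ker_subset[of zs "z # A"] homog_ker_subset[of zs B] by (auto simp: Cons)
    show ?case
      by (subst antisymmetry[OF f_degree[OF H(2)] f_degree[OF H(1)]])
        (auto simp: sg_minus minus_sg intro!: sg_cong)
  qed
  moreover have "unshuffle ys (\<lambda>A B. sg (1 + len A + (len B - 1) * (fst z + deg A)) (br (f (z # A)) (f B))) = Q zs"
    by (simp add: Cons)
  moreover have "unshuffle zs (\<lambda>A B. sg (len A + (len B - 1) * deg A) (br (f A) (f B))) =
      unshuffle ys (\<lambda>A B. sg (1 + len A + (len B - 1) * (fst z + deg A)) (br (f (z # A)) (f B))) +
      unshuffle ys (\<lambda>A B. sg (len A + deg A * fst z + (len A + len B * deg A)) (br (f A) (f (z # B))))"
    by (simp add: Cons)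
  ultimately show ?thesis by (simp only:)
qed (simp add: f_Nil brr.zero)

lemma f_homog_ker:
  assumes "2 \<le> length zs" "homog_ker zs"
  shows "f zs = \<eta> (Q zs)"
proof (rule double_cancel)
  show "f zs + f zs = \<eta> (Q zs) + \<eta> (Q zs)"
    unfolding \<eta>.add[symmetric] Q_double[OF assms(2)]
    by (rule f_eq) (use assms in \<open>auto simp: homog_ker_def\<close>)
qed

text \<open>The terms in which the bracket sum is substituted for \<open>d f\<close> cancel. Expanding \<open>Q A\<close> gives a sum of
  \<open>[[f A, f B], f C]\<close> over three blocks. The sum does not change when the blocks are rotated, and
  the three rotated summands add up to a Jacobi expression.\<close>

lemma Q_jacobi:
  assumes "homog_ker zs"
  shows "unshuffle zs (\<lambda>A C. sg (len A + (len C - 1) * deg A) (br (Q A) (f C))) = 0" (is "?T = 0")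
proof -
  define w where "w = (\<lambda>(A :: 'a glist) (B :: 'a glist) (C :: 'a glist). len B + (len C - 1) * (deg A + deg B) + (len B - 1) * deg A)"
  define W where "W = (\<lambda>A B C. sg (w A B C) (br (br (f A) (f B)) (f C)))"
  define U where "U = unshuffle zs (\<lambda>A C. unshuffle A (\<lambda>A B. W A B C))"
  define s where "s = (\<lambda>(A :: 'a glist) (B :: 'a glist) (C :: 'a glist). (len A + len B) * len C + (deg A + deg B) * deg C)"
  have "?T + ?T = unshuffle zs (\<lambda>A C. sg (len A + (len C - 1) * deg A) (br (Q A + Q A) (f C)))"
    by (simp add: unshuffle_add[symmetric] sg_add brl.add)
  also have "\<dots> = U" unfolding U_def
  proof (rule unshuffle_cong, goal_cases)
    case (1 A C)
    have HA: "homog_ker A" using assms 1 homog_ker_subset by blast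
    show ?case unfolding Q_double[OF HA] unshuffle_additive[OF br_additive_left] sg_unshuffle
      by (rule unshuffle_cong)
        (auto simp: W_def w_def sg_additive[OF br_additive_left] intro!: sg_cong)
  qed
  finally have TU: "?T + ?T = U" .
  have U2: "U = unshuffle zs (\<lambda>A C. unshuffle A (\<lambda>A B. sg (s A B C) (W C A B)))"
    unfolding U_def s_def by (rule unshuffle_rotate)
  have U3: "U = unshuffle zs (\<lambda>A C. unshuffle A (\<lambda>A B. sg (s A B C) (sg (s C A B) (W B C A))))"
    by (rule trans[OF U2], subst unshuffle_rotate, simp only: s_def)
  have "U + U + U = unshuffle zs (\<lambda>A C. unshuffle A (\<lambda>A B. W A B C + sg (s A B C) (W C A B)
      + sg (s A B C) (sg (s C A B) (W B C A))))"
    unfolding unshuffle_add by (simp only: U_def[symmetric] U2[symmetric] U3[symmetric])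
  also have "\<dots> = 0"
  proof (rule unshuffle_0I, rule unshuffle_0I, goal_cases)
    case (1 A' C A B)
    have H: "homog_ker A" "homog_ker B" "homog_ker C" using 1 by (auto intro!: homog_ker_subset[OF assms])
    have eq: "W A B C + sg (s A B C) (W C A B) + sg (s A B C) (sg (s C A B) (W B C A)) =
      sg (w A B C) (br (br (f A) (f B)) (f C) +
        sg ((deg C + 1 - len C) * ((deg A + 1 - len A) + (deg B + 1 - len B))) (br (br (f C) (f A)) (f B)) +
        sg ((deg A + 1 - len A) * ((deg B + 1 - len B) + (deg C + 1 - len C))) (br (br (f B) (f C)) (f A)))"
      unfolding W_def sg_add sg_sg
      by (intro arg_cong2[where f="(+)"] sg_cong refl) (auto simp: s_def w_def)
    show ?case unfolding eq
      by (subst jacobi[OF H[THEN f_degree]]) simp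
  qed
  finally have "U = 0" by (rule triple_zero)
  with TU show ?thesis using double_zero[of ?T] by (simp only:)
qed

lemma d_unshuffle: "d (unshuffle zs F) = unshuffle zs (\<lambda>A B. d (F A B))"
  by (rule unshuffle_additive[OF d_additive])

text \<open>The insertion sums of \<open>Q\<close> and \<open>f\<close>. Terms with at most one entry in \<open>A\<close> contribute zero, because
  \<open>\<mu>\<close> vanishes there, and \<open>f\<close> and with it \<open>Q\<close> vanish on lists that begin with a zero entry.\<close>

definition Q_after_mu :: "'a glist \<Rightarrow> 'a" where
  "Q_after_mu zs = unshuffle zs (\<lambda>A B. sg (len A * len B) (Q (mu_entry A # B)))"

definition f_after_mu :: "'a glist \<Rightarrow> 'a" where
  "f_after_mu zs = unshuffle zs (\<lambda>A B. sg (len A * len B) (f (mu_entry A # B)))"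

lemma unshuffle_Nil_right:
  assumes "\<And>A B. length A + length B = length zs \<Longrightarrow> B \<noteq> [] \<Longrightarrow> F A B = 0"
  shows "unshuffle zs F = F zs []"
  using assms
proof (induction zs arbitrary: F)
  case (Cons z zs)
  have "unshuffle zs (\<lambda>A B. sg (len A + deg A * fst z) (F A (z # B))) = 0"
    by (rule unshuffle_0I) (simp add: Cons.prems)
  moreover have "unshuffle zs (\<lambda>A B. F (z # A) B) = F (z # zs) []"
    by (rule Cons.IH) (simp add: Cons.prems)
  ultimately show ?case by simp
qed simp

text \<open>The recursion for \<open>f\<close> applies to all terms except those where \<open>\<mu>\<close> takes the whole list; these
  contribute \<open>f_1 \<mu>\<close>, and \<open>f_1\<close> is the inclusion.\<close>

lemma \<eta>_Q_after_mu:
  assumes "homog_ker zs"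
  shows "f_after_mu zs = \<mu> zs + \<eta> (Q_after_mu zs)"
proof -
  have "f_after_mu zs = unshuffle zs (\<lambda>A B. (if B = [] then \<mu> A else 0) + \<eta> (sg (len A * len B) (Q (mu_entry A # B))))"
    unfolding f_after_mu_def
  proof (rule unshuffle_cong, goal_cases)
    case (1 A B)
    show ?case
    proof (cases "B = []")
      case True
      then show ?thesis by (simp add: f_single \<eta>.zero del: half_bracket.simps)
    next
      case False
      have "homog_ker (mu_entry A # B)" using 1 by (intro homog_ker_mu_entry homog_ker_subset[OF assms])
      with False have "f (mu_entry A # B) = \<eta> (Q (mu_entry A # B))"
        by (intro f_homog_ker) (cases B; auto)+
      then show ?thesis using False by (simp add: sg_additive[OF \<eta>_additive] del: half_bracket.simps)
    qed
  qed
  also have "\<dots> = \<mu> zs + \<eta> (Q_after_mu zs)"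
    unfolding unshuffle_add Q_after_mu_def unshuffle_additive[OF \<eta>_additive]
    by (subst unshuffle_Nil_right) auto
  finally show ?thesis .
qed

text \<open>From \<open>f = \<eta> Q\<close> one gets \<open>d f = d \<eta> Q = Q - P Q - \<eta> d Q\<close>, in which \<open>- P Q = \<mu>\<close>. Thus the morphism
  equation for a list follows from the identity \<open>d_Q\<close> below for the same list.\<close>

lemma d_f_step:
  assumes "homog_ker zs" and d_Q: "d (Q zs) + Q_after_mu zs = 0"
  shows "d (f zs) = Q zs + f_after_mu zs"
proof -
  consider "zs = []" | z where "zs = [z]" | "2 \<le> length zs"
    by (cases zs rule: remdups_adj.cases) auto
  then show ?thesis
  proof cases
    case 1
    then show ?thesis by (simp add: f_after_mu_def f_single f_Nil d.zero)
  next
    case 2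
    then show ?thesis using assms(1)
      by (simp add: f_after_mu_def f_Nil f_single f_zero ker_d brr.zero)
  next
    case 3
    have "\<eta> (d (Q zs)) = - \<eta> (Q_after_mu zs)"
      using arg_cong[OF d_Q, of \<eta>] by (simp add: \<eta>.add \<eta>.zero eq_neg_iff_add_eq_0)
    then show ?thesis
      using \<eta>_Q_after_mu[OF assms(1)] proj_eq[of "Q zs"] f_homog_ker[OF 3 assms(1)] by (simp add: \<mu>_def algebra_simps)
  qed
qed

text \<open>In \<open>Q (mu_entry A # R)\<close> the inserted entry comes first and therefore lies in the left block, so
  the right block consists of original entries and \<open>f\<close> of the left block is a summand of \<open>f_after_mu\<close>.\<close>

lemma Q_after_mu_expand:
  "Q_after_mu zs = - unshuffle zs (\<lambda>A C. sg (len A + (len C - 1) * deg A) (br (f_after_mu A) (f C)))"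
proof -
  have "Q_after_mu zs = unshuffle zs (\<lambda>A R. unshuffle R (\<lambda>B C. sg (len A * (len B + len C) + 1 + len B
      + (len C - 1) * (deg A + 2 - len A + deg B)) (br (f (mu_entry A # B)) (f C))))"
    unfolding Q_after_mu_def by (intro unshuffle_cong) (auto simp: sg_unshuffle intro!: unshuffle_cong sg_cong)
  also have "\<dots> = unshuffle zs (\<lambda>A C. - sg (len A + (len C - 1) * deg A) (br (f_after_mu A) (f C)))"
    unfolding unshuffle_assoc[symmetric] f_after_mu_def unshuffle_additive[OF br_additive_left] sg_unshuffle sg_additive[OF br_additive_left] unshuffle_minus sg_sg minus_sg
    by (intro unshuffle_cong) (auto intro!: sg_cong)
  finally show ?thesis by (simp add: unshuffle_minus)
qed

text \<open>The identity behind both the morphism equation and the relations of \<open>\<mu>\<close>. By induction, \<open>d f\<close> may be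
  replaced by \<open>Q + f_after_mu\<close> on shorter lists. The Leibniz rule gives two families of terms in
  \<open>d (Q + Q)\<close>, which agree by cocommutativity; in one of them the part with \<open>Q\<close> vanishes by
  the Jacobi identity, and the part with \<open>f_after_mu\<close> is \<open>- Q_after_mu\<close>.\<close>

lemma d_Q: "homog_ker zs \<Longrightarrow> d (Q zs) + Q_after_mu zs = 0"
proof (induction "length zs" arbitrary: zs rule: less_induct)
  case less
  note H = less.prems
  have HA: "homog_ker A" if "set A \<subseteq> set zs" for A using H that by (rule homog_ker_subset)
  have IH: "d (f A) = Q A + f_after_mu A" if "length A < length zs" "set A \<subseteq> set zs" for A
    using that by (intro d_f_step less.hyps HA)
  define T where "T = unshuffle zs (\<lambda>A C. sg (len A + (len C - 1) * deg A) (br (d (f A)) (f C)))"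
  have "d (Q zs) + d (Q zs) = unshuffle zs (\<lambda>A B. sg (len A + (len B - 1) * deg A) (br (d (f A)) (f B))
      + sg (len A + (len B - 1) * deg A + (deg A + 1 - len A)) (br (f A) (d (f B))))"
    unfolding d.add[symmetric] Q_double[OF H] d_unshuffle
  proof (rule unshuffle_cong, goal_cases)
    case (1 A B)
    then show ?case
      by (simp add: sg_additive[OF d_additive] leibniz[OF f_degree[OF HA] f_degree[OF HA]] sg_add)
  qed
  also have "\<dots> = T + unshuffle zs (\<lambda>A B. sg (len A + (len B - 1) * deg A + (deg A + 1 - len A)) (br (f A) (d (f B))))"
    by (simp add: unshuffle_add T_def)
  also have "unshuffle zs (\<lambda>A B. sg (len A + (len B - 1) * deg A + (deg A + 1 - len A)) (br (f A) (d (f B)))) = T"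
    unfolding T_def
  proof (subst unshuffle_swap, intro unshuffle_cong, goal_cases)
    case (1 A B)
    show ?case
      by (subst antisymmetry[OF f_degree[OF HA] d_degree[OF f_degree[OF HA]]], fact, fact)
        (auto simp: sg_minus minus_sg intro!: sg_cong)
  qed
  finally have "d (Q zs) = T" by (rule double_cancel)
  also have "T = unshuffle zs (\<lambda>A C. sg (len A + (len C - 1) * deg A) (br (Q A) (f C))
     + sg (len A + (len C - 1) * deg A) (br (f_after_mu A) (f C)))"
    unfolding T_def
  proof (rule unshuffle_cong, goal_cases)
    case (1 A C)
    show ?case
    proof (cases "C = []")
      case False
      with 1 show ?thesis by (simp add: IH brl.add sg_add)
    qed (simp add: f_Nil brr.zero)
  qed
  also have "\<dots> = - Q_after_mu zs"
    by (simp add: unshuffle_add Q_jacobi[OF H] Q_after_mu_expand)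
  finally show ?case by simp
qed

theorem morphism_eq: "homog_ker zs \<Longrightarrow> d (f zs) = Q zs + f_after_mu zs"
  by (intro d_f_step d_Q)

text \<open>The projection \<open>P\<close> applied to \<open>d_Q\<close>, as \<open>P d = 0\<close>.\<close>

theorem mu_mu: assumes "homog_ker zs" shows "unshuffle zs (\<lambda>A B. sg (len A * len B) (\<mu> (mu_entry A # B))) = 0"
proof -
  have "unshuffle zs (\<lambda>A B. sg (len A * len B) (\<mu> (mu_entry A # B))) = - proj_comm d \<eta> (Q_after_mu zs)"
    unfolding Q_after_mu_def unshuffle_additive[OF proj_additive] unshuffle_minus \<mu>_def sg_additive[OF proj_additive]
      sg_minus ..
  also have "Q_after_mu zs = - d (Q zs)" using d_Q[OF assms] by (simp add: eq_neg_iff_add_eq_0 add.commute)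
  finally show ?thesis by (simp add: P.minus proj_d)
qed

end


section \<open>Shuffles and permutations\<close>

text \<open>The permutation of \<open>{..<Suc n}\<close> for which \<open>a_0\<close> is put at position \<open>k\<close> of the list that \<open>\<sigma>\<close> makes of
  the other entries.\<close>

definition ins_perm :: "nat \<Rightarrow> (nat \<Rightarrow> nat) \<Rightarrow> nat \<Rightarrow> nat" where
  "ins_perm k \<sigma> = (\<lambda>i. if i < k then Suc (\<sigma> i) else if i = k then 0 else Suc (\<sigma> (i - 1)))"

lemma ins_perm_simps [simp]: "ins_perm k \<sigma> k = 0" "i < k \<Longrightarrow> ins_perm k \<sigma> i = Suc (\<sigma> i)"
    "k \<le> i \<Longrightarrow> ins_perm k \<sigma> (Suc i) = Suc (\<sigma> i)"
  by (simp_all add: ins_perm_def)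

lemma ins_perm_eq_0_iff [simp]: "ins_perm k \<sigma> i = 0 \<longleftrightarrow> i = k"
  by (simp add: ins_perm_def)

lemma ins_perm_permutes:
  assumes "\<sigma> permutes {..<n}" "k \<le> n"
  shows "ins_perm k \<sigma> permutes {..<Suc n}"
proof (rule bij_imp_permutes)
  have eq: "ins_perm k \<sigma> i = (if i = k then 0 else Suc (\<sigma> (if i < k then i else i - 1)))" for i
    by (simp add: ins_perm_def)
  have inj: "inj_on (ins_perm k \<sigma>) {..<Suc n}"
  proof (rule inj_onI)
    fix i j assume "ins_perm k \<sigma> i = ins_perm k \<sigma> j"
    then have "i = k \<and> j = k \<or> i \<noteq> k \<and> j \<noteq> k \<and> (if i < k then i else i - 1) = (if j < k then j else j - 1)"
      using injD[OF permutes_inj[OF assms(1)]] by (auto simp only: eq nat.inject nat.distinct split: if_split_asm)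
    then show "i = j" by (auto split: if_split_asm)
  qed
  moreover have "ins_perm k \<sigma> ` {..<Suc n} \<subseteq> {..<Suc n}"
  proof (intro image_subsetI)
    fix i assume "i \<in> {..<Suc n}"
    then have "(if i < k then i else i - 1) < n" if "i \<noteq> k" using that assms(2) by auto
    then show "ins_perm k \<sigma> i \<in> {..<Suc n}"
      using permutes_in_image[OF assms(1), of "if i < k then i else i - 1"] by (auto simp: eq)
  qed
  ultimately have "ins_perm k \<sigma> ` {..<Suc n} = {..<Suc n}"
    by (intro endo_inj_surj) auto
  with inj show "bij_betw (ins_perm k \<sigma>) {..<Suc n} {..<Suc n}" by (simp add: bij_betw_def)
next
  fix i assume "i \<notin> {..<Suc n}"
  then show "ins_perm k \<sigma> i = i"
    using assms(2) permutes_not_in[OF assms(1), of "i - 1"] by (auto simp: ins_perm_def)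
qed

lemma ins_perm_inject:
  assumes "ins_perm k \<sigma> = ins_perm k' \<sigma>'"
  shows "k = k' \<and> \<sigma> = \<sigma>'"
proof -
  have k: "k = k'" using assms by (metis ins_perm_eq_0_iff)
  moreover have "\<sigma> i = \<sigma>' i" for i
    using fun_cong[OF assms, of "if i < k then i else Suc i"] k by (simp split: if_splits)
  ultimately show ?thesis by auto
qed

lemma ins_perm_bij:
  "bij_betw (\<lambda>(k, \<sigma>). ins_perm k \<sigma>) ({..n} \<times> {\<sigma>. \<sigma> permutes {..<n}}) {\<sigma>. \<sigma> permutes {..<Suc n}}"
proof -
  let ?A = "{..n} \<times> {\<sigma>. \<sigma> permutes {..<n}}" and ?h = "\<lambda>(k, \<sigma>). ins_perm k \<sigma>"
  have inj: "inj_on ?h ?A"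
    by (auto simp: inj_on_def dest: ins_perm_inject)
  have sub: "?h ` ?A \<subseteq> {\<sigma>. \<sigma> permutes {..<Suc n}}"
    by (auto intro: ins_perm_permutes)
  have "card (?h ` ?A) = card {\<sigma>. \<sigma> permutes {..<Suc n}}"
    by (simp add: card_image[OF inj] card_cartesian_product card_permutations[of _ n]
        card_permutations[of _ "Suc n"])
  with sub have "?h ` ?A = {\<sigma>. \<sigma> permutes {..<Suc n}}"
    by (intro card_subset_eq) (simp_all add: finite_permutations)
  with inj show ?thesis by (simp add: bij_betw_def)
qed

lemma permute_list_ins_perm:
  assumes "\<sigma> permutes {..<length zs}" "k \<le> length zs"
  shows "permute_list (ins_perm k \<sigma>) (z # zs) =
    take k (permute_list \<sigma> zs) @ z # drop k (permute_list \<sigma> zs)"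
proof (rule nth_equalityI, goal_cases)
  case (2 i)
  have "\<sigma> j < length zs" if "j < length zs" for j
    using permutes_in_image[OF assms(1)] that by auto
  with 2 assms(2) show ?case
    by (cases "i = length zs") (auto simp: permute_list_def nth_append nth_Cons' ins_perm_def min_def)
qed (use assms in auto)

lemma ksign_0 [simp]: "ksign 0 = 1"
  by (simp add: ksign_def)

lemma ksign_add: "ksign (a + b) = ksign a * ksign b"
  by (auto simp: ksign_def)

lemma ksign_sum: "finite S \<Longrightarrow> ksign (sum F S) = (\<Prod>x\<in>S. ksign (F x))"
  by (induction S rule: finite_induct) (simp_all add: ksign_add)

text \<open>Besides the inversions of \<open>\<sigma>\<close>, the new entry is inverted with exactly the \<open>k\<close> entries that now
  precede it.\<close>

lemma chi_ins_perm:
  assumes \<sigma>: "\<sigma> permutes {..<length ds}" and k: "k \<le> length ds"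
  shows "chi (d # ds) (ins_perm k \<sigma>) =
    ksign (int k + sum_list (take k (permute_list \<sigma> ds)) * d) * chi ds \<sigma>"
proof -
  \<comment> \<open>the increasing map onto the positions other than \<open>k\<close>\<close>
  define e where "e = (\<lambda>i. if i < k then i else Suc i)"
  define Inv where "Inv = {(i, j). i < j \<and> j < length ds \<and> \<sigma> j < \<sigma> i}"
  let ?f = "\<lambda>(i, j). - ksign ((d # ds) ! ins_perm k \<sigma> i * (d # ds) ! ins_perm k \<sigma> j)"
  have fin: "finite Inv"
    by (rule finite_subset[of _ "{..<length ds} \<times> {..<length ds}"]) (auto simp: Inv_def)
  have e: "ins_perm k \<sigma> (e i) = Suc (\<sigma> i)" for i by (simp add: e_def)
  have e_less: "e i < e j \<longleftrightarrow> i < j" for i j by (auto simp: e_def)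
  have e_ran: "\<exists>i'. i = e i'" if "i \<noteq> k" for i
    by (rule exI[of _ "if i < k then i else i - 1"]) (use that in \<open>auto simp: e_def\<close>)
  have e_len: "e j < Suc (length ds) \<longleftrightarrow> j < length ds" for j using k by (auto simp: e_def)
  have ek: "e i \<noteq> k" for i by (simp add: e_def)
  have "{(i, j). i < j \<and> j < length (d # ds) \<and> ins_perm k \<sigma> j < ins_perm k \<sigma> i} =
      map_prod e e ` Inv \<union> (\<lambda>i. (i, k)) ` {..<k}" (is "?S = ?R")
  proof (intro set_eqI iffI)
    fix p assume p: "p \<in> ?S"
    obtain i j where ij: "p = (i, j)" "i < j" "j < Suc (length ds)" "ins_perm k \<sigma> j < ins_perm k \<sigma> i"
      using p by auto
    then have "i \<noteq> k" by (metis ins_perm_simps(1) not_less_zero)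
    then obtain i' where i': "i = e i'" using e_ran by blast
    show "p \<in> ?R"
    proof (cases "j = k")
      case False
      then obtain j' where "j = e j'" using e_ran by blast
      with ij i' have "(i', j') \<in> Inv" by (simp add: Inv_def e e_less e_len)
      with \<open>j = e j'\<close> i' ij show ?thesis by force
    qed (use ij in auto)
  next
    fix p assume "p \<in> ?R"
    then show "p \<in> ?S" using k by (auto simp: Inv_def e e_less e_len)
  qed
  then have "chi (d # ds) (ins_perm k \<sigma>) =
      (\<Prod>p\<in>map_prod e e ` Inv. ?f p) * (\<Prod>p\<in>(\<lambda>i. (i, k)) ` {..<k}. ?f p)"
    unfolding chi_def using fin ek by (subst prod.union_disjoint[symmetric]) auto
  also have "(\<Prod>p\<in>map_prod e e ` Inv. ?f p) = chi ds \<sigma>"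
  proof -
    have "inj_on (map_prod e e) Inv"
      using e_less by (auto simp: inj_on_def) (metis linorder_neq_iff)+
    then show ?thesis
      by (subst prod.reindex) (auto simp: chi_def Inv_def e intro!: prod.cong)
  qed
  also have "(\<Prod>p\<in>(\<lambda>i. (i, k)) ` {..<k}. ?f p) = (\<Prod>i<k. ksign (1 + ds ! \<sigma> i * d))"
    by (subst prod.reindex) (auto simp: inj_on_def ksign_def intro!: prod.cong)
  also have "\<dots> = ksign (\<Sum>i<k. 1 + ds ! \<sigma> i * d)"
    by (simp add: ksign_sum)
  also have "(\<Sum>i<k. 1 + ds ! \<sigma> i * d) = int k + sum_list (take k (permute_list \<sigma> ds)) * d"
    using k by (simp add: sum.distrib sum_list_sum_nth permute_list_def sum_distrib_right
      min_def lessThan_atLeast0 )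
  finally show ?thesis by (simp add: mult.commute)
qed

lemma Sh_permutes: "\<sigma> \<in> Sh k n \<Longrightarrow> \<sigma> permutes {..<n}"
  by (simp add: Sh_def)

lemma finite_Sh [simp]: "finite (Sh k n)"
  by (rule finite_subset[OF _ finite_permutations[of "{..<n}"]]) (auto simp: Sh_def)

lemma ins_perm_0_Sh:
  assumes "\<sigma> permutes {..<n}"
  shows "ins_perm 0 \<sigma> \<in> Sh (Suc k) (Suc n) \<longleftrightarrow> \<sigma> \<in> Sh k n"
proof -
  have "strict_mono_on {..<Suc k} (ins_perm 0 \<sigma>) \<longleftrightarrow> strict_mono_on {..<k} \<sigma>" (is "?l \<longleftrightarrow> ?r")
  proof
    assume l: ?l
    show ?r
    proof (rule strict_mono_onI)
      fix r s assume "r \<in> {..<k}" "s \<in> {..<k}" "r < s"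
      then show "\<sigma> r < \<sigma> s" using strict_mono_onD[OF l, of "Suc r" "Suc s"] by simp
    qed
  next
    assume r: ?r
    show ?l
    proof (rule strict_mono_onI)
      fix i j assume "i \<in> {..<Suc k}" "j \<in> {..<Suc k}" "i < j"
      then show "ins_perm 0 \<sigma> i < ins_perm 0 \<sigma> j"
        using strict_mono_onD[OF r, of "i - 1" "j - 1"] by (cases i; cases j) auto
    qed
  qed
  moreover have "strict_mono_on {Suc k..<Suc n} (ins_perm 0 \<sigma>) \<longleftrightarrow> strict_mono_on {k..<n} \<sigma>" (is "?l \<longleftrightarrow> ?r")
  proof
    assume l: ?l
    show ?r
    proof (rule strict_mono_onI)
      fix r s assume "r \<in> {k..<n}" "s \<in> {k..<n}" "r < s"
      then show "\<sigma> r < \<sigma> s" using strict_mono_onD[OF l, of "Suc r" "Suc s"] by simp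
    qed
  next
    assume r: ?r
    show ?l
    proof (rule strict_mono_onI)
      fix i j assume "i \<in> {Suc k..<Suc n}" "j \<in> {Suc k..<Suc n}" "i < j"
      then show "ins_perm 0 \<sigma> i < ins_perm 0 \<sigma> j"
        using strict_mono_onD[OF r, of "i - 1" "j - 1"] by (cases i; cases j) auto
    qed
  qed
  ultimately show ?thesis using ins_perm_permutes[OF assms, of 0] assms by (simp add: Sh_def)
qed

lemma ins_perm_Sh:
  assumes "\<sigma> permutes {..<n}" "k \<le> n"
  shows "ins_perm k \<sigma> \<in> Sh k (Suc n) \<longleftrightarrow> \<sigma> \<in> Sh k n"
proof -
  have "strict_mono_on {..<k} (ins_perm k \<sigma>) \<longleftrightarrow> strict_mono_on {..<k} \<sigma>"
    by (simp add: strict_mono_on_def)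
  moreover have "strict_mono_on {k..<Suc n} (ins_perm k \<sigma>) \<longleftrightarrow> strict_mono_on {k..<n} \<sigma>" (is "?l \<longleftrightarrow> ?r")
  proof
    assume l: ?l
    show ?r
    proof (rule strict_mono_onI)
      fix r s assume "r \<in> {k..<n}" "s \<in> {k..<n}" "r < s"
      then show "\<sigma> r < \<sigma> s" using strict_mono_onD[OF l, of "Suc r" "Suc s"] by simp
    qed
  next
    assume r: ?r
    show ?l
    proof (rule strict_mono_onI)
      fix i j assume *: "i \<in> {k..<Suc n}" "j \<in> {k..<Suc n}" "i < j"
      show "ins_perm k \<sigma> i < ins_perm k \<sigma> j"
      proof (cases "i = k")
        case True
        with * have "ins_perm k \<sigma> j \<noteq> 0" by simp
        then show ?thesis unfolding True by (simp only: ins_perm_simps(1) neq0_conv)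
      next
        case False
        with * show ?thesis
          using strict_mono_onD[OF r, of "i - 1" "j - 1"] by (cases i; cases j) auto
      qed
    qed
  qed
  ultimately show ?thesis using ins_perm_permutes[OF assms] assms by (simp add: Sh_def)
qed

text \<open>In a shuffle the value 0 can only be at the start of one of the two blocks. These two cases are the
  two summands in the recursion of \<open>unshuffle\<close>.\<close>

lemma Sh_Suc_cases:
  assumes "\<sigma> \<in> Sh k (Suc n)" "k \<le> Suc n"
  obtains k' \<tau> where "k = Suc k'" "k' \<le> n" "\<tau> \<in> Sh k' n" "\<sigma> = ins_perm 0 \<tau>"
    | \<tau> where "k \<le> n" "\<tau> \<in> Sh k n" "\<sigma> = ins_perm k \<tau>"
proof -
  have "\<sigma> \<in> (\<lambda>(k, \<sigma>). ins_perm k \<sigma>) ` ({..n} \<times> {\<sigma>. \<sigma> permutes {..<n}})"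
    using bij_betw_imp_surj_on[OF ins_perm_bij[of n]] assms by (simp add: Sh_def)
  then obtain j \<tau> where \<tau>: "j \<le> n" "\<tau> permutes {..<n}" "\<sigma> = ins_perm j \<tau>" by auto
  have "j = 0 \<and> 0 < k \<or> j = k"
  proof (rule ccontr)
    assume *: "\<not> ?thesis"
    have "\<sigma> (j - 1) < \<sigma> j"
    proof (cases "j < k")
      case True
      with * assms show ?thesis by (intro strict_mono_onD[of "{..<k}" \<sigma>]) (auto simp: Sh_def)
    next
      case False
      with * assms \<tau> show ?thesis by (intro strict_mono_onD[of "{k..<Suc n}" \<sigma>]) (auto simp: Sh_def)
    qed
    with \<tau>(3) show False by simp
  qed
  then show thesis
  proof
    assume "j = 0 \<and> 0 < k"
    then show thesis using that(1)[of "k - 1" \<tau>] \<tau> assms ins_perm_0_Sh[OF \<tau>(2), of "k - 1"] by auto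
  next
    assume "j = k"
    then show thesis using that(2)[of \<tau>] \<tau> assms ins_perm_Sh[OF \<tau>(2), of k] by auto
  qed
qed

lemma sum_Sh_Suc:
  "(\<Sum>k\<le>Suc n. \<Sum>\<sigma>\<in>Sh k (Suc n). \<Phi> k \<sigma>) =
   (\<Sum>k\<le>n. \<Sum>\<sigma>\<in>Sh k n. \<Phi> (Suc k) (ins_perm 0 \<sigma>)) + (\<Sum>k\<le>n. \<Sum>\<sigma>\<in>Sh k n. (\<Phi> k (ins_perm k \<sigma>) :: 'b::comm_monoid_add))"
proof -
  let ?S = "\<lambda>n. SIGMA k:{..n}. Sh k n"
  let ?a = "\<lambda>(k, \<sigma>). (Suc k, ins_perm 0 \<sigma>)" and ?b = "\<lambda>(k, \<sigma>). (k, ins_perm k \<sigma>)"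
  have eq: "?S (Suc n) = ?a ` ?S n \<union> ?b ` ?S n"
  proof (intro set_eqI iffI)
    fix p assume "p \<in> ?S (Suc n)"
    then obtain k \<sigma> where p: "p = (k, \<sigma>)" "k \<le> Suc n" "\<sigma> \<in> Sh k (Suc n)" by auto
    from p(3,2) show "p \<in> ?a ` ?S n \<union> ?b ` ?S n"
      by (cases rule: Sh_Suc_cases) (force simp: p(1))+
  next
    fix p assume "p \<in> ?a ` ?S n \<union> ?b ` ?S n"
    then show "p \<in> ?S (Suc n)"
      by (auto simp: ins_perm_0_Sh ins_perm_Sh Sh_permutes)
  qed
  have "(\<Sum>k\<le>Suc n. \<Sum>\<sigma>\<in>Sh k (Suc n). \<Phi> k \<sigma>) = (\<Sum>(k, \<sigma>)\<in>?S (Suc n). \<Phi> k \<sigma>)"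
    by (rule sum.Sigma) simp_all
  also have "\<dots> = (\<Sum>(k, \<sigma>)\<in>?a ` ?S n. \<Phi> k \<sigma>) + (\<Sum>(k, \<sigma>)\<in>?b ` ?S n. \<Phi> k \<sigma>)"
    unfolding eq by (rule sum.union_disjoint) (auto dest: ins_perm_inject)
  also have "(\<Sum>(k, \<sigma>)\<in>?a ` ?S n. \<Phi> k \<sigma>) = (\<Sum>(k, \<sigma>)\<in>?S n. \<Phi> (Suc k) (ins_perm 0 \<sigma>))"
    by (subst sum.reindex) (auto simp: inj_on_def case_prod_unfold dest: ins_perm_inject)
  also have "(\<Sum>(k, \<sigma>)\<in>?b ` ?S n. \<Phi> k \<sigma>) = (\<Sum>(k, \<sigma>)\<in>?S n. \<Phi> k (ins_perm k \<sigma>))"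
    by (subst sum.reindex) (auto simp: inj_on_def case_prod_unfold dest: ins_perm_inject)
  finally show ?thesis by (simp add: sum.Sigma)
qed

text \<open>A recursive form of the sum over all cuts of a list (\<open>deconcat_sum\<close>), made for list induction in
  parallel with \<open>unshuffle\<close>.\<close>

primrec deconcat :: "'a list \<Rightarrow> ('a list \<Rightarrow> 'a list \<Rightarrow> 'w) \<Rightarrow> 'w::ab_group_add" where
  "deconcat [] F = F [] []"
| "deconcat (y # ys) F = F [] (y # ys) + deconcat ys (\<lambda>A B. F (y # A) B)"

lemma deconcat_sum: "deconcat ys F = (\<Sum>k\<le>length ys. F (take k ys) (drop k ys))"
  by (induction ys arbitrary: F) (simp_all add: sum.atMost_Suc_shift del: sum.atMost_Suc)

lemma deconcat_add: "deconcat ys (\<lambda>A B. F A B + F' A B) = deconcat ys F + deconcat ys F'"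
  by (simp add: deconcat_sum sum.distrib)

lemma deconcat_sg: "sg m (deconcat ys F) = deconcat ys (\<lambda>A B. sg m (F A B))"
  by (simp add: deconcat_sum sg_sum)

text \<open>Inserting \<open>z\<close> anywhere into a list and then cutting it anywhere is the same as cutting first and
  then inserting \<open>z\<close> into the left or into the right piece.\<close>

lemma deconcat_insert:
  "deconcat ys (\<lambda>A B. sg (len A + deg A * fst z) (deconcat (A @ z # B) F)) =
   deconcat ys (\<lambda>A B. deconcat A (\<lambda>A1 A2. sg (len A1 + deg A1 * fst z) (F (A1 @ z # A2) B)) +
     sg (len A + deg A * fst z) (deconcat B (\<lambda>B1 B2. sg (len B1 + deg B1 * fst z) (F A (B1 @ z # B2)))))"
proof (induction ys arbitrary: F)
  case (Cons y ys)
  have IH: "deconcat ys (\<lambda>A B. sg (1 + len A + (fst y + deg A) * fst z) (deconcat (A @ z # B) (\<lambda>C. F (y # C)))) =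
    deconcat ys (\<lambda>A B. deconcat A (\<lambda>A1 A2. sg (1 + len A1 + (fst y + deg A1) * fst z) (F (y # A1 @ z # A2) B)) +
     sg (1 + len A + (fst y + deg A) * fst z) (deconcat B (\<lambda>B1 B2. sg (len B1 + deg B1 * fst z) (F (y # A) (B1 @ z # B2)))))"
    using arg_cong[OF Cons[of "\<lambda>C. F (y # C)"], of "sg (1 + fst y * fst z)"]
    by (simp add: deconcat_sg sg_add algebra_simps)
  show ?case
    using IH by (simp add: sg_add deconcat_add algebra_simps)
qed (simp add: algebra_simps)

locale graded_sums = module scale
  for scale :: "'k::comm_ring_1 \<Rightarrow> 'v::ab_group_add \<Rightarrow> 'v" (infixr \<open>*s\<close> 75)
begin

lemma scale_ksign: "of_int (ksign m) *s x = sg m x"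
  by (simp add: ksign_def sg_def)

lemma scale_ksign_mult: "(of_int (ksign m) * c) *s x = sg m (c *s x)"
  by (simp add: scale_ksign flip: scale_scale)

lemma sg_scale: "sg m (c *s x) = c *s sg m x"
  by (simp add: sg_def)

lemma unshuffle_Sh:
  "unshuffle zs F = (\<Sum>k\<le>length zs. \<Sum>\<sigma>\<in>Sh k (length zs). of_int (chi (map fst zs) \<sigma>) *s
     (F (take k (permute_list \<sigma> zs)) (drop k (permute_list \<sigma> zs))))"
proof (induction zs arbitrary: F)
  case Nil
  have "Sh 0 0 = {id}" by (auto simp: Sh_def strict_mono_on_def)
  then show ?case by (simp add: chi_def)
next
  case (Cons z zs)
  have deg: "deg (take k (permute_list \<sigma> zs)) = sum_list (take k (permute_list \<sigma> (map fst zs)))"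
    if "\<sigma> \<in> Sh k' (length zs)" for k k' \<sigma>
    using that by (simp add: deg_def permute_list_map Sh_permutes flip: take_map)
  show ?case
    unfolding unshuffle.simps Cons length_Cons sum_Sh_Suc
    by (intro arg_cong2[where f="(+)"] sum.cong refl)
      (auto simp: permute_list_ins_perm Sh_permutes chi_ins_perm scale_ksign_mult deg sg_scale)
qed

text \<open>Precomposition with the antisymmetrizer \<open>\<alpha>_n\<close>.\<close>

definition alternate :: "'c glist \<Rightarrow> ('c glist \<Rightarrow> 'v) \<Rightarrow> 'v" where
  "alternate zs F = (\<Sum>\<sigma>\<in>{\<sigma>. \<sigma> permutes {..<length zs}}.
     of_int (chi (map fst zs) \<sigma>) *s F (permute_list \<sigma> zs))"

lemma alternate_Nil [simp]: "alternate [] F = F []"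
  by (simp add: alternate_def chi_def)

lemma alternate_Cons: "alternate (z # zs) F = alternate zs (\<lambda>ys. deconcat ys (\<lambda>A B. sg (len A + deg A * fst z) (F (A @ z # B))))"
proof -
  have deg: "deg (take k (permute_list \<sigma> zs)) = sum_list (take k (permute_list \<sigma> (map fst zs)))"
    if "\<sigma> permutes {..<length zs}" for k \<sigma>
    using that by (simp add: deg_def permute_list_map flip: take_map)
  have "alternate (z # zs) F = (\<Sum>(k, \<sigma>)\<in>{..length zs} \<times> {\<sigma>. \<sigma> permutes {..<length zs}}.
     of_int (chi (map fst (z # zs)) (ins_perm k \<sigma>)) *s F (permute_list (ins_perm k \<sigma>) (z # zs)))"
    unfolding alternate_def length_Cons
    by (subst sum.reindex_bij_betw[OF ins_perm_bij, symmetric]) (simp add: case_prod_unfold)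
  also have "\<dots> = (\<Sum>\<sigma>\<in>{\<sigma>. \<sigma> permutes {..<length zs}}. \<Sum>k\<le>length zs.
     of_int (chi (map fst (z # zs)) (ins_perm k \<sigma>)) *s F (permute_list (ins_perm k \<sigma>) (z # zs)))"
    by (subst sum.cartesian_product[symmetric]) (rule sum.swap)
  also have "\<dots> = alternate zs (\<lambda>ys. deconcat ys (\<lambda>A B. sg (len A + deg A * fst z) (F (A @ z # B))))"
    unfolding alternate_def deconcat_sum scale_sum_right
    by (intro sum.cong refl) (auto simp: permute_list_ins_perm chi_ins_perm scale_ksign_mult deg sg_scale)
  finally show ?thesis .
qed

lemma alternate_cong:
  assumes "\<And>ys. \<lbrakk>length ys = length zs; deg ys = deg zs; mset ys = mset zs\<rbrakk> \<Longrightarrow> F ys = F' ys"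
  shows "alternate zs F = alternate zs F'"
  unfolding alternate_def
proof (intro sum.cong refl, goal_cases)
  case (1 \<sigma>)
  then have m: "mset (permute_list \<sigma> zs) = mset zs" by simp
  then have "mset (map fst (permute_list \<sigma> zs)) = mset (map fst zs)" by simp
  then have "deg (permute_list \<sigma> zs) = deg zs" unfolding deg_def by (metis sum_mset_sum_list)
  with m show ?case by (simp add: assms)
qed

lemma alternate_add: "alternate zs (\<lambda>ys. F ys + F' ys) = alternate zs F + alternate zs F'"
  by (simp add: alternate_def scale_right_distrib sum.distrib)

lemma alternate_sg: "sg m (alternate zs F) = alternate zs (\<lambda>ys. sg m (F ys))"
  by (simp add: alternate_def sg_sum sg_scale)

lemma alternate_deconcat_swap: "alternate zs (\<lambda>ys. deconcat xs (F ys)) = deconcat xs (\<lambda>A B. alternate zs (\<lambda>ys. F ys A B))"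
  unfolding alternate_def deconcat_sum scale_sum_right by (rule sum.swap)

text \<open>A permutation followed by a cut is the same as an unshuffle followed by a permutation of each block.
  This is what turns the recursion of trees at the root into a recursion over unshuffles.\<close>

lemma alternate_deconcat:
  "alternate zs (\<lambda>ys. deconcat ys F) = unshuffle zs (\<lambda>A B. alternate A (\<lambda>A'. alternate B (\<lambda>B'. F A' B')))"
proof (induction zs arbitrary: F)
  case (Cons z zs)
  have "alternate (z # zs) (\<lambda>ys. deconcat ys F) = unshuffle zs (\<lambda>A B. alternate A (\<lambda>A'. alternate B (\<lambda>B'.
     deconcat A' (\<lambda>A1 A2. sg (len A1 + deg A1 * fst z) (F (A1 @ z # A2) B')) +
     sg (len A' + deg A' * fst z) (deconcat B' (\<lambda>B1 B2. sg (len B1 + deg B1 * fst z) (F A' (B1 @ z # B2)))))))"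
    unfolding alternate_Cons deconcat_insert Cons ..
  also have "\<dots> = unshuffle (z # zs) (\<lambda>A B. alternate A (\<lambda>A'. alternate B (\<lambda>B'. F A' B')))"
    unfolding alternate_add unshuffle_add unshuffle.simps alternate_Cons alternate_sg alternate_deconcat_swap
    by (intro arg_cong2[where f="(+)"] refl unshuffle_cong alternate_cong) simp
  finally show ?case .
qed simp

end

text \<open>A pair of entries is inverted by \<open>\<tau> \<circ> \<sigma>\<close> iff it is inverted by exactly one of \<open>\<sigma>\<close> and \<open>\<tau>\<close>; as the
  sign of a pair is symmetric and squares to 1, the products agree pair by pair.\<close>

lemma chi_comp:
  assumes \<sigma>: "\<sigma> permutes {..<length ds}" and \<tau>: "\<tau> permutes {..<length ds}"
  shows "chi ds (\<tau> \<circ> \<sigma>) = chi ds \<tau> * chi (permute_list \<tau> ds) \<sigma>"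
proof -
  define I where "I = {(i, j). i < j \<and> j < length ds}"
  define th where "th = (\<lambda>a b. - ksign (ds ! a * ds ! b))"
  \<comment> \<open>\<open>m\<close> permutes the pairs \<open>i < j\<close>; it matches a pair of positions with the pair on which \<open>\<tau>\<close> acts\<close>
  define m where "m = (\<lambda>(i, j). (min (\<sigma> i) (\<sigma> j), max (\<sigma> i) (\<sigma> j)))"
  have th_sym: "th a b = th b a" and th_sq: "th a b * th a b = 1" for a b
    by (simp_all add: th_def ksign_def mult.commute)
  have fin: "finite I"
    by (rule finite_subset[of _ "{..<length ds} \<times> {..<length ds}"]) (auto simp: I_def)
  have inj\<sigma>: "\<sigma> i = \<sigma> j \<longleftrightarrow> i = j" for i j using permutes_inj[OF \<sigma>] by (rule inj_eq)
  have less: "\<sigma> i < length ds \<longleftrightarrow> i < length ds" for i using permutes_in_image[OF \<sigma>, of i] by simp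
  have inj\<tau>: "\<tau> i = \<tau> j \<longleftrightarrow> i = j" for i j using permutes_inj[OF \<tau>] by (rule inj_eq)
  have inj: "inj_on m I"
    by (auto simp: inj_on_def I_def m_def min_def max_def inj\<sigma> split: if_splits)
  have "m ` I \<subseteq> I"
  proof (intro image_subsetI)
    fix p assume p: "p \<in> I"
    obtain i j where ij: "p = (i, j)" by (cases p)
    with p have "\<sigma> i < \<sigma> j \<or> \<sigma> j < \<sigma> i" using inj\<sigma>[of i j] by (auto simp: I_def)
    with p show "m p \<in> I" by (auto simp: ij I_def m_def less)
  qed
  with inj fin have bij: "bij_betw m I I"
    by (simp add: bij_betw_def endo_inj_surj)
  have chi: "chi es \<rho> = (\<Prod>(i, j)\<in>I. if \<rho> j < \<rho> i then - ksign (es ! \<rho> i * es ! \<rho> j) else 1)"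
    if "length es = length ds" for es \<rho>
  proof -
    have "{(i, j). i < j \<and> j < length es \<and> \<rho> j < \<rho> i} = {p \<in> I. case p of (i, j) \<Rightarrow> \<rho> j < \<rho> i}"
      using that by (auto simp: I_def)
    then show ?thesis unfolding chi_def
      using fin by (simp add: prod.inter_filter case_prod_unfold)
  qed
  have "chi ds \<tau> = (\<Prod>p\<in>I. case m p of (a, b) \<Rightarrow> if \<tau> b < \<tau> a then th (\<tau> a) (\<tau> b) else 1)"
    unfolding chi[OF refl] th_def by (rule prod.reindex_bij_betw[OF bij, symmetric])
  moreover have "chi (permute_list \<tau> ds) \<sigma> = (\<Prod>(i, j)\<in>I. if \<sigma> j < \<sigma> i then th (\<tau> (\<sigma> i)) (\<tau> (\<sigma> j)) else 1)"
    by (subst chi) (auto simp: I_def th_def less permute_list_def intro!: prod.cong)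
  moreover have "chi ds (\<tau> \<circ> \<sigma>) = (\<Prod>(i, j)\<in>I. if \<tau> (\<sigma> j) < \<tau> (\<sigma> i) then th (\<tau> (\<sigma> i)) (\<tau> (\<sigma> j)) else 1)"
    unfolding chi[OF refl] th_def comp_def ..
  moreover have pw: "(case m p of (a, b) \<Rightarrow> if \<tau> b < \<tau> a then th (\<tau> a) (\<tau> b) else 1) *
      (case p of (i, j) \<Rightarrow> if \<sigma> j < \<sigma> i then th (\<tau> (\<sigma> i)) (\<tau> (\<sigma> j)) else 1) =
      (case p of (i, j) \<Rightarrow> if \<tau> (\<sigma> j) < \<tau> (\<sigma> i) then th (\<tau> (\<sigma> i)) (\<tau> (\<sigma> j)) else 1)" if p: "p \<in> I" for p
  proof (cases p)
    case (Pair i j)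
    then have "\<tau> (\<sigma> i) \<noteq> \<tau> (\<sigma> j)" using p by (simp add: inj\<sigma> inj\<tau> I_def)
    then show ?thesis using th_sym[of "\<tau> (\<sigma> i)" "\<tau> (\<sigma> j)"] th_sq[of "\<tau> (\<sigma> i)" "\<tau> (\<sigma> j)"]
      by (auto simp: Pair m_def min_def max_def)
  qed
  ultimately show ?thesis
    by (simp only: prod.distrib[symmetric]) (rule prod.cong[OF refl pw[symmetric]])
qed

lemma chi_id: "chi ds id = 1"
  unfolding chi_def by (rule prod.neutral) auto

lemma chi_square: "chi ds \<sigma> * chi ds \<sigma> = 1"
  unfolding chi_def prod.distrib[symmetric] by (rule prod.neutral) (auto simp: ksign_def)


section \<open>Homogeneous components and multilinear extension\<close>

locale graded_ambient = graded_sums scale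
  for scale :: "'k::comm_ring_1 \<Rightarrow> 'v::ab_group_add \<Rightarrow> 'v" (infixr \<open>*s\<close> 75) +
  fixes G :: "int \<Rightarrow> 'v set"
  assumes graded: "graded_module scale UNIV G"
begin

lemma G_subspace: "subspace (G p)"
  using graded graded_module.subspace_grade by blast

lemma decomp_hcomp: "is_decomp G x (hcomp G x)"
  unfolding hcomp_def by (rule theI'[OF graded_module.direct_sum[OF graded UNIV_I]])

lemma hcomp_eqI: "is_decomp G x c \<Longrightarrow> hcomp G x = c"
  using decomp_hcomp graded_module.direct_sum[OF graded, of x] by blast

lemma hcomp_G: "hcomp G x p \<in> G p" and finite_hcomp: "finite {p. hcomp G x p \<noteq> 0}"
  using decomp_hcomp[of x] by (simp_all add: is_decomp_def)

lemma hcomp_eqI':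
  assumes "finite S" "\<And>p. c p \<in> G p" "\<And>p. p \<notin> S \<Longrightarrow> c p = 0" "x = (\<Sum>p\<in>S. c p)"
  shows "hcomp G x = c"
proof (rule hcomp_eqI)
  have sub: "{p. c p \<noteq> 0} \<subseteq> S" using assms(3) by auto
  then have "(\<Sum>p\<in>S. c p) = (\<Sum>p\<in>{p. c p \<noteq> 0}. c p)"
    by (intro sum.mono_neutral_right assms(1)) auto
  then show "is_decomp G x c"
    using assms finite_subset[OF sub] by (simp add: is_decomp_def)
qed

lemma sum_hcomp:
  assumes "finite S" "{p. hcomp G x p \<noteq> 0} \<subseteq> S"
  shows "(\<Sum>p\<in>S. hcomp G x p) = x"
proof -
  have "(\<Sum>p\<in>S. hcomp G x p) = (\<Sum>p\<in>{p. hcomp G x p \<noteq> 0}. hcomp G x p)"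
    by (intro sum.mono_neutral_right assms) auto
  also have "\<dots> = x" using decomp_hcomp[of x] by (simp add: is_decomp_def)
  finally show ?thesis .
qed

lemma hcomp_homog: "x \<in> G q \<Longrightarrow> hcomp G x = (\<lambda>p. if p = q then x else 0)"
  by (rule hcomp_eqI'[of "{q}"]) (auto intro: subspace_0 G_subspace)

lemma hcomp_map:
  assumes "additive h" and h: "\<And>p x. x \<in> G p \<Longrightarrow> h x \<in> G (p + q)"
  shows "hcomp G (h x) p = h (hcomp G x (p - q))"
proof -
  interpret additive h by fact
  let ?S = "{p. hcomp G x p \<noteq> 0}"
  have "hcomp G (h x) = (\<lambda>p. h (hcomp G x (p - q)))"
  proof (rule hcomp_eqI'[of "(\<lambda>p. p + q) ` ?S"])
    show "h (hcomp G x (p - q)) \<in> G p" for p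
      using h[OF hcomp_G, of x "p - q"] by simp
    show "h (hcomp G x (p - q)) = 0" if "p \<notin> (\<lambda>p. p + q) ` ?S" for p
    proof -
      have "p - q \<notin> ?S" using that by (auto simp: image_iff)
      then show ?thesis by (simp add: zero)
    qed
    have "h x = h (\<Sum>p\<in>?S. hcomp G x p)" by (simp add: sum_hcomp[OF finite_hcomp])
    also have "\<dots> = (\<Sum>p\<in>(\<lambda>p. p + q) ` ?S. h (hcomp G x (p - q)))"
      by (simp add: sum sum.reindex inj_on_def)
    finally show "h x = (\<Sum>p\<in>(\<lambda>p. p + q) ` ?S. h (hcomp G x (p - q)))" .
  qed (simp add: finite_hcomp)
  then show ?thesis by simp
qed

lemma hcomp_add: "hcomp G (x + y) p = hcomp G x p + hcomp G y p"
proof -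
  let ?S = "\<lambda>x. {p. hcomp G x p \<noteq> 0}"
  have "hcomp G (x + y) = (\<lambda>p. hcomp G x p + hcomp G y p)"
  proof (rule hcomp_eqI'[of "?S x \<union> ?S y"])
    show "x + y = (\<Sum>p\<in>?S x \<union> ?S y. hcomp G x p + hcomp G y p)"
      by (simp add: sum.distrib sum_hcomp finite_hcomp)
  qed (auto simp: finite_hcomp intro: hcomp_G subspace_add G_subspace)
  then show ?thesis by simp
qed

lemma hcomp_scale: "hcomp G (r *s x) p = r *s hcomp G x p"
  using hcomp_map[of "\<lambda>x. r *s x" 0 x p]
  by (simp add: additive_def scale_right_distrib subspace_scale G_subspace)

lemma eq_0_if_homog_0:
  assumes "additive h" "\<And>p x. x \<in> G p \<Longrightarrow> h x = 0"
  shows "h x = 0"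
proof -
  interpret additive h by fact
  have "h x = h (\<Sum>p\<in>{p. hcomp G x p \<noteq> 0}. hcomp G x p)"
    by (simp add: sum_hcomp finite_hcomp)
  also have "\<dots> = 0"
    unfolding sum by (rule sum.neutral) (use assms(2) hcomp_G in blast)
  finally show ?thesis .
qed

abbreviation mlinear :: "nat \<Rightarrow> ('v list \<Rightarrow> 'v) \<Rightarrow> bool" where
  "mlinear n F \<equiv> multilinear scale UNIV scale UNIV n F"

lemma mlinear_update:
  assumes "mlinear n F" "length xs = n" "i < n"
  shows "F (xs[i := x + y]) = F (xs[i := x]) + F (xs[i := y])"
    and "F (xs[i := r *s x]) = r *s F (xs[i := x])"
  using assms by (auto simp: multilinear_def)

lemma mlinearI:
  assumes "\<And>xs i x y r. \<lbrakk>length xs = n; i < n\<rbrakk> \<Longrightarrow>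
     F (xs[i := x + y]) = F (xs[i := x]) + F (xs[i := y]) \<and> F (xs[i := r *s x]) = r *s F (xs[i := x])"
  shows "mlinear n F"
  using assms by (simp add: multilinear_def)

lemma mlinear_zero:
  assumes "mlinear n F" "length xs = n" "0 \<in> set xs"
  shows "F xs = 0"
proof -
  obtain i where i: "i < n" "xs ! i = 0" using assms by (auto simp: in_set_conv_nth)
  have "F xs = F (xs[i := 0 *s 0])" using list_update_id[of xs i] i by simp
  also have "\<dots> = 0" using mlinear_update(2)[OF assms(1,2) i(1), of 0 0] by simp
  finally show ?thesis .
qed

lemma mlinear_sum:
  assumes "\<And>s. s \<in> S \<Longrightarrow> mlinear n (F s)"
  shows "mlinear n (\<lambda>xs. \<Sum>s\<in>S. F s xs)"
  by (intro mlinearI) (auto simp: mlinear_update[OF assms] scale_sum_right simp flip: sum.distrib intro!: sum.cong)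

lemma mlinear_scale: "mlinear n F \<Longrightarrow> mlinear n (\<lambda>xs. c *s F xs)"
  by (intro mlinearI) (simp add: mlinear_update scale_right_distrib mult.commute)

lemma mlinear_minus: "mlinear n F \<Longrightarrow> mlinear n (\<lambda>xs. - F xs)"
  using mlinear_scale[of n F "- 1"] by simp

lemma mlinear_permute:
  assumes "mlinear n F" "\<sigma> permutes {..<n}"
  shows "mlinear n (\<lambda>xs. F (permute_list \<sigma> xs))"
proof (rule mlinearI)
  fix xs :: "'v list" and i x y r assume n: "length xs = n" "i < n"
  have upd: "permute_list \<sigma> (xs[i := z]) = (permute_list \<sigma> xs)[inv \<sigma> i := z]" for z
  proof (rule nth_equalityI)
    fix j assume "j < length (permute_list \<sigma> (xs[i := z]))"
    then have j: "j < n" using n by simp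
    have "\<sigma> j < n" using permutes_in_image[OF assms(2)] j by simp
    moreover have "\<sigma> j = i \<longleftrightarrow> inv \<sigma> i = j" using permutes_inv_eq[OF assms(2)] by auto
    ultimately show "permute_list \<sigma> (xs[i := z]) ! j = (permute_list \<sigma> xs)[inv \<sigma> i := z] ! j"
      using n j by (auto simp: permute_list_def nth_list_update)
  qed simp
  have "inv \<sigma> i < n" using permutes_in_image[OF permutes_inv[OF assms(2)]] n by simp
  then show "F (permute_list \<sigma> (xs[i := x + y])) = F (permute_list \<sigma> (xs[i := x])) + F (permute_list \<sigma> (xs[i := y])) \<and>
     F (permute_list \<sigma> (xs[i := r *s x])) = r *s F (permute_list \<sigma> (xs[i := x]))"
    unfolding upd using mlinear_update[OF assms(1)] n by simp
qed

lemma listset_iff: "ds \<in> listset As \<longleftrightarrow> list_all2 (\<in>) ds As"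
  by (induction As arbitrary: ds) (auto simp: set_Cons_def list_all2_Cons2)

text \<open>Summing over one finite set \<open>S\<close> of degrees that contains the degrees of all arguments makes the index
  set independent of the arguments, so that multilinearity can be checked summand by summand. The
  additional summands vanish because they have a zero entry.\<close>

lemma homog_extension_eq:
  assumes mlinear: "\<And>ds. length ds = n \<Longrightarrow> mlinear n (F ds)" and n: "length xs = n"
    and S: "finite S" "\<And>x. x \<in> set xs \<Longrightarrow> {p. hcomp G x p \<noteq> 0} \<subseteq> S"
  shows "homog_extension G F xs =
    (\<Sum>ds\<in>{ds. set ds \<subseteq> S \<and> length ds = n}. F ds (map2 (hcomp G) xs ds))"
  unfolding homog_extension_def
proof (rule sum.mono_neutral_left)
  show "finite {ds. set ds \<subseteq> S \<and> length ds = n}" by (rule finite_lists_length_eq[OF S(1)])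
  show "listset (map (\<lambda>x. {p. hcomp G x p \<noteq> 0}) xs) \<subseteq> {ds. set ds \<subseteq> S \<and> length ds = n}"
  proof
    fix ds assume "ds \<in> listset (map (\<lambda>x. {p. hcomp G x p \<noteq> 0}) xs)"
    then have l: "length ds = n" "\<And>i. i < n \<Longrightarrow> hcomp G (xs ! i) (ds ! i) \<noteq> 0"
      using n by (auto simp: listset_iff list_all2_conv_all_nth)
    moreover have "set ds \<subseteq> S"
    proof
      fix p assume "p \<in> set ds"
      then obtain i where "i < n" "p = ds ! i" using l by (auto simp: in_set_conv_nth)
      with l S(2)[of "xs ! i"] n show "p \<in> S" by auto
    qed
    ultimately show "ds \<in> {ds. set ds \<subseteq> S \<and> length ds = n}" by simp
  qed
  show "\<forall>ds\<in>{ds. set ds \<subseteq> S \<and> length ds = n} - listset (map (\<lambda>x. {p. hcomp G x p \<noteq> 0}) xs).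
       F ds (map2 (hcomp G) xs ds) = 0"
  proof
    fix ds assume ds: "ds \<in> {ds. set ds \<subseteq> S \<and> length ds = n} - listset (map (\<lambda>x. {p. hcomp G x p \<noteq> 0}) xs)"
    then obtain i where "i < n" "hcomp G (xs ! i) (ds ! i) = 0"
      using n by (auto simp: listset_iff list_all2_conv_all_nth)
    then have "0 \<in> set (map2 (hcomp G) xs ds)"
      using n ds nth_mem[of i "map2 (hcomp G) xs ds"] by auto
    with mlinear ds n show "F ds (map2 (hcomp G) xs ds) = 0" by (intro mlinear_zero[of n]) auto
  qed
qed

lemma mlinear_homog_extension:
  assumes mlinear: "\<And>ds. length ds = n \<Longrightarrow> mlinear n (F ds)"
  shows "mlinear n (homog_extension G F)"
proof (rule mlinearI)
  fix xs :: "'v list" and i x y r assume n: "length xs = n" "i < n"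
  define S where "S = (\<Union>x\<in>{x, y, x + y, r *s x} \<union> set xs. {p. hcomp G x p \<noteq> 0})"
  have eq: "homog_extension G F (xs[i := z]) =
      (\<Sum>ds\<in>{ds. set ds \<subseteq> S \<and> length ds = n}. F ds ((map2 (hcomp G) xs ds)[i := hcomp G z (ds ! i)]))"
    if z: "z \<in> {x, y, x + y, r *s x}" for z
  proof -
    have "homog_extension G F (xs[i := z]) =
       (\<Sum>ds\<in>{ds. set ds \<subseteq> S \<and> length ds = n}. F ds (map2 (hcomp G) (xs[i := z]) ds))"
    proof (rule homog_extension_eq[OF mlinear])
      show "finite S" by (auto simp: S_def finite_hcomp)
      show "{p. hcomp G w p \<noteq> 0} \<subseteq> S" if "w \<in> set (xs[i := z])" for w
        using set_update_subset_insert[of xs i z] that z unfolding S_def by blast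
    qed (use n in auto)
    also have "\<dots> = (\<Sum>ds\<in>{ds. set ds \<subseteq> S \<and> length ds = n}. F ds ((map2 (hcomp G) xs ds)[i := hcomp G z (ds ! i)]))"
      using n by (intro sum.cong refl arg_cong2[where f=F] nth_equalityI) (auto simp: nth_list_update)
    finally show ?thesis .
  qed
  show "homog_extension G F (xs[i := x + y]) = homog_extension G F (xs[i := x]) + homog_extension G F (xs[i := y]) \<and>
     homog_extension G F (xs[i := r *s x]) = r *s homog_extension G F (xs[i := x])"
    using n by (simp add: eq hcomp_add hcomp_scale mlinear_update[OF mlinear] sum.distrib scale_sum_right)
qed

lemma homog_extension_homog:
  assumes mlinear: "\<And>ds. length ds = n \<Longrightarrow> mlinear n (F ds)" and n: "length xs = n"
    and ds: "homog G ds xs"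
  shows "homog_extension G F xs = F ds xs"
proof -
  have l: "length ds = n" "\<And>i. i < n \<Longrightarrow> xs ! i \<in> G (ds ! i)"
    using ds n by (auto simp: homog_def list_all2_conv_all_nth)
  have h: "hcomp G (xs ! i) = (\<lambda>p. if p = ds ! i then xs ! i else 0)" if "i < n" for i
    using l(2)[OF that] by (rule hcomp_homog)
  have "homog_extension G F xs =
    (\<Sum>es\<in>{es. set es \<subseteq> set ds \<and> length es = n}. F es (map2 (hcomp G) xs es))"
  proof (rule homog_extension_eq[OF mlinear n])
    fix x assume "x \<in> set xs"
    then obtain i where "i < n" "x = xs ! i" using n by (auto simp: in_set_conv_nth)
    then show "{p. hcomp G x p \<noteq> 0} \<subseteq> set ds" using h[of i] l(1) by auto
  qed auto
  also have "\<dots> = (\<Sum>es\<in>{ds}. F es (map2 (hcomp G) xs es))"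
  proof (rule sum.mono_neutral_right)
    show "\<forall>es\<in>{es. set es \<subseteq> set ds \<and> length es = n} - {ds}. F es (map2 (hcomp G) xs es) = 0"
    proof
      fix es assume es: "es \<in> {es. set es \<subseteq> set ds \<and> length es = n} - {ds}"
      then obtain i where i: "i < n" "es ! i \<noteq> ds ! i" using l(1) by (auto simp: list_eq_iff_nth_eq)
      then have "0 \<in> set (map2 (hcomp G) xs es)"
        using n es h[of i] nth_mem[of i "map2 (hcomp G) xs es"] by auto
      with mlinear es n show "F es (map2 (hcomp G) xs es) = 0" by (intro mlinear_zero[of n]) auto
    qed
  qed (use l(1) finite_lists_length_eq in auto)
  also have "\<dots> = F ds (map2 (hcomp G) xs ds)" by simp
  also have "map2 (hcomp G) xs ds = xs"
    using n l h by (intro nth_equalityI) auto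
  finally show ?thesis by simp
qed

end


section \<open>Sums over oriented trees\<close>

lemma size1_label_all [simp]: "size1 (label_all g \<phi>) = size1 \<phi>"
  by (simp add: label_all_def size1_size)

lemma size1_label_root [simp]: "size1 (label_root b g \<phi>) = size1 \<phi>"
  by (cases \<phi>) (simp_all)

lemma label_all_simps [simp]: "label_all g \<langle>\<rangle> = \<langle>\<rangle>" "label_all g \<langle>l, u, r\<rangle> = \<langle>label_all g l, g, label_all g r\<rangle>"
  by (simp_all add: label_all_def)

lemma label_root_self: "label_root g g \<phi> = label_all g \<phi>"
  by (cases \<phi>) simp_all

lemma tree_deg_label_all: "tree_deg (label_all (q, b) \<phi>) = q * (int (size1 \<phi>) - 1)"
  by (induction \<phi>) (simp_all add: algebra_simps)

lemma length_left_steps: "length (left_steps \<phi>) = size1 \<phi>"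
  by (induction \<phi>) simp_all

text \<open>This is \<open>tree_sign\<close> without the exception for the tree with one leaf, where it is \<open>- 1\<close>. The sign of
  a tree thus becomes multiplicative up to \<open>(-1)^k\<close> for \<open>k\<close> leaves on the left (each of them gets one more
  left step), and the outer minus sign in \<open>f_n\<close> makes the formula for \<open>f_n\<close> give the inclusion for
  \<open>n = 1\<close>.\<close>

definition leaf_sign :: "'a tree \<Rightarrow> int" where
  "leaf_sign \<phi> = ksign (\<Sum>w\<leftarrow>left_steps \<phi>. int w + 1)"

lemma leaf_sign_Leaf [simp]: "leaf_sign \<langle>\<rangle> = - 1"
  by (simp add: leaf_sign_def ksign_def)

lemma leaf_sign_Node: "leaf_sign \<langle>l, u, r\<rangle> = ksign (int (size1 l)) * (leaf_sign l * leaf_sign r)"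
proof -
  have "(\<Sum>w\<leftarrow>map Suc ws. int w + 1) = int (length ws) + (\<Sum>w\<leftarrow>ws. int w + 1)" for ws
    by (induction ws) simp_all
  then show ?thesis
    by (simp add: leaf_sign_def ksign_add length_left_steps del: map_map)
qed

lemma tree_sign_Node: "tree_sign \<langle>l, u, r\<rangle> = leaf_sign \<langle>l, u, r\<rangle>"
proof -
  have "(\<Sum>w\<leftarrow>ws. int w + 1) = int (\<Sum>w\<leftarrow>ws. w + 1)" for ws
    by (induction ws) simp_all
  then show ?thesis by (simp add: tree_sign_def leaf_sign_def ksign_def minus_one_power_iff del: left_steps.simps)
qed

lemma Ot_0 [simp]: "Ot 0 = {}" by (simp add: Ot_def)
lemma Ot_1 [simp]: "Ot (Suc 0) = {\<langle>\<rangle>}"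
  by (auto simp: Ot_def size1_size)

lemma Ot_rec: "2 \<le> n \<Longrightarrow> Ot n = (\<lambda>(k, l, r). \<langle>l, (), r\<rangle>) ` (SIGMA k:{..n}. Ot k \<times> Ot (n - k))"
proof (intro set_eqI iffI)
  fix \<phi> assume n: "2 \<le> n" and "\<phi> \<in> Ot n"
  then have \<phi>: "size1 \<phi> = n" by (simp add: Ot_def)
  with n obtain l u r where [simp]: "\<phi> = \<langle>l, u, r\<rangle>" by (cases \<phi>) auto
  show "\<phi> \<in> (\<lambda>(k, l, r). \<langle>l, (), r\<rangle>) ` (SIGMA k:{..n}. Ot k \<times> Ot (n - k))"
    by (rule image_eqI[of _ _ "(size1 l, l, r)"]) (use \<phi> in \<open>auto simp: Ot_def\<close>)
qed (auto simp: Ot_def)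

lemma finite_Ot [simp]: "finite (Ot n)"
proof (induction n rule: less_induct)
  case (less n)
  consider "n = 0" | "n = Suc 0" | "2 \<le> n" by linarith
  then show ?case
  proof cases
    case 3
    have "finite (Ot k \<times> Ot (n - k))" if "k \<in> {..n}" for k
      using that less by (cases "k = 0 \<or> k = n") auto
    then show ?thesis unfolding Ot_rec[OF 3]
      by (rule finite_imageI[OF finite_SigmaI[OF finite_atMost]])
  qed simp_all
qed

text \<open>The indices \<open>k = 0\<close> and \<open>k = n\<close> are harmless, since no tree has zero leaves.\<close>

lemma sum_Ot_rec:
  assumes "2 \<le> n"
  shows "(\<Sum>\<phi>\<in>Ot n. F \<phi>) = (\<Sum>k\<le>n. \<Sum>l\<in>Ot k. \<Sum>r\<in>Ot (n - k). F \<langle>l, (), r\<rangle>)"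
proof -
  have "(\<Sum>\<phi>\<in>Ot n. F \<phi>) = (\<Sum>(k, l, r)\<in>(SIGMA k:{..n}. Ot k \<times> Ot (n - k)). F \<langle>l, (), r\<rangle>)"
    unfolding Ot_rec[OF assms]
    by (subst sum.reindex) (auto simp: inj_on_def Ot_def case_prod_unfold)
  also have "\<dots> = (\<Sum>k\<le>n. \<Sum>(l, r)\<in>Ot k \<times> Ot (n - k). F \<langle>l, (), r\<rangle>)"
    by (subst sum.Sigma) auto
  finally show ?thesis by (simp add: sum.cartesian_product)
qed

context graded_sums
begin

lemma scale_chi_square: "of_int (chi ds \<sigma>) *s (of_int (chi ds \<sigma>) *s x) = x"
  by (simp add: chi_square flip: of_int_mult)

text \<open>Antisymmetrized maps are antisymmetric: reindex the sum by left multiplication with \<open>\<tau>\<close>.\<close>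

lemma alternate_permute:
  assumes \<tau>: "\<tau> permutes {..<length zs}"
  shows "alternate (permute_list \<tau> zs) F = of_int (chi (map fst zs) \<tau>) *s alternate zs F"
proof -
  let ?S = "{\<sigma>. \<sigma> permutes {..<length zs}}"
  have "of_int (chi (map fst zs) \<tau>) *s alternate zs F = (\<Sum>\<sigma>\<in>?S.
      of_int (chi (map fst zs) \<tau>) *s of_int (chi (map fst zs) (\<tau> \<circ> \<sigma>)) *s F (permute_list (\<tau> \<circ> \<sigma>) zs))"
    unfolding alternate_def scale_sum_right by (rule setum_permutations_compose_left[OF \<tau>])
  also have "\<dots> = alternate (permute_list \<tau> zs) F"
    unfolding alternate_def length_permute_list
  proof (intro sum.cong refl, goal_cases)
    case (1 \<sigma>)
    then have \<sigma>: "\<sigma> permutes {..<length (map fst zs)}" "\<sigma> permutes {..<length zs}" by simp_all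
    have \<tau>': "\<tau> permutes {..<length (map fst zs)}" using \<tau> by simp
    show ?case
      unfolding chi_comp[OF \<sigma>(1) \<tau>'] permute_list_compose[OF \<sigma>(2)] permute_list_map[OF \<tau>, symmetric]
      by (simp only: of_int_mult scale_scale[symmetric] scale_chi_square)
  qed
  finally show ?thesis ..
qed

lemma alternate_hom:
  assumes "module_hom scale scale h"
  shows "h (alternate zs F) = alternate zs (\<lambda>ys. h (F ys))"
proof -
  interpret module_hom scale scale h by fact
  show ?thesis by (simp add: alternate_def sum scale)
qed

lemma alternate_scale: "alternate zs (\<lambda>ys. c *s F ys) = c *s alternate zs F"
  by (simp add: alternate_def scale_sum_right mult.commute)

lemma alternate_sum: "alternate zs (\<lambda>ys. \<Sum>s\<in>S. F s ys) = (\<Sum>s\<in>S. alternate zs (F s))"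
  unfolding alternate_def scale_sum_right by (rule sum.swap)

definition bilin :: "('v \<Rightarrow> 'v \<Rightarrow> 'v) \<Rightarrow> bool" where
  "bilin b \<longleftrightarrow> (\<forall>y. module_hom scale scale (\<lambda>x. b x y)) \<and> (\<forall>x. module_hom scale scale (b x))"

lemma bilin_hom: "bilin b \<Longrightarrow> module_hom scale scale h \<Longrightarrow> bilin (\<lambda>x y. h (b x y))"
  unfolding bilin_def using module_hom_compose[of scale scale _ scale h] by (auto simp: comp_def)

lemma bilin_simps:
  assumes "bilin b"
  shows "b (x + x') y = b x y + b x' y" "b x (y + y') = b x y + b x y'"
    "b (c *s x) y = c *s b x y" "b x (c *s y) = c *s b x y" "b 0 y = 0" "b x 0 = 0"
    "b (- x) y = - b x y" "b x (- y) = - b x y"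
    "b (sum F S) y = (\<Sum>s\<in>S. b (F s) y)" "b x (sum F S) = (\<Sum>s\<in>S. b x (F s))"
proof -
  interpret l: module_hom scale scale "\<lambda>x. b x y" for y using assms by (simp add: bilin_def)
  interpret r: module_hom scale scale "b x" for x using assms by (simp add: bilin_def)
  show "b (x + x') y = b x y + b x' y" "b x (y + y') = b x y + b x y'"
    "b (c *s x) y = c *s b x y" "b x (c *s y) = c *s b x y" "b 0 y = 0" "b x 0 = 0"
    "b (- x) y = - b x y" "b x (- y) = - b x y"
    "b (sum F S) y = (\<Sum>s\<in>S. b (F s) y)" "b x (sum F S) = (\<Sum>s\<in>S. b x (F s))"
    by (rule l.add r.add l.scale r.scale l.zero r.zero l.neg r.neg l.sum r.sum)+
qed

definition teval :: "(int \<times> ('v \<Rightarrow> 'v \<Rightarrow> 'v)) tree \<Rightarrow> 'v glist \<Rightarrow> 'v" where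
  "teval B zs = tree_eval scale B (map fst zs) (map snd zs)"

lemma teval_Leaf [simp]: "teval \<langle>\<rangle> [z] = snd z"
  by (simp add: teval_def)

lemma teval_Node: "teval \<langle>l, (q, b), r\<rangle> zs = sg (tree_deg r * deg (take (size1 l) zs))
    (b (teval l (take (size1 l) zs)) (teval r (drop (size1 l) zs)))"
  by (simp add: teval_def take_map drop_map deg_def scale_ksign)

definition tree_sum :: "('v \<Rightarrow> 'v \<Rightarrow> 'v) \<Rightarrow> 'v glist \<Rightarrow> 'v" where
  "tree_sum g zs = (\<Sum>\<phi>\<in>Ot (length zs). of_int (leaf_sign \<phi>) *s teval (label_all (- 1, g) \<phi>) zs)"

lemma tree_sum_Nil [simp]: "tree_sum g [] = 0"
  and tree_sum_single [simp]: "tree_sum g [z] = - snd z"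
  by (simp_all add: tree_sum_def)

text \<open>Cutting all trees at the root. The right subtree, with \<open>j\<close> leaves, carries maps of total degree
  \<open>1 - j\<close>, so its Koszul sign gives \<open>(-1)^((j - 1) deg A)\<close>, and the recursion of the tree sign gives
  \<open>(-1)^(len A)\<close>. Together they form the sign of the bracket terms.\<close>

lemma root_sum_rec:
  assumes b: "bilin b" and n: "2 \<le> length zs"
  shows "(\<Sum>\<phi>\<in>Ot (length zs). of_int (tree_sign \<phi>) *s teval (label_root (q, b) (- 1, g) \<phi>) zs) =
    deconcat zs (\<lambda>A B. sg (len A + (len B - 1) * deg A) (b (tree_sum g A) (tree_sum g B)))"
  unfolding sum_Ot_rec[OF n] deconcat_sum
proof (intro sum.cong refl, goal_cases)
  case (1 k)
  let ?A = "take k zs" and ?B = "drop k zs"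
  have l: "length ?A = k" "length ?B = length zs - k" using 1 by auto
  have "sg (len ?A + (len ?B - 1) * deg ?A) (b (tree_sum g ?A) (tree_sum g ?B)) =
    (\<Sum>l\<in>Ot k. \<Sum>r\<in>Ot (length zs - k). sg (int k + (int (length zs - k) - 1) * deg ?A)
      (of_int (leaf_sign l) *s of_int (leaf_sign r) *s b (teval (label_all (- 1, g) l) ?A) (teval (label_all (- 1, g) r) ?B)))"
    unfolding tree_sum_def l unfolding bilin_simps(9)[OF b] unfolding bilin_simps(10)[OF b]
    by (simp only: bilin_simps(3,4)[OF b] sg_sum) (simp only: scale_scale mult.commute)
  also have "\<dots> = (\<Sum>l\<in>Ot k. \<Sum>r\<in>Ot (length zs - k).
     of_int (tree_sign \<langle>l, (), r\<rangle>) *s teval (label_root (q, b) (- 1, g) \<langle>l, (), r\<rangle>) zs)"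
  proof (intro sum.cong refl, goal_cases)
    case (1 l r)
    then have s: "size1 l = k" "size1 r = length zs - k" by (simp_all add: Ot_def)
    show ?case
      unfolding tree_sign_Node leaf_sign_Node label_root.simps teval_Node size1_label_all s
        tree_deg_label_all
      by (simp only: of_int_mult scale_scale[symmetric] scale_ksign sg_scale sg_sg)
        (intro arg_cong[of _ _ "scale _"] sg_cong refl; simp)
  qed
  finally show ?case ..
qed

lemma tree_sum_rec:
  assumes "bilin g" and n: "2 \<le> length zs"
  shows "tree_sum g zs = deconcat zs (\<lambda>A B. sg (len A + (len B - 1) * deg A) (g (tree_sum g A) (tree_sum g B)))"
proof -
  have "tree_sum g zs = (\<Sum>\<phi>\<in>Ot (length zs). of_int (tree_sign \<phi>) *s teval (label_root (- 1, g) (- 1, g) \<phi>) zs)"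
    unfolding tree_sum_def label_root_self
  proof (intro sum.cong refl, goal_cases)
    case (1 \<phi>)
    then show ?case using n by (cases \<phi>) (auto simp: Ot_def tree_sign_Node)
  qed
  then show ?thesis by (simp add: root_sum_rec[OF assms])
qed

lemma alternate_bilin:
  assumes b: "bilin b"
  shows "alternate A (\<lambda>A'. alternate B (\<lambda>B'. b (F A') (F' B'))) = b (alternate A F) (alternate B F')"
proof -
  have "module_hom scale scale (b x)" "module_hom scale scale (\<lambda>x. b x y)" for x y
    using b by (simp_all add: bilin_def)
  then show ?thesis by (simp add: alternate_hom[symmetric] alternate_hom[of "\<lambda>x. b x y" for y, symmetric])
qed

definition alt_tree_sum :: "('v \<Rightarrow> 'v \<Rightarrow> 'v) \<Rightarrow> 'v glist \<Rightarrow> 'v" where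
  "alt_tree_sum g zs = alternate zs (tree_sum g)"

lemma alt_tree_sum_Nil [simp]: "alt_tree_sum g [] = 0"
  by (simp add: alt_tree_sum_def)

lemma alt_tree_sum_single [simp]: "alt_tree_sum g [z] = - snd z"
  by (simp add: alt_tree_sum_def alternate_Cons)

text \<open>The recursion at the root after antisymmetrization. The sign of the bracket terms depends only on
  the lengths and degrees of the blocks, so it is not affected by permuting the entries of a block.\<close>

lemma alternate_root_sum:
  assumes b: "bilin b" and n: "2 \<le> length zs"
  shows "alternate zs (\<lambda>ys. \<Sum>\<phi>\<in>Ot (length zs). of_int (tree_sign \<phi>) *s teval (label_root (q, b) (- 1, g) \<phi>) ys) =
    unshuffle zs (\<lambda>A B. sg (len A + (len B - 1) * deg A) (b (alt_tree_sum g A) (alt_tree_sum g B)))" (is "?l = _")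
proof -
  have "?l = alternate zs (\<lambda>ys. deconcat ys (\<lambda>A B. sg (len A + (len B - 1) * deg A) (b (tree_sum g A) (tree_sum g B))))"
    by (intro alternate_cong) (use n in \<open>simp flip: root_sum_rec[OF b, of _ q]\<close>)
  also have "\<dots> = unshuffle zs (\<lambda>A B. alternate A (\<lambda>A'. alternate B (\<lambda>B'. sg (len A' + (len B' - 1) * deg A') (b (tree_sum g A') (tree_sum g B')))))"
    by (rule alternate_deconcat)
  also have "\<dots> = unshuffle zs (\<lambda>A B. sg (len A + (len B - 1) * deg A) (alternate A (\<lambda>A'. alternate B (\<lambda>B'. b (tree_sum g A') (tree_sum g B')))))"
    unfolding alternate_sg by (intro unshuffle_cong alternate_cong) simp
  finally show ?thesis unfolding alternate_bilin[OF b] alt_tree_sum_def .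
qed

lemma alt_tree_sum_rec:
  assumes b: "bilin g" and n: "2 \<le> length zs"
  shows "alt_tree_sum g zs = unshuffle zs (\<lambda>A B. sg (len A + (len B - 1) * deg A) (g (alt_tree_sum g A) (alt_tree_sum g B)))"
proof -
  have "alt_tree_sum g zs = alternate zs (\<lambda>ys. \<Sum>\<phi>\<in>Ot (length zs). of_int (tree_sign \<phi>) *s teval (label_root (- 1, g) (- 1, g) \<phi>) ys)"
    unfolding alt_tree_sum_def
  proof (rule alternate_cong, goal_cases)
    case (1 ys)
    then show ?case using n root_sum_rec[OF b, of ys "- 1" g] tree_sum_rec[OF b, of ys] by simp
  qed
  then show ?thesis by (simp add: alternate_root_sum[OF assms])
qed

end

context graded_ambient
begin

text \<open>For fixed degrees, the evaluation of a tree is multilinear in all arguments, homogeneous or not;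
  the degrees only enter through signs.\<close>

lemma mlinear_tree_eval:
  assumes "\<forall>(q, b)\<in>set_tree B. bilin b"
  shows "mlinear (size1 B) (tree_eval scale B ds)"
  using assms
proof (induction B arbitrary: ds)
  case Leaf
  show ?case by (intro mlinearI) (auto simp: length_Suc_conv)
next
  case (Node l qb r)
  obtain q b where [simp]: "qb = (q, b)" by (cases qb)
  have b: "bilin b" and l: "mlinear (size1 l) (tree_eval scale l es)" and r: "mlinear (size1 r) (tree_eval scale r es)" for es
    using Node by auto
  show ?case
  proof (rule mlinearI)
    fix xs :: "'v list" and i x y c assume n: "length xs = size1 \<langle>l, qb, r\<rangle>" "i < size1 \<langle>l, qb, r\<rangle>"
    let ?t = "take (size1 l)" and ?d = "drop (size1 l)"
    show "tree_eval scale \<langle>l, qb, r\<rangle> ds (xs[i := x + y]) = tree_eval scale \<langle>l, qb, r\<rangle> ds (xs[i := x]) + tree_eval scale \<langle>l, qb, r\<rangle> ds (xs[i := y])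
      \<and> tree_eval scale \<langle>l, qb, r\<rangle> ds (xs[i := c *s x]) = c *s tree_eval scale \<langle>l, qb, r\<rangle> ds (xs[i := x])"
    proof (cases "i < size1 l")
      case True
      have "?t (xs[i := z]) = (?t xs)[i := z]" "?d (xs[i := z]) = ?d xs" for z
        using True by (simp_all add: take_update_swap)
      moreover have "length (?t xs) = size1 l" using n by simp
      ultimately show ?thesis
        using mlinear_update[OF l _ True] by (simp add: bilin_simps[OF b] scale_right_distrib mult.commute)
    next
      case False
      have "?t (xs[i := z]) = ?t xs" "?d (xs[i := z]) = (?d xs)[i - size1 l := z]" for z
        using False by (simp_all add: drop_update_swap)
      moreover have "length (?d xs) = size1 r" "i - size1 l < size1 r" using n False by simp_all
      ultimately show ?thesis
        using mlinear_update[OF r] by (simp add: bilin_simps[OF b] scale_right_distrib mult.commute)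
    qed
  qed
qed

lemma tree_eval_degree:
  assumes "\<forall>(q, b)\<in>set_tree B. \<forall>p p' x x'. x \<in> G p \<longrightarrow> x' \<in> G p' \<longrightarrow> b x x' \<in> G (p + p' + q)"
    and "length zs = size1 B" "\<And>p x. (p, x) \<in> set zs \<Longrightarrow> x \<in> G p"
  shows "teval B zs \<in> G (deg zs + tree_deg B)"
  using assms
proof (induction B arbitrary: zs)
  case Leaf
  then show ?case by (auto simp: length_Suc_conv)
next
  case (Node l qb r)
  obtain q b where [simp]: "qb = (q, b)" by (cases qb)
  let ?A = "take (size1 l) zs" and ?B = "drop (size1 l) zs"
  have "teval l ?A \<in> G (deg ?A + tree_deg l)"
    by (rule Node.IH) (use Node.prems in \<open>auto dest: in_set_takeD\<close>)
  moreover have "teval r ?B \<in> G (deg ?B + tree_deg r)"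
    by (rule Node.IH) (use Node.prems in \<open>auto dest: in_set_dropD\<close>)
  ultimately have "b (teval l ?A) (teval r ?B) \<in> G ((deg ?A + tree_deg l) + (deg ?B + tree_deg r) + q)"
    using Node.prems(1) by auto
  also have "(deg ?A + tree_deg l) + (deg ?B + tree_deg r) + q = deg zs + tree_deg \<langle>l, qb, r\<rangle>"
    using deg_simps(3)[of ?A ?B] by (simp del: deg_simps)
  finally show ?case
    by (simp add: teval_Node sg_def subspace_neg G_subspace)
qed

lemma mlinear_alternate_tree:
  assumes "\<forall>(q, b)\<in>set_tree B. bilin b" "size1 B = n"
  shows "mlinear n (\<lambda>xs. \<Sum>\<sigma>\<in>{\<sigma>. \<sigma> permutes {..<n}}. of_int (chi ds \<sigma>) *s
    tree_eval scale B (permute_list \<sigma> ds) (permute_list \<sigma> xs))"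
  using mlinear_tree_eval[OF assms(1)] unfolding assms(2)
  by (intro mlinear_sum mlinear_scale mlinear_permute) auto

text \<open>The length of the list is made a constant, so that the summand is a multilinear map of fixed arity.\<close>

lemma tree_alt_cong_len:
  assumes "length xs = n"
  shows "tree_alt scale G B xs = homog_extension G (\<lambda>ds xs. \<Sum>\<sigma>\<in>{\<sigma>. \<sigma> permutes {..<n}}. of_int (chi ds \<sigma>) *s
    tree_eval scale B (permute_list \<sigma> ds) (permute_list \<sigma> xs)) xs"
  unfolding tree_alt_def homog_extension_def
proof (intro sum.cong refl, goal_cases)
  case (1 ds)
  then have "length ds = n" using assms by (auto simp: listset_iff dest: list_all2_lengthD)
  then show ?case using assms by simp
qed

lemma mlinear_tree_alt:
  assumes "\<forall>(q, b)\<in>set_tree B. bilin b" "size1 B = n"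
  shows "mlinear n (tree_alt scale G B)"
proof -
  have "mlinear n (homog_extension G (\<lambda>ds xs. \<Sum>\<sigma>\<in>{\<sigma>. \<sigma> permutes {..<n}}. of_int (chi ds \<sigma>) *s
    tree_eval scale B (permute_list \<sigma> ds) (permute_list \<sigma> xs)))"
    by (rule mlinear_homog_extension) (rule mlinear_alternate_tree[OF assms])
  then show ?thesis by (simp add: multilinear_def tree_alt_cong_len)
qed

lemma tree_alt_homog:
  assumes B: "\<forall>(q, b)\<in>set_tree B. bilin b" "size1 B = length zs"
    and zs: "\<And>p x. (p, x) \<in> set zs \<Longrightarrow> x \<in> G p"
  shows "tree_alt scale G B (map snd zs) = alternate zs (teval B)"
proof -
  have "homog G (map fst zs) (map snd zs)"
    using zs by (auto simp: homog_def list_all2_conv_all_nth)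
  then have "tree_alt scale G B (map snd zs) = (\<Sum>\<sigma>\<in>{\<sigma>. \<sigma> permutes {..<length zs}}. of_int (chi (map fst zs) \<sigma>) *s
    tree_eval scale B (permute_list \<sigma> (map fst zs)) (permute_list \<sigma> (map snd zs)))"
    by (subst tree_alt_cong_len[of _ "length zs"], simp, subst homog_extension_homog[OF mlinear_alternate_tree[OF B]]) simp_all
  also have "\<dots> = alternate zs (teval B)"
    unfolding alternate_def by (intro sum.cong refl) (simp add: teval_def permute_list_map)
  finally show ?thesis .
qed


section \<open>Insertion and bracket sums as sums over unshuffles\<close>

lemma sum_pairs:
  fixes n :: nat
  shows "(\<Sum>(k, l)\<in>{(k, l). 1 \<le> k \<and> 1 \<le> l \<and> k + l = n + 1}. F k l) = (\<Sum>k=1..n. F k (n + 1 - k))"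
proof -
  have eq: "{(k, l). 1 \<le> k \<and> 1 \<le> l \<and> k + l = n + 1} = (\<lambda>k. (k, n + 1 - k)) ` {1..n}"
    by (auto simp: image_iff)
  show ?thesis unfolding eq by (subst sum.reindex) (auto simp: inj_on_def)
qed

lemma insertion_sum_unshuffle:
  "insertion_sum scale F \<mu> (map fst zs) (map snd zs) =
   unshuffle zs (\<lambda>A B. if A = [] then 0 else
     sg (len A * len B) (F (Suc (length B)) (\<mu> (length A) (map snd A) # map snd B)))"
  (is "_ = unshuffle zs ?G")
proof -
  let ?n = "length zs"
  have "unshuffle zs ?G = (\<Sum>k\<in>{1..?n}. \<Sum>\<sigma>\<in>Sh k ?n. of_int (chi (map fst zs) \<sigma>) *s
     ?G (take k (permute_list \<sigma> zs)) (drop k (permute_list \<sigma> zs)))"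
    unfolding unshuffle_Sh by (rule sum.mono_neutral_right) (auto simp: not_le)
  also have "\<dots> = insertion_sum scale F \<mu> (map fst zs) (map snd zs)"
    unfolding insertion_sum_def length_map sum_pairs
  proof (intro sum.cong refl, goal_cases)
    case (1 k \<sigma>)
    have nz: "zs \<noteq> []" using 1 by auto
    then have ne: "permute_list \<sigma> zs \<noteq> []" by (metis length_0_conv length_permute_list)
    have "((- 1) ^ (k * (?n + 1 - k - 1)) :: int) = ksign (int k * int (?n - k))"
      using 1 by (auto simp: ksign_def minus_one_power_iff)
    moreover have "?n + 1 - k = Suc (?n - k)" using 1 by auto
    ultimately show ?case
      using 1 nz ne by (auto simp: scale_ksign_mult sg_scale permute_list_map Sh_permutes take_map drop_map min_def)
  qed
  finally show ?thesis ..
qed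

text \<open>A shuffle with \<open>\<sigma> 0 < \<sigma> i\<close> has its value 0 at position 0, so it arises from a shuffle of the
  remaining entries by putting the first entry at the start of the left block.\<close>

lemma bracket_sum_unshuffle:
  "bracket_sum scale br f (map fst (z # zs)) (map snd (z # zs)) =
   unshuffle zs (\<lambda>A B. if B = [] then 0 else sg (1 + len A + (len B - 1) * (fst z + deg A))
     (br (f (Suc (length A)) (snd z # map snd A)) (f (length B) (map snd B))))"
  (is "_ = unshuffle zs ?G")
proof -
  let ?n = "length zs"
  have eq: "{(i, j). 1 \<le> i \<and> 1 \<le> j \<and> i + j = Suc ?n} = (\<lambda>k. (Suc k, ?n - k)) ` {..<?n}"
    by (auto simp: image_iff Suc_le_eq gr0_conv_Suc) (metis Suc_diff_Suc)
  have Sh: "{\<sigma> \<in> Sh (Suc k) (Suc ?n). \<sigma> 0 < \<sigma> (Suc k)} = ins_perm 0 ` Sh k ?n" if "k < ?n" for k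
  proof (intro set_eqI iffI)
    fix \<sigma> assume "\<sigma> \<in> {\<sigma> \<in> Sh (Suc k) (Suc ?n). \<sigma> 0 < \<sigma> (Suc k)}"
    then have \<sigma>: "\<sigma> \<in> Sh (Suc k) (Suc ?n)" "\<sigma> (Suc k) \<noteq> 0" by auto
    show "\<sigma> \<in> ins_perm 0 ` Sh k ?n"
      by (rule Sh_Suc_cases[OF \<sigma>(1)]) (use \<sigma>(2) that in auto)
  next
    fix \<sigma> assume "\<sigma> \<in> ins_perm 0 ` Sh k ?n"
    then show "\<sigma> \<in> {\<sigma> \<in> Sh (Suc k) (Suc ?n). \<sigma> 0 < \<sigma> (Suc k)}"
      using that by (auto simp: ins_perm_0_Sh Sh_permutes)
  qed
  have "unshuffle zs ?G = (\<Sum>k\<in>{..<?n}. \<Sum>\<sigma>\<in>Sh k ?n. of_int (chi (map fst zs) \<sigma>) *s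
     ?G (take k (permute_list \<sigma> zs)) (drop k (permute_list \<sigma> zs)))"
    unfolding unshuffle_Sh by (rule sum.mono_neutral_right) (auto simp: not_less)
  also have "\<dots> = bracket_sum scale br f (map fst (z # zs)) (map snd (z # zs))"
    unfolding bracket_sum_def length_map length_Cons eq
  proof (subst sum.reindex, (auto simp: inj_on_def)[1], unfold comp_def case_prod_conv, rule sum.cong[OF refl], goal_cases)
    case (1 k)
    then have k: "k < ?n" by simp
    show ?case unfolding Sh[OF k]
    proof (subst sum.reindex, (auto simp: inj_on_def dest: ins_perm_inject)[1], rule sum.cong[OF refl], unfold comp_def, goal_cases)
      case (1 \<sigma>)
      let ?A = "take k (permute_list \<sigma> zs)" and ?B = "drop k (permute_list \<sigma> zs)"
      have \<sigma>: "\<sigma> permutes {..<length zs}" using 1 by (rule Sh_permutes)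
      have p: "permute_list (ins_perm 0 \<sigma>) (map fst (z # zs)) = fst z # permute_list \<sigma> (map fst zs)"
        "permute_list (ins_perm 0 \<sigma>) (map snd (z # zs)) = snd z # permute_list \<sigma> (map snd zs)"
        using \<sigma> by (simp_all add: permute_list_ins_perm)
      have chi: "chi (map fst (z # zs)) (ins_perm 0 \<sigma>) = chi (map fst zs) \<sigma>"
        using \<sigma> by (simp add: chi_ins_perm)
      have deg: "sum_list (take k (permute_list \<sigma> (map fst zs))) = deg ?A"
        using \<sigma> by (simp add: deg_def permute_list_map take_map)
      have s: "map snd ?A = take k (permute_list \<sigma> (map snd zs))" "map snd ?B = drop k (permute_list \<sigma> (map snd zs))"
        using \<sigma> by (simp_all add: permute_list_map take_map drop_map)
      have "?B \<noteq> []" "length ?A = k" "length ?B = ?n - k" using k by auto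
      then show ?case unfolding p chi s by (simp add: deg scale_ksign flip: scale_scale)
    qed
  qed
  finally show ?thesis ..
qed

end


section \<open>Tree sums solve the recursion\<close>

locale dg_contraction = graded_ambient scale G
  for scale :: "'k::comm_ring_1 \<Rightarrow> 'v::ab_group_add \<Rightarrow> 'v" (infixr \<open>*s\<close> 75)
    and G :: "int \<Rightarrow> 'v set" +
  fixes \<rho> :: "rat \<Rightarrow> 'k" and d \<eta> :: "'v \<Rightarrow> 'v" and br :: "'v \<Rightarrow> 'v \<Rightarrow> 'v"
  assumes \<rho>_one: "\<rho> 1 = 1"
    and \<rho>_add: "\<And>x y. \<rho> (x + y) = \<rho> x + \<rho> y"
    and \<rho>_mult: "\<And>x y. \<rho> (x * y) = \<rho> x * \<rho> y"
    and dgla: "dg_lie_algebra scale UNIV G d br"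
    and \<eta>_linear: "module_hom scale scale \<eta>"
    and \<eta>_degree: "\<And>p x. x \<in> G p \<Longrightarrow> \<eta> x \<in> G (p - 1)"
    and d_\<eta>_d: "\<And>x. d (\<eta> (d x)) = d x"
    and \<eta>_\<eta>: "\<And>x. \<eta> (\<eta> x) = 0"
    and \<eta>_d_\<eta>: "\<And>x. \<eta> (d (\<eta> x)) = \<eta> x"
begin

lemma module_axioms': "module scale" ..

lemma module_homI: "(\<And>x y. h (x + y) = h x + h y) \<Longrightarrow> (\<And>c x. h (c *s x) = c *s h x) \<Longrightarrow> module_hom scale scale h"
  by (intro module_hom.intro module_hom_axioms.intro module_axioms') auto

lemma hom_additive: "module_hom scale scale h \<Longrightarrow> additive h"
  by (simp add: additive_def module_hom.add)

lemma dgla_mlinear: "n \<ge> 1 \<Longrightarrow> mlinear n (dgla_maps d br n)"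
  and dgla_degree: "n \<ge> 1 \<Longrightarrow> length xs = n \<Longrightarrow> homog G ds xs \<Longrightarrow>
    dgla_maps d br n xs \<in> G (sum_list ds + (2 - int n))"
  and dgla_antisym: "n \<ge> 1 \<Longrightarrow> length xs = n \<Longrightarrow> homog G ds xs \<Longrightarrow> \<sigma> permutes {..<n} \<Longrightarrow>
    dgla_maps d br n (permute_list \<sigma> xs) = of_int (chi ds \<sigma>) *s dgla_maps d br n xs"
  and dgla_eq: "length xs \<ge> 1 \<Longrightarrow> homog G ds xs \<Longrightarrow> insertion_sum scale (dgla_maps d br) (dgla_maps d br) ds xs = 0"
  using dgla unfolding dg_lie_algebra_def Linf_algebra_def graded_multilinear_def graded_antisymmetric_def
  by blast+

lemma dgla_maps_simps [simp]: "dgla_maps d br (Suc 0) [x] = d x" "dgla_maps d br (Suc (Suc 0)) [x, y] = br x y"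
   "dgla_maps d br (Suc (Suc (Suc n))) xs = 0"
  by (simp_all add: dgla_maps_def)

lemma d_hom: "module_hom scale scale d"
  using mlinear_update[OF dgla_mlinear[of 1], of "[0]" 0] by (intro module_homI) simp_all

lemma br_bilin: "bilin br"
  unfolding bilin_def
proof (intro conjI allI)
  fix x
  show "module_hom scale scale (br x)"
    using mlinear_update[OF dgla_mlinear[of 2], of "[x, 0]" 1] by (intro module_homI) (simp_all add: numeral_2_eq_2)
  show "module_hom scale scale (\<lambda>y. br y x)"
    using mlinear_update[OF dgla_mlinear[of 2], of "[0, x]" 0] by (intro module_homI) (simp_all add: numeral_2_eq_2)
qed

lemma scale_half: "\<rho> (1 / 2) *s x + \<rho> (1 / 2) *s x = x"
proof -
  have "\<rho> (1 / 2) + \<rho> (1 / 2) = 1" using \<rho>_one by (simp flip: \<rho>_add)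
  then show ?thesis by (simp flip: scale_left_distrib)
qed

lemma scale_third: "\<rho> (1 / 3) *s x + \<rho> (1 / 3) *s x + \<rho> (1 / 3) *s x = x"
proof -
  have "\<rho> (1 / 3) + \<rho> (1 / 3) + \<rho> (1 / 3) = 1" using \<rho>_one by (simp flip: \<rho>_add)
  then show ?thesis by (simp flip: scale_left_distrib)
qed

lemma homog_1: "homog G [p] [x] \<longleftrightarrow> x \<in> G p"
  and homog_2: "homog G [p, q] [x, y] \<longleftrightarrow> x \<in> G p \<and> y \<in> G q"
  and homog_3: "homog G [p, q, r] [x, y, z] \<longleftrightarrow> x \<in> G p \<and> y \<in> G q \<and> z \<in> G r"
  by (simp_all add: homog_def)

text \<open>The transposition of two entries is \<open>ins_perm 1 id\<close>.\<close>

lemma antisym: "br y x = - sg (p * q) (br x y)" if "x \<in> G p" "y \<in> G q"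
proof -
  have "permute_list (ins_perm 1 id) [x, y] = [y, x]"
    by (subst permute_list_ins_perm) (auto simp: permutes_id)
  moreover have "chi [p, q] (ins_perm 1 id) = ksign (1 + q * p)"
    by (subst chi_ins_perm) (auto simp: permutes_id chi_id)
  moreover have "ins_perm 1 id permutes {..<2}"
    using ins_perm_permutes[of id 1 1] by (simp add: permutes_id numeral_2_eq_2)
  ultimately have "br y x = sg (1 + q * p) (br x y)"
    using dgla_antisym[of 2 "[x, y]" "[p, q]" "ins_perm 1 id"] that
    by (simp add: homog_2 numeral_2_eq_2 scale_ksign)
  then show ?thesis by (simp add: minus_sg mult.commute add.commute)
qed

sublocale dg_lie G d br
proof (rule dg_lie.intro)
  interpret d: module_hom scale scale d by (rule d_hom)
  show "additive d" by (rule hom_additive[OF d_hom])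
  show "additive (\<lambda>x. br x y)" "additive (br x)" for x y
    by (simp_all add: additive_def bilin_simps[OF br_bilin])
  show "0 \<in> G p" "x \<in> G p \<Longrightarrow> y \<in> G p \<Longrightarrow> x + y \<in> G p" "x \<in> G p \<Longrightarrow> - x \<in> G p" for p x y
    using G_subspace by (auto intro: subspace_0 subspace_add subspace_neg)
  show d_deg: "x \<in> G p \<Longrightarrow> d x \<in> G (p + 1)" for x p
    using dgla_degree[of 1 "[x]" "[p]"] by (simp add: homog_1)
  show br_deg: "x \<in> G p \<Longrightarrow> y \<in> G q \<Longrightarrow> br x y \<in> G (p + q)" for x y p q
    using dgla_degree[of 2 "[x, y]" "[p, q]"] by (simp add: homog_2 numeral_2_eq_2)
  \<comment> \<open>the defining relation for \<open>n = 1\<close>\<close>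
  show "d (d x) = 0" for x
  proof (rule eq_0_if_homog_0[where h = "\<lambda>x. d (d x)"])
    show "additive (\<lambda>x. d (d x))" by (simp add: additive_def d.add)
    show "d (d x) = 0" if "x \<in> G p" for x p
      using dgla_eq[of "[x]" "[p]"] insertion_sum_unshuffle[of "dgla_maps d br" "dgla_maps d br" "[(p, x)]"] that
      by (simp add: homog_1)
  qed
  show anti: "br x y = - sg (p * q) (br y x)" if "x \<in> G p" "y \<in> G q" for x y p q
    using antisym[OF that(2,1)] by (simp add: mult.commute)
  \<comment> \<open>the defining relation for \<open>n = 2\<close>\<close>
  show "d (br x y) = br (d x) y + sg p (br x (d y))" if xy: "x \<in> G p" "y \<in> G q" for x y p q
  proof -
    have "br (d y) x = - sg ((q + 1) * p) (br x (d y))"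
      by (rule anti) (use xy d_deg in auto)
    moreover have "br (d x) y = d (br x y) + sg (p * q) (br (d y) x)"
      using dgla_eq[of "[x, y]" "[p, q]"] insertion_sum_unshuffle[of "dgla_maps d br" "dgla_maps d br" "[(p, x), (q, y)]"] xy
      by (auto simp: homog_2 sg_def algebra_simps split: if_splits)
    ultimately show ?thesis by (auto simp: sg_def)
  qed
  \<comment> \<open>the defining relation for \<open>n = 3\<close>, with the middle term brought into cyclic order\<close>
  show "br (br x y) z + sg (r * (p + q)) (br (br z x) y) + sg (p * (q + r)) (br (br y z) x) = 0"
    if xyz: "x \<in> G p" "y \<in> G q" "z \<in> G r" for x y z p q r
  proof -
    have s: "sg 2 u = u" "sg (q * r + 3) u = sg (1 + q * r) u" "sg (p * q + (p * r + 4)) u = sg (p * q + p * r) u" for u :: 'v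
      by (simp_all add: sg_def)
    have "br (br x y) z + sg (1 + q * r) (br (br x z) y) + sg (p * q + p * r) (br (br y z) x) = 0"
      using dgla_eq[of "[x, y, z]" "[p, q, r]"] xyz
        insertion_sum_unshuffle[of "dgla_maps d br" "dgla_maps d br" "[(p, x), (q, y), (r, z)]"]
      by (simp add: homog_3 d.zero s algebra_simps)
    moreover have "sg (1 + q * r) (br (br x z) y) = sg (r * (p + q)) (br (br z x) y)"
      unfolding anti[OF xyz(1,3)]
      by (auto simp: bilin_simps[OF br_bilin] sg_def)
    ultimately show ?thesis by (simp add: algebra_simps)
  qed
  show "x = 0" if "x + x = 0" for x :: 'v
    using scale_half[of x] that scale_right_distrib[of "\<rho> (1/2)" x x] by simp
  show "x = 0" if "x + x + x = 0" for x :: 'v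
    using scale_third[of x] that by (metis scale_right_distrib scale_zero_right)
qed

definition g where "g = (\<lambda>x y. \<eta> (br x y))"

lemma g_bilin: "bilin g"
  unfolding g_def by (rule bilin_hom[OF br_bilin \<eta>_linear])

lemma P_hom: "module_hom scale scale (proj_comm d \<eta>)"
proof -
  interpret d: module_hom scale scale d by (rule d_hom)
  interpret \<eta>: module_hom scale scale \<eta> by (rule \<eta>_linear)
  show ?thesis by (rule module_homI) (simp_all add: proj_comm_def d.add \<eta>.add d.scale \<eta>.scale scale_right_distrib scale_right_diff_distrib)
qed

lemma Pbr_bilin: "bilin (\<lambda>x y. proj_comm d \<eta> (br x y))"
  by (rule bilin_hom[OF br_bilin P_hom])

abbreviation tf :: "nat \<Rightarrow> 'v list \<Rightarrow> 'v" where "tf \<equiv> transfer_f \<rho> scale G br \<eta>"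
abbreviation tmu :: "nat \<Rightarrow> 'v list \<Rightarrow> 'v" where "tmu \<equiv> transfer_mu \<rho> scale G d br \<eta>"

definition f :: "'v glist \<Rightarrow> 'v" where
  "f zs = (if zs = [] then 0 else tf (length zs) (map snd zs))"

lemma label_all_g: "\<forall>(q, b)\<in>set_tree (label_all (- 1, g) \<phi>). bilin b"
  using g_bilin by (auto simp: label_all_def tree.set_map)

lemma label_root_Pg: "\<forall>(q, b)\<in>set_tree (label_root (0, \<lambda>x y. proj_comm d \<eta> (br x y)) (- 1, g) \<phi>). bilin b"
  using g_bilin Pbr_bilin by (cases \<phi>) (auto simp: label_all_def tree.set_map)

lemma tf_mlinear: "n \<ge> 1 \<Longrightarrow> mlinear n (tf n)"
proof (cases "n = 1")
  case True
  then show ?thesis by (intro mlinearI) (simp add: transfer_f_def)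
next
  case False
  have "mlinear n (\<lambda>xs. - (\<rho> ((- 1 / 2) ^ (n - 1)) *s (\<Sum>\<phi>\<in>Ot n. of_int (tree_sign \<phi>) *s
     tree_alt scale G (label_all (- 1, g) \<phi>) xs)))"
    by (intro mlinear_minus mlinear_scale mlinear_sum mlinear_tree_alt label_all_g) (simp add: Ot_def)
  then show ?thesis using False by (simp add: multilinear_def transfer_f_def g_def)
qed

lemma tmu_mlinear: "mlinear n (tmu n)"
proof (cases "n = 1")
  case True
  then show ?thesis by (intro mlinearI) (simp add: transfer_mu_def)
next
  case False
  have "mlinear n (\<lambda>xs. \<rho> ((- 1 / 2) ^ (n - 1)) *s (\<Sum>\<phi>\<in>Ot n. of_int (tree_sign \<phi>) *s
     tree_alt scale G (label_root (0, \<lambda>x y. proj_comm d \<eta> (br x y)) (- 1, g) \<phi>) xs))"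
    by (intro mlinear_scale mlinear_sum mlinear_tree_alt label_root_Pg) (simp add: Ot_def)
  then show ?thesis using False by (simp add: multilinear_def transfer_mu_def g_def)
qed

text \<open>For homogeneous arguments the multilinear extension disappears, and by the choice of \<open>leaf_sign\<close>
  the formula is uniform: it also covers lists with at most one entry.\<close>

lemma f_alt_tree_sum:
  assumes zs: "\<And>p x. (p, x) \<in> set zs \<Longrightarrow> x \<in> G p"
  shows "f zs = - (\<rho> ((- 1 / 2) ^ (length zs - 1)) *s alt_tree_sum g zs)"
proof -
  consider "zs = []" | z where "zs = [z]" | "2 \<le> length zs"
    by (cases zs rule: remdups_adj.cases) auto
  then show ?thesis
  proof cases
    case 3
    have "tf (length zs) (map snd zs) = - (\<rho> ((- 1 / 2) ^ (length zs - 1)) *s (\<Sum>\<phi>\<in>Ot (length zs). of_int (tree_sign \<phi>) *s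
     alternate zs (teval (label_all (- 1, g) \<phi>))))"
      unfolding transfer_f_def g_def[symmetric] using 3
      by (auto intro!: sum.cong arg_cong[of _ _ "scale _"] tree_alt_homog[OF label_all_g _ zs] simp: Ot_def)
    also have "(\<Sum>\<phi>\<in>Ot (length zs). of_int (tree_sign \<phi>) *s alternate zs (teval (label_all (- 1, g) \<phi>))) = alt_tree_sum g zs"
      unfolding alt_tree_sum_rec[OF g_bilin 3] alternate_root_sum[OF g_bilin 3, of "- 1", symmetric]
      by (simp add: alternate_sum alternate_scale label_root_self)
    finally show ?thesis using 3 by (auto simp: f_def)
  qed (simp_all add: f_def transfer_f_def \<rho>_one)
qed

lemma \<rho>_0: "\<rho> 0 = 0"
  using \<rho>_add[of 0 0] by simp

lemma \<rho>_minus: "\<rho> (- x) = - \<rho> x"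
  using \<rho>_add[of x "- x"] by (simp add: \<rho>_0 eq_neg_iff_add_eq_0 add.commute)

text \<open>If \<open>c_n = - (-1/2)^(n - 1)\<close> denotes the coefficient of \<open>f_n\<close>, then \<open>2 c_n = c_i c_j\<close> for \<open>i + j = n\<close>.
  This is where the factor \<open>-1/2\<close> comes from: it compensates for counting the blocks \<open>(A, B)\<close>
  and \<open>(B, A)\<close> separately.\<close>

lemma \<rho>_double: "\<rho> ((- 1 / 2) ^ Suc n) *s x + \<rho> ((- 1 / 2) ^ Suc n) *s x = - (\<rho> ((- 1 / 2) ^ n) *s x)"
proof -
  have "\<rho> ((- 1 / 2) ^ Suc n) + \<rho> ((- 1 / 2) ^ Suc n) = - \<rho> ((- 1 / 2) ^ n)"
    by (simp flip: \<rho>_add \<rho>_minus)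
  then show ?thesis by (simp flip: scale_left_distrib)
qed

text \<open>The bracket terms of \<open>f\<close> in terms of antisymmetrized tree sums: the coefficients of both factors
  combine to a power that depends on the total length only. It is used for \<open>h = \<eta>\<close> and for
  the projection \<open>h = 1 - [d, \<eta>]\<close>.\<close>

lemma f_bracket:
  assumes zs: "\<And>p x. (p, x) \<in> set zs \<Longrightarrow> x \<in> G p" and n: "2 \<le> length zs" and h: "module_hom scale scale h"
  shows "h (unshuffle zs (\<lambda>A B. sg (len A + (len B - 1) * deg A) (br (f A) (f B)))) =
    \<rho> ((- 1 / 2) ^ (length zs - 2)) *s unshuffle zs (\<lambda>A B. sg (len A + (len B - 1) * deg A) (h (br (alt_tree_sum g A) (alt_tree_sum g B))))"
proof -
  have "h (unshuffle zs (\<lambda>A B. sg (len A + (len B - 1) * deg A) (br (f A) (f B)))) =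
      unshuffle zs (\<lambda>A B. sg (len A + (len B - 1) * deg A) (h (br (f A) (f B))))"
    by (simp add: unshuffle_additive[OF hom_additive[OF h]] sg_additive[OF hom_additive[OF h]])
  also have "\<dots> = unshuffle zs (\<lambda>A B. \<rho> ((- 1 / 2) ^ (length zs - 2)) *s
     sg (len A + (len B - 1) * deg A) (h (br (alt_tree_sum g A) (alt_tree_sum g B))))"
  proof (rule unshuffle_cong, goal_cases)
    case (1 A B)
    show ?case
    proof (cases "A = [] \<or> B = []")
      case True
      then show ?thesis using module_hom.zero[OF h] by (auto simp: f_def bilin_simps[OF br_bilin])
    next
      case False
      have "f A = - (\<rho> ((- 1 / 2) ^ (length A - 1)) *s alt_tree_sum g A)" "f B = - (\<rho> ((- 1 / 2) ^ (length B - 1)) *s alt_tree_sum g B)"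
        by (rule f_alt_tree_sum, use 1 zs in blast)+
      moreover have "\<rho> ((- 1 / 2) ^ (length A - 1)) * \<rho> ((- 1 / 2) ^ (length B - 1)) = \<rho> ((- 1 / 2) ^ (length zs - 2))"
      proof -
        have "length zs - 2 = (length A - 1) + (length B - 1)" using 1 False by (cases A; cases B) auto
        then show ?thesis by (simp add: power_add flip: \<rho>_mult)
      qed
      ultimately show ?thesis
        by (simp add: bilin_simps[OF br_bilin] module_hom.scale[OF h] sg_scale mult.commute)
    qed
  qed
  also have "\<dots> = \<rho> ((- 1 / 2) ^ (length zs - 2)) *s unshuffle zs (\<lambda>A B. sg (len A + (len B - 1) * deg A) (h (br (alt_tree_sum g A) (alt_tree_sum g B))))"
    by (rule unshuffle_additive[symmetric]) (simp add: additive_def scale_right_distrib)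
  finally show ?thesis .
qed

lemma f_rec:
  assumes n: "2 \<le> length zs" and zs: "\<And>p x. (p, x) \<in> set zs \<Longrightarrow> x \<in> G p"
  shows "f zs + f zs = \<eta> (unshuffle zs (\<lambda>A B. sg (len A + (len B - 1) * deg A) (br (f A) (f B))))"
proof -
  have "length zs - 1 = Suc (length zs - 2)" using n by simp
  moreover have "f zs = - (\<rho> ((- 1 / 2) ^ (length zs - 1)) *s alt_tree_sum g zs)"
    by (rule f_alt_tree_sum) (rule zs)
  moreover have "\<eta> (unshuffle zs (\<lambda>A B. sg (len A + (len B - 1) * deg A) (br (f A) (f B)))) =
      \<rho> ((- 1 / 2) ^ (length zs - 2)) *s unshuffle zs (\<lambda>A B. sg (len A + (len B - 1) * deg A) (\<eta> (br (alt_tree_sum g A) (alt_tree_sum g B))))"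
    by (rule f_bracket[where h = \<eta>]) (fact zs n \<eta>_linear)+
  moreover have "\<dots> = \<rho> ((- 1 / 2) ^ (length zs - 2)) *s alt_tree_sum g zs"
    unfolding alt_tree_sum_rec[OF g_bilin n] by (simp add: g_def)
  ultimately have "f zs + f zs = - (\<rho> ((- 1 / 2) ^ Suc (length zs - 2)) *s alt_tree_sum g zs + \<rho> ((- 1 / 2) ^ Suc (length zs - 2)) *s alt_tree_sum g zs)"
    and fb: "\<eta> (unshuffle zs (\<lambda>A B. sg (len A + (len B - 1) * deg A) (br (f A) (f B)))) =
      \<rho> ((- 1 / 2) ^ (length zs - 2)) *s alt_tree_sum g zs"
    by (simp_all only: minus_add_distrib)
  note this(1)
  also have "- (\<rho> ((- 1 / 2) ^ Suc (length zs - 2)) *s alt_tree_sum g zs + \<rho> ((- 1 / 2) ^ Suc (length zs - 2)) *s alt_tree_sum g zs) = \<rho> ((- 1 / 2) ^ (length zs - 2)) *s alt_tree_sum g zs"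
    unfolding \<rho>_double by simp
  also have "\<dots> = \<eta> (unshuffle zs (\<lambda>A B. sg (len A + (len B - 1) * deg A) (br (f A) (f B))))"
    by (rule fb[symmetric])
  finally show ?thesis .
qed

lemma f_deg:
  assumes zs: "\<And>p x. (p, x) \<in> set zs \<Longrightarrow> x \<in> G p"
  shows "f zs \<in> G (deg zs + 1 - len zs)"
proof -
  have "teval (label_all (- 1, g) \<phi>) ys \<in> G (deg zs + 1 - len zs)"
    if \<phi>: "\<phi> \<in> Ot (length ys)" and ys: "length ys = length zs" "deg ys = deg zs" "mset ys = mset zs" for \<phi> ys
  proof -
    have g: "g x x' \<in> G (p + p' + - 1)" if "x \<in> G p" "x' \<in> G p'" for x x' p p'
      using \<eta>_degree[OF br_degree[OF that]] by (simp add: g_def)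
    have "teval (label_all (- 1, g) \<phi>) ys \<in> G (deg ys + tree_deg (label_all (- 1, g) \<phi>))"
    proof (rule tree_eval_degree)
      show "\<forall>(q, b)\<in>set_tree (label_all (- 1, g) \<phi>). \<forall>p p' x x'. x \<in> G p \<longrightarrow> x' \<in> G p' \<longrightarrow> b x x' \<in> G (p + p' + q)"
        using g by (auto simp: label_all_def tree.set_map)
      show "length ys = size1 (label_all (- 1, g) \<phi>)" using \<phi> by (simp add: Ot_def)
      show "x \<in> G p" if "(p, x) \<in> set ys" for p x
        using that zs mset_eq_setD[OF ys(3)] by auto
    qed
    also have "deg ys + tree_deg (label_all (- 1, g) \<phi>) = deg zs + 1 - len zs"
      using \<phi> ys by (simp add: tree_deg_label_all Ot_def)
    finally show ?thesis .
  qed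
  then have ts: "tree_sum g ys \<in> G (deg zs + 1 - len zs)"
    if "length ys = length zs" "deg ys = deg zs" "mset ys = mset zs" for ys
    unfolding tree_sum_def using that by (intro subspace_sum subspace_scale G_subspace) auto
  have *: "alt_tree_sum g zs \<in> G (deg zs + 1 - len zs)"
    unfolding alt_tree_sum_def alternate_def
  proof (intro subspace_sum subspace_scale G_subspace ts)
    fix \<sigma> assume \<sigma>: "\<sigma> \<in> {\<sigma>. \<sigma> permutes {..<length zs}}"
    then show m: "mset (permute_list \<sigma> zs) = mset zs" by simp
    then have "mset (map fst (permute_list \<sigma> zs)) = mset (map fst zs)" by simp
    then show "deg (permute_list \<sigma> zs) = deg zs" unfolding deg_def by (metis sum_mset_sum_list)
  qed simp
  have fz: "f zs = - (\<rho> ((- 1 / 2) ^ (length zs - 1)) *s alt_tree_sum g zs)"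
    by (rule f_alt_tree_sum) (rule zs)
  show ?thesis unfolding fz by (intro subspace_neg subspace_scale G_subspace *)
qed

sublocale transfer G d br \<eta> f
proof
  interpret \<eta>: module_hom scale scale \<eta> by (rule \<eta>_linear)
  show "\<eta> (x + y) = \<eta> x + \<eta> y" for x y by (rule \<eta>.add)
  show "f [] = 0" by (simp add: f_def)
  show "f [z] = snd z" for z by (simp add: f_def transfer_f_def)
  show "f zs = 0" if "0 \<in> snd ` set zs" for zs
    using that mlinear_zero[OF tf_mlinear[of "length zs"], of "map snd zs"] by (cases zs) (auto simp: f_def Suc_le_eq)
qed (use d_\<eta>_d \<eta>_d_\<eta> \<eta>_\<eta> \<eta>_degree f_deg f_rec in auto)


section \<open>The structure on the kernel and the quasi-isomorphism\<close>

abbreviation H :: "'v set" where "H \<equiv> ker_comm d \<eta>"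
abbreviation GH :: "int \<Rightarrow> 'v set" where "GH \<equiv> \<lambda>p. H \<inter> G p"

lemma H_subspace: "subspace H"
proof -
  interpret P: module_hom scale scale "\<lambda>x. x - proj_comm d \<eta> x"
    by (rule module_homI)
      (simp_all add: module_hom.add[OF P_hom] module_hom.scale[OF P_hom] scale_right_diff_distrib)
  have eq: "H = {x. x - proj_comm d \<eta> x = 0}" by (auto simp: ker_comm_def proj_comm_def add.commute)
  show ?thesis unfolding eq by (rule P.subspace_kernel)
qed

text \<open>Homogeneous components of elements of \<open>H\<close> are in \<open>H\<close>, because \<open>d\<close> and \<open>\<eta>\<close> are homogeneous.\<close>

lemma hcomp_H: assumes "x \<in> H" shows "hcomp G x p \<in> H"
proof -
  have "\<eta> y \<in> G (q + (- 1))" if "y \<in> G q" for y q using \<eta>_degree[OF that] by simp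
  from hcomp_map[OF \<eta>_additive this] have "\<eta> (hcomp G x p) = hcomp G (\<eta> x) (p - 1)"
    by simp
  moreover have "d (hcomp G x p) = hcomp G (d x) (p + 1)"
    using hcomp_map[OF d_additive d_degree, of x "p + 1"] by simp
  moreover have "hcomp G 0 q = 0" for q
    using hcomp_homog[OF zero_G, of q] by simp
  ultimately show ?thesis using ker_d[OF assms] ker_\<eta>[OF assms] by (intro kerI) simp_all
qed

lemma graded_H: "graded_module scale H GH"
proof (intro graded_module.intro graded_module_axioms.intro module_axioms')
  show "subspace H" by (rule H_subspace)
  show "subspace (H \<inter> G p)" for p by (rule subspace_inter[OF H_subspace G_subspace])
  show "H \<inter> G p \<subseteq> H" for p by blast
  fix x assume x: "x \<in> H"
  show "\<exists>!c. is_decomp GH x c"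
  proof (rule ex1I)
    show "is_decomp GH x (hcomp G x)"
      using decomp_hcomp[of x] hcomp_H[OF x] by (simp add: is_decomp_def)
    show "c = hcomp G x" if "is_decomp GH x c" for c
      using that by (intro hcomp_eqI[symmetric]) (simp add: is_decomp_def)
  qed
qed

lemma homog_zip_ker: "homog GH ds xs \<Longrightarrow> homog_ker (zip ds xs)"
  and homog_zip: "homog GH ds xs \<Longrightarrow> length ds = length xs"
  by (auto simp: homog_def homog_ker_def set_zip list_all2_conv_all_nth)

lemma homog_ker_G: "homog_ker zs \<Longrightarrow> (p, x) \<in> set zs \<Longrightarrow> x \<in> G p"
  by (auto simp: homog_ker_def)

lemma tf_f: "zs \<noteq> [] \<Longrightarrow> length zs = n \<Longrightarrow> tf n (map snd zs) = f zs"
  by (auto simp: f_def)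

lemma tmu_alternate:
  assumes n: "2 \<le> length zs" and zs: "\<And>p x. (p, x) \<in> set zs \<Longrightarrow> x \<in> G p"
  shows "tmu (length zs) (map snd zs) = \<rho> ((- 1 / 2) ^ (length zs - 1)) *s
    alternate zs (\<lambda>ys. \<Sum>\<phi>\<in>Ot (length zs). of_int (tree_sign \<phi>) *s
      teval (label_root (0, \<lambda>x y. proj_comm d \<eta> (br x y)) (- 1, g) \<phi>) ys)"
proof -
  have "tree_alt scale G (label_root (0, \<lambda>x y. proj_comm d \<eta> (br x y)) (- 1, g) \<phi>) (map snd zs) =
      alternate zs (teval (label_root (0, \<lambda>x y. proj_comm d \<eta> (br x y)) (- 1, g) \<phi>))" if "\<phi> \<in> Ot (length zs)" for \<phi>
    by (rule tree_alt_homog[OF label_root_Pg _ zs]) (use that in \<open>simp_all add: Ot_def\<close>)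
  then show ?thesis
    using n by (simp add: transfer_mu_def alternate_sum alternate_scale flip: g_def)
qed

text \<open>The tree formula for \<open>\<mu>_n\<close> differs from that for \<open>f_n\<close> by the map at the root and by the outer sign;
  by the recursion at the root it equals \<open>- P Q\<close>.\<close>

lemma tmu_mu:
  assumes "zs \<noteq> []" "length zs = n" "homog_ker zs"
  shows "tmu n (map snd zs) = \<mu> zs"
proof (cases "2 \<le> n")
  case False
  with assms(1,2) obtain z where "zs = [z]" by (cases zs rule: remdups_adj.cases) auto
  with assms(2) show ?thesis by (auto simp: transfer_mu_def)
next
  case True
  then have n: "2 \<le> length zs" using assms by simp
  note zs = homog_ker_G[OF assms(3)]
  let ?U = "unshuffle zs (\<lambda>A B. sg (len A + (len B - 1) * deg A) (proj_comm d \<eta> (br (alt_tree_sum g A) (alt_tree_sum g B))))"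
  have t: "tmu (length zs) (map snd zs) = \<rho> ((- 1 / 2) ^ (length zs - 1)) *s ?U"
    by (simp add: tmu_alternate[OF n zs] alternate_root_sum[OF Pbr_bilin n])
  have "length zs - 1 = Suc (length zs - 2)" using n by simp
  then have "tmu (length zs) (map snd zs) + tmu (length zs) (map snd zs) = - (\<rho> ((- 1 / 2) ^ (length zs - 2)) *s ?U)"
    unfolding t by (simp only: \<rho>_double)
  also have "\<dots> = - proj_comm d \<eta> (Q zs + Q zs)"
    unfolding Q_double[OF assms(3)] by (simp only: f_bracket[where h = "proj_comm d \<eta>", OF zs n P_hom])
  also have "\<dots> = \<mu> zs + \<mu> zs" by (simp add: \<mu>_def P.add)
  finally show ?thesis using assms(2) by (auto intro: double_cancel)
qed

lemma multilinear_restrict: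
  assumes "mlinear n F" "\<And>xs. length xs = n \<Longrightarrow> F xs \<in> N"
  shows "multilinear scale M scale N n F"
  using assms by (auto simp: multilinear_def)

lemma tmu_H: "tmu n xs \<in> H" if "n \<ge> 1" "length xs = n"
proof (cases "n = 1")
  case True
  then show ?thesis by (simp add: transfer_mu_def subspace_0 H_subspace)
next
  case False
  have "tree_eval scale (label_root (0, \<lambda>x y. proj_comm d \<eta> (br x y)) (- 1, g) \<phi>) ds ys \<in> H"
    if "\<phi> \<in> Ot n" for \<phi> ds ys
    using that False \<open>n \<ge> 1\<close> proj_ker
    by (cases \<phi>) (auto simp: Ot_def intro!: subspace_scale H_subspace)
  then show ?thesis using False
    by (simp add: transfer_mu_def tree_alt_def homog_extension_def flip: g_def)
      (intro subspace_scale subspace_sum H_subspace; simp)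
qed

lemma tf_antisym: "n \<ge> 1 \<Longrightarrow> graded_antisymmetric GH scale n (tf n)"
  unfolding graded_antisymmetric_def
proof (intro allI impI, elim conjE)
  fix ds xs \<sigma> assume n: "1 \<le> n" "length xs = n" and h: "homog GH ds xs" and \<sigma>: "\<sigma> permutes {..<n}"
  define zs where "zs = zip ds xs"
  have l: "length ds = n" "length zs = n" using homog_zip[OF h] n by (simp_all add: zs_def)
  have m: "map snd zs = xs" "map fst zs = ds" using l n by (simp_all add: zs_def)
  have \<sigma>': "\<sigma> permutes {..<length zs}" using \<sigma> l by simp
  have zs: "x \<in> G p" if "(p, x) \<in> set zs" for p x
    using homog_ker_G homog_zip_ker[OF h] that unfolding zs_def by blast
  have zs': "x \<in> G p" if "(p, x) \<in> set (permute_list \<sigma> zs)" for p x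
    using zs that \<sigma>' by simp
  have f1: "f zs = - (\<rho> ((- 1 / 2) ^ (length zs - 1)) *s alt_tree_sum g zs)"
    by (rule f_alt_tree_sum) (rule zs)
  have f2: "f (permute_list \<sigma> zs) = - (\<rho> ((- 1 / 2) ^ (length (permute_list \<sigma> zs) - 1)) *s alt_tree_sum g (permute_list \<sigma> zs))"
    by (rule f_alt_tree_sum) (rule zs')
  have "permute_list \<sigma> zs \<noteq> []" using l n by (metis length_permute_list list.size(3) not_one_le_zero)
  moreover have "permute_list \<sigma> xs = map snd (permute_list \<sigma> zs)" using \<sigma>' m by (simp flip: permute_list_map)
  ultimately have "tf n (permute_list \<sigma> xs) = f (permute_list \<sigma> zs)"
    using tf_f[of "permute_list \<sigma> zs" n] l by simp
  also have "\<dots> = of_int (chi ds \<sigma>) *s f zs"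
    unfolding f1 f2 by (simp add: alt_tree_sum_def alternate_permute[OF \<sigma>'] m mult.commute)
  also have "f zs = tf n xs" using l n m(1) by (cases "zs = []") (simp_all add: f_def del: map_eq_Cons_conv)
  finally show "tf n (permute_list \<sigma> xs) = of_int (chi ds \<sigma>) *s tf n xs" .
qed

lemma tmu_antisym: "n \<ge> 1 \<Longrightarrow> graded_antisymmetric GH scale n (tmu n)"
  unfolding graded_antisymmetric_def
proof (intro allI impI, elim conjE)
  fix ds xs \<sigma> assume n: "1 \<le> n" "length xs = n" and h: "homog GH ds xs" and \<sigma>: "\<sigma> permutes {..<n}"
  define zs where "zs = zip ds xs"
  have l: "length ds = n" "length zs = n" using homog_zip[OF h] n by (simp_all add: zs_def)
  have m: "map snd zs = xs" "map fst zs = ds" using l n by (simp_all add: zs_def)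
  have \<sigma>': "\<sigma> permutes {..<length zs}" using \<sigma> l by simp
  have zs: "x \<in> G p" if "(p, x) \<in> set zs" for p x
    using homog_ker_G homog_zip_ker[OF h] that unfolding zs_def by blast
  have zs': "x \<in> G p" if "(p, x) \<in> set (permute_list \<sigma> zs)" for p x
    using zs that \<sigma>' by simp
  show "tmu n (permute_list \<sigma> xs) = of_int (chi ds \<sigma>) *s tmu n xs"
  proof (cases "n = 1")
    case False
    then have n2: "2 \<le> length zs" "2 \<le> length (permute_list \<sigma> zs)" using n l by simp_all
    have "permute_list \<sigma> xs = map snd (permute_list \<sigma> zs)" using \<sigma>' m by (simp flip: permute_list_map)
    then show ?thesis
      using tmu_alternate[OF n2(1) zs] tmu_alternate[OF n2(2) zs']
      by (simp add: alternate_permute[OF \<sigma>'] m l mult.commute)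
  qed (simp add: transfer_mu_def)
qed

text \<open>The assumption \<open>F'0\<close> removes the terms where \<open>\<mu>\<close> takes no entry: they occur among the unshuffles,
  whereas insertion sums start with \<open>k = 1\<close>.\<close>

lemma insertion_tmu:
  assumes zs: "homog_ker zs" and F: "\<And>ys. homog_ker ys \<Longrightarrow> ys \<noteq> [] \<Longrightarrow> F (length ys) (map snd ys) = F' ys"
    and F'0: "\<And>ys. F' (mu_entry [] # ys) = 0"
  shows "insertion_sum scale F tmu (map fst zs) (map snd zs) =
    unshuffle zs (\<lambda>A B. sg (len A * len B) (F' (mu_entry A # B)))"
  unfolding insertion_sum_unshuffle
proof (rule unshuffle_cong, goal_cases)
  case (1 A B)
  have H: "homog_ker A" "homog_ker B" using homog_ker_subset[OF zs] 1 by auto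
  show ?case
  proof (cases "A = []")
    case False
    then show ?thesis using F[OF homog_ker_mu_entry[OF H]] tmu_mu[OF False refl H(1)] by simp
  qed (simp add: F'0)
qed

lemma map_zip_homog: "homog GH ds xs \<Longrightarrow> map fst (zip ds xs) = ds \<and> map snd (zip ds xs) = xs"
  using homog_zip by simp

lemma f_mu_entry_Nil: "f (mu_entry [] # ys) = 0"
  by (rule f_zero) simp

lemma mu_mu_entry_Nil: "\<mu> (mu_entry [] # ys) = 0"
proof -
  have "f (mu_entry [] # A) = 0" for A by (rule f_zero) simp
  then have "Q (mu_entry [] # ys) = 0" by (simp add: brl.zero unshuffle_zero)
  then show ?thesis by (simp add: \<mu>_def P.zero del: half_bracket.simps)
qed

theorem Linf_H: "Linf_algebra scale H GH tmu"
  unfolding Linf_algebra_def graded_multilinear_def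
proof (intro conjI allI impI graded_H)
  fix n :: nat assume n: "1 \<le> n"
  show "multilinear scale H scale H n (tmu n)"
    by (rule multilinear_restrict[OF tmu_mlinear]) (rule tmu_H[OF n])
  show "graded_antisymmetric GH scale n (tmu n)" by (rule tmu_antisym[OF n])
  fix ds xs assume "length xs = n \<and> homog GH ds xs"
  then have h: "length xs = n" "homog GH ds xs" by simp_all
  define zs where "zs = zip ds xs"
  have zs: "homog_ker zs" "length zs = n" "zs \<noteq> []" "map fst zs = ds" "map snd zs = xs"
    using homog_zip_ker[OF h(2)] map_zip_homog[OF h(2)] homog_zip[OF h(2)] h(1) n by (auto simp: zs_def)
  have "tmu n xs = \<mu> zs" using tmu_mu[OF zs(3,2,1)] zs by simp
  moreover have "\<mu> zs \<in> G (deg zs + (2 - int n))"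
    using Q_degree[OF zs(1)] zs(2) by (simp add: \<mu>_def minus_G proj_degree algebra_simps)
  ultimately show "tmu n xs \<in> H \<inter> G (sum_list ds + (2 - int n))"
    using tmu_H[OF n h(1)] zs by (simp add: deg_def)
  show "insertion_sum scale tmu tmu ds xs = 0"
    using insertion_tmu[OF zs(1), of tmu \<mu>] mu_mu[OF zs(1)] mu_mu_entry_Nil tmu_mu zs by simp
qed

theorem Linf_morphism_f: "Linf_morphism scale H GH tmu scale UNIV G d br tf"
  unfolding Linf_morphism_def graded_multilinear_def
proof (intro conjI allI impI Linf_H dgla)
  fix n :: nat assume n: "1 \<le> n"
  show "multilinear scale H scale UNIV n (tf n)"
    by (rule multilinear_restrict[OF tf_mlinear[OF n]]) simp
  show "graded_antisymmetric GH scale n (tf n)" by (rule tf_antisym[OF n])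
  fix ds xs assume "length xs = n \<and> homog GH ds xs"
  then have h: "length xs = n" "homog GH ds xs" by simp_all
  define zs where "zs = zip ds xs"
  have zs: "homog_ker zs" "length zs = n" "zs \<noteq> []" "map fst zs = ds" "map snd zs = xs"
    using homog_zip_ker[OF h(2)] map_zip_homog[OF h(2)] homog_zip[OF h(2)] h(1) n by (auto simp: zs_def)
  have f: "tf n xs = f zs" using tf_f[OF zs(3,2)] zs by simp
  then show "tf n xs \<in> G (sum_list ds + (1 - int n))"
    using f_degree[OF zs(1)] zs by (simp add: deg_def algebra_simps)
  obtain z ys where z: "zs = z # ys" using zs(3) by (cases zs) auto
  have "bracket_sum scale br tf ds xs = Q zs"
    unfolding zs(4,5)[symmetric] z bracket_sum_unshuffle half_bracket.simps
    by (intro unshuffle_cong) (simp add: f_def brr.zero)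
  moreover have "insertion_sum scale tf tmu ds xs = f_after_mu zs"
    using insertion_tmu[OF zs(1), of tf f] tf_f f_mu_entry_Nil zs by (simp add: f_after_mu_def)
  ultimately show "d (tf n xs) - bracket_sum scale br tf ds xs = insertion_sum scale tf tmu ds xs"
    using morphism_eq[OF zs(1)] f by simp
qed

text \<open>On homogeneous arguments this is the recursion for two entries; both sides are biadditive.\<close>

lemma tf_2: "tf 2 [x, y] = - \<eta> (br x y)"
proof -
  interpret \<eta>: module_hom scale scale \<eta> by (rule \<eta>_linear)
  have hom: "tf 2 [x, y] = - \<eta> (br x y)" if "x \<in> G p" "y \<in> G q" for x y p q
  proof (rule double_cancel)
    have "tf 2 [x, y] = f [(p, x), (q, y)]" by (simp add: f_def numeral_2_eq_2)
    then have "tf 2 [x, y] + tf 2 [x, y] = \<eta> (unshuffle [(p, x), (q, y)] (\<lambda>A B. sg (len A + (len B - 1) * deg A) (br (f A) (f B))))"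
      using f_rec[of "[(p, x), (q, y)]"] that by auto
    also have "\<dots> = \<eta> (- br x y + - br x y)"
      using antisymmetry[OF that(2,1)]
      by (simp add: f_single f_Nil brl.zero brr.zero) (auto simp: sg_def)
    finally show "tf 2 [x, y] + tf 2 [x, y] = - \<eta> (br x y) + - \<eta> (br x y)"
      by (simp add: \<eta>.add \<eta>.neg \<eta>.diff)
  qed
  have add: "additive (\<lambda>x. tf 2 [x, y] + \<eta> (br x y))" "additive (\<lambda>y. tf 2 [x, y] + \<eta> (br x y))" for x y
    using mlinear_update(1)[OF tf_mlinear[of 2], of "[0, y]" 0] mlinear_update(1)[OF tf_mlinear[of 2], of "[x, 0]" 1]
    by (simp_all add: additive_def brl.add brr.add \<eta>.add)
  have "tf 2 [x, y] + \<eta> (br x y) = 0" if "x \<in> G p" for x y p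
    by (rule eq_0_if_homog_0[OF add(2)]) (use hom[OF that] in simp)
  then have "tf 2 [x, y] + \<eta> (br x y) = 0"
    by (rule eq_0_if_homog_0[OF add(1)])
  then show ?thesis by (simp add: eq_neg_iff_add_eq_0)
qed

text \<open>Every class of cocycles has exactly one representative in \<open>H\<close>: a cocycle \<open>x\<close> differs from
  \<open>(1 - [d, \<eta>]) x\<close> by \<open>d (\<eta> x)\<close>, and the projection, which is the identity on \<open>H\<close>, kills
  coboundaries.\<close>

theorem quasi_iso: "quasi_isomorphism scale H GH (\<lambda>x. tmu 1 [x]) scale UNIV G d (\<lambda>x. tf 1 [x])"
  unfolding quasi_isomorphism_def
proof (intro conjI allI ballI)
  have f1: "tf 1 [x] = x" and mu1: "tmu 1 [x] = 0" for x by (simp_all add: transfer_f_def transfer_mu_def)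
  show "graded_multilinear scale H GH scale UNIV G 1 0 (\<lambda>xs. tf 1 [xs ! 0])"
    unfolding graded_multilinear_def f1
    by (auto simp: multilinear_def homog_def length_Suc_conv list_all2_Cons2)
  show "tf 1 [tmu 1 [x]] = d (tf 1 [x])" if "x \<in> H" for x
    using ker_d[OF that] by (simp only: f1 mu1)
  fix p
  let ?c = "\<lambda>x. coh_rel G d p `` {x}"
  have eqv: "equiv {x \<in> G p. d x = 0} (coh_rel G d p)"
  proof (rule equivI)
    show "coh_rel G d p \<subseteq> {x \<in> G p. d x = 0} \<times> {x \<in> G p. d x = 0}"
      by (auto simp: coh_rel_def)
    show "refl_on {x \<in> G p. d x = 0} (coh_rel G d p)"
      using zero_G d.zero by (auto simp: refl_on_def coh_rel_def image_iff intro!: bexI[of _ 0])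
    show "sym (coh_rel G d p)"
    proof (rule symI)
      fix x y assume xy: "(x, y) \<in> coh_rel G d p"
      then obtain w where w: "x - y = d w" "w \<in> G (p - 1)" by (auto simp: coh_rel_def)
      have "y - x = d (- w)" using w(1) by (simp add: d.minus flip: w(1))
      with xy minus_G[OF w(2)] show "(y, x) \<in> coh_rel G d p" by (auto simp: coh_rel_def)
    qed
    show "trans (coh_rel G d p)"
    proof (rule transI)
      fix x y z assume xy: "(x, y) \<in> coh_rel G d p" and yz: "(y, z) \<in> coh_rel G d p"
      then obtain w w' where w: "x - y = d w" "w \<in> G (p - 1)" "y - z = d w'" "w' \<in> G (p - 1)"
        by (auto simp: coh_rel_def)
      have "x - z = d (w + w')" by (simp add: d.add flip: w(1,3))
      with xy yz add_G[OF w(2,4)] show "(x, z) \<in> coh_rel G d p" by (auto simp: coh_rel_def)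
    qed
  qed
  have coh_H: "cohomology GH (\<lambda>x. tmu 1 [x]) p = (\<lambda>x. {x}) ` (H \<inter> G p)"
  proof -
    have "coh_rel GH (\<lambda>x. tmu 1 [x]) p = {(x, x) | x. x \<in> H \<inter> G p}"
      using subspace_0[OF H_subspace] zero_G by (auto simp: coh_rel_def mu1[unfolded One_nat_def] image_iff)
    then show ?thesis by (auto simp: cohomology_def quotient_def mu1[unfolded One_nat_def])
  qed
  have "inj_on ?c (H \<inter> G p)"
  proof (rule inj_onI)
    fix x y assume xy: "x \<in> H \<inter> G p" "y \<in> H \<inter> G p" "?c x = ?c y"
    then have "(x, y) \<in> coh_rel G d p"
      using eq_equiv_class[OF xy(3) eqv] ker_d by auto
    then obtain w where w: "x - y = d w" by (auto simp: coh_rel_def)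
    have "proj_comm d \<eta> v = v" if "v \<in> H" for v using that by (simp add: ker_comm_def proj_comm_def)
    moreover have "x - y \<in> H" using xy H_subspace by (auto intro: subspace_diff)
    ultimately have "x - y = proj_comm d \<eta> (d w)" using w by metis
    then show "x = y" by (simp add: proj_d)
  qed
  moreover have "?c ` (H \<inter> G p) = cohomology G d p"
  proof (intro equalityI subsetI)
    fix c assume "c \<in> ?c ` (H \<inter> G p)"
    then show "c \<in> cohomology G d p" using ker_d by (auto simp: cohomology_def intro: quotientI)
  next
    fix c assume "c \<in> cohomology G d p"
    then obtain x where x: "x \<in> G p" "d x = 0" "c = ?c x" by (auto simp: cohomology_def elim: quotientE)
    have P: "proj_comm d \<eta> x = x - d (\<eta> x)" using x by (simp add: proj_comm_def \<eta>.zero)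
    have "(x, proj_comm d \<eta> x) \<in> coh_rel G d p"
      using x proj_degree[OF x(1)] \<eta>_degree[OF x(1)] by (auto simp: coh_rel_def P d.diff d_d)
    then have "c = ?c (proj_comm d \<eta> x)" using equiv_class_eq[OF eqv] x(3) by blast
    then show "c \<in> ?c ` (H \<inter> G p)" using proj_ker proj_degree[OF x(1)] by blast
  qed
  ultimately have bij: "bij_betw ?c (H \<inter> G p) (cohomology G d p)" by (simp add: bij_betw_def)
  have "bij_betw (\<lambda>c. coh_rel G d p `` c) ((\<lambda>x. {x}) ` (H \<inter> G p)) (cohomology G d p)"
    using bij inj_on_imageI[of "\<lambda>c. coh_rel G d p `` c" "\<lambda>x. {x}" "H \<inter> G p"]
    by (simp add: bij_betw_def image_image comp_def)
  then show "bij_betw (\<lambda>c. coh_rel G d p `` ((\<lambda>x. tf 1 [x]) ` c)) (cohomology GH (\<lambda>x. tmu 1 [x]) p) (cohomology G d p)"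
    unfolding coh_H f1 by simp
qed

end

theorem theorem4p5:
  fixes \<rho> :: "rat \<Rightarrow> 'k::comm_ring_1"
    and scale :: "'k \<Rightarrow> 'v::ab_group_add \<Rightarrow> 'v"
    and G :: "int \<Rightarrow> 'v set"
    and d \<eta> :: "'v \<Rightarrow> 'v"
    and br :: "'v \<Rightarrow> 'v \<Rightarrow> 'v"
  assumes \<rho>_one: "\<rho> 1 = 1"
    and \<rho>_add: "\<And>x y. \<rho> (x + y) = \<rho> x + \<rho> y"
    and \<rho>_mult: "\<And>x y. \<rho> (x * y) = \<rho> x * \<rho> y"
    and dgla: "dg_lie_algebra scale UNIV G d br"
    and \<eta>_linear: "module_hom scale scale \<eta>"
    and \<eta>_degree: "\<And>p x. x \<in> G p \<Longrightarrow> \<eta> x \<in> G (p - 1)"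
    and d_\<eta>_d: "\<And>x. d (\<eta> (d x)) = d x"
    and \<eta>_\<eta>: "\<And>x. \<eta> (\<eta> x) = 0"
    and \<eta>_d_\<eta>: "\<And>x. \<eta> (d (\<eta> x)) = \<eta> x"
  shows "Linf_quasi_isomorphism
           scale (ker_comm d \<eta>) (\<lambda>p. ker_comm d \<eta> \<inter> G p) (transfer_mu \<rho> scale G d br \<eta>)
           scale UNIV G d br
           (transfer_f \<rho> scale G br \<eta>)
         \<and> (\<forall>x\<in>ker_comm d \<eta>. \<forall>y\<in>ker_comm d \<eta>. transfer_f \<rho> scale G br \<eta> 2 [x, y] = - \<eta> (br x y))"
proof -
  have graded: "graded_module scale UNIV G"
    using dgla by (simp add: dg_lie_algebra_def Linf_algebra_def)
  then interpret dg_contraction scale G \<rho> d \<eta> br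
    by (intro dg_contraction.intro dg_contraction_axioms.intro graded_ambient.intro
        graded_ambient_axioms.intro graded_sums.intro graded_module.axioms(1) assms)
  show ?thesis
    unfolding Linf_quasi_isomorphism_def using Linf_morphism_f quasi_iso tf_2 by blast
qed

end
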